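(* Let $\mathbb F_q$ be a finite field of cardinality $q$ and characteristic different from $2$. Let $G=Sp_4(\mathbb F_q((\pi)))$, $K=Sp_4(\mathbb F_q[[\pi]])$, $\Gamma=Sp_4(\mathbb F_q[\pi^{-1}])$, and let $H\subsetneq\Gamma$ be the subgroup of upper triangular unipotent matrices in $\Gamma$. Then $H$ has property $(T_{Schur},G,K)$. As a consequence, the non-cocompact lattice $\Gamma$ of $G$ also has property $(T_{Schur},G,K)$.
   Context: $Sp_4(R)$ denotes the group of matrices $A\in M_4(R)$ with $AJ\,{}^tA=J$, where $J=\begin{pmatrix}0&0&0&1\\0&0&1&0\\0&-1&0&0\\-1&0&0&0\end{pmatrix}$. $\mathbb F_q((\pi))$ is the local field of Laurent series in $\pi$, $\mathbb F_q[[\pi]]$ its ring of integers, and $\mathbb F_q[\pi^{-1}]$ the polynomial ring in $\pi^{-1}$. A continuous length function on a locally compact group $G$ is a continuous $\ell:G\to\mathbb R_{\ge0}$ with $\ell(1)=0$, $\ell(g^{-1})=\ell(g)$, $\ell(gh)\le\ell(g)+\ell(h)$; $B_n=\{g\in G:\ell(g)\le n\}$. Let $G$ be a non-compact locally compact group, $K\subsetneq G$ a compact subgroup, $L\subseteq G$ a non-compact closed subgroup. For $c\in C(G)$ (a continuous complex function on $G$) and $f\in C_c(L)$ put $(\mathrm{Schur}_c f)(h)=c(h)f(h)$ for $h\in L$. Given a continuous length function $\ell$ on $G$, put $$\|\mathrm{Schur}_c|_{C(L\cap B_n)}\|=\sup\{\|\mathrm{Schur}_cf\|_{C^*_r(L)}: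 f\in C_c(L),\ \mathrm{supp}(f)\subset B_n,\ \|f\|_{C^*_r(L)}\le1\},$$ where $C_r^*(L)$ is the reduced $C^*$-algebra of $L$. Definition. $L$ has property $(T_{Schur},G,K)$ if for every continuous length function $\ell:G\to\mathbb R_{\ge0}$ there exists $s_0>0$ such that for every $s\in[0,s_0)$ there exists a continuous function $\phi\in C_0(G)$ vanishing at infinity such that for every $C>0$ and every $K$-biinvariant $c\in C(G)$ satisfying $\|\mathrm{Schur}_c|_{C(L\cap B_n)}\|\le Ce^{sn}$ for all $n\in\mathbb N$, there exists $c_\infty\in\mathbb C$ with $|c(g)-c_\infty|\le C\phi(g)$ for all $g\in G$. *)

theory Defs
  imports
    "HOL-Analysis.Analysis"
    "HOL-Algebra.Group"
    "HOL-Computational_Algebra.Formal_Laurent_Series"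
begin

section \<open>Locally compact groups and reduced norms\<close>

text \<open>
  A topological group is a HOL-Algebra group whose carrier is a subset of a Hausdorff
  space and carries the subspace topology. A subgroup \<open>L\<close> of \<open>G\<close> is regarded as the
  group \<open>G\<lparr>carrier := L\<rparr>\<close>. Functions on the group are only used on the carrier.
\<close>

definition locally_compact_group :: "('a::t2_space) monoid \<Rightarrow> bool" where
  "locally_compact_group G \<longleftrightarrow>
     group G \<and>
     continuous_on (carrier G \<times> carrier G) (\<lambda>(x, y). x \<otimes>\<^bsub>G\<^esub> y) \<and>
     continuous_on (carrier G) (\<lambda>x. inv\<^bsub>G\<^esub> x) \<and>
     locally_compact_space (top_of_set (carrier G))"

definition is_left_haar :: "('a::t2_space) monoid \<Rightarrow> 'a measure \<Rightarrow> bool" where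
  "is_left_haar G \<mu> \<longleftrightarrow>
     sets \<mu> = sets (restrict_space borel (carrier G)) \<and>
     emeasure \<mu> (carrier G) \<noteq> 0 \<and>
     (\<forall>Q. compact Q \<and> Q \<subseteq> carrier G \<longrightarrow> emeasure \<mu> Q < \<infinity>) \<and>
     (\<forall>A\<in>sets \<mu>. emeasure \<mu> A =
        (INF U\<in>{U. openin (top_of_set (carrier G)) U \<and> A \<subseteq> U}. emeasure \<mu> U)) \<and>
     (\<forall>U. openin (top_of_set (carrier G)) U \<longrightarrow>
        emeasure \<mu> U = (SUP Q\<in>{Q. compact Q \<and> Q \<subseteq> U}. emeasure \<mu> Q)) \<and>
     (\<forall>g\<in>carrier G. \<forall>A\<in>sets \<mu>. emeasure \<mu> ((\<lambda>x. g \<otimes>\<^bsub>G\<^esub> x) ` A) = emeasure \<mu> A)"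

text \<open>
  A Haar measure is unique up to a positive factor. Replacing \<open>\<mu>\<close> by \<open>a \<mu>\<close> multiplies
  \<open>reduced_norm\<close> by \<open>a\<close>, hence leaves \<open>schur_norm\<close> below unchanged.
\<close>

definition left_haar :: "('a::t2_space) monoid \<Rightarrow> 'a measure" where
  "left_haar G = (SOME \<mu>. is_left_haar G \<mu>)"

definition supp_on :: "('a::t2_space) monoid \<Rightarrow> ('a \<Rightarrow> complex) \<Rightarrow> 'a set" where
  "supp_on G f = top_of_set (carrier G) closure_of {x \<in> carrier G. f x \<noteq> 0}"

definition Cc :: "('a::t2_space) monoid \<Rightarrow> ('a \<Rightarrow> complex) set" where
  "Cc G = {f. continuous_on (carrier G) f \<and> compact (supp_on G f)}"

definition square_integrable :: "'a measure \<Rightarrow> ('a \<Rightarrow> complex) \<Rightarrow> bool" where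
  "square_integrable \<mu> \<xi> \<longleftrightarrow>
     \<xi> \<in> borel_measurable \<mu> \<and> integrable \<mu> (\<lambda>x. (cmod (\<xi> x))\<^sup>2)"

definition norm_L2 :: "'a measure \<Rightarrow> ('a \<Rightarrow> complex) \<Rightarrow> real" where
  "norm_L2 \<mu> \<xi> = sqrt (LINT x|\<mu>. (cmod (\<xi> x))\<^sup>2)"

definition convol ::
    "('a::t2_space) monoid \<Rightarrow> ('a \<Rightarrow> complex) \<Rightarrow> ('a \<Rightarrow> complex) \<Rightarrow> 'a \<Rightarrow> complex" where
  "convol G f \<xi> x = (LINT y|left_haar G. f y * \<xi> (inv\<^bsub>G\<^esub> y \<otimes>\<^bsub>G\<^esub> x))"

text \<open>
  The norm of \<open>f \<in> Cc G\<close> in the reduced C*-algebra: the operator norm of \<open>\<xi> \<mapsto> f * \<xi>\<close> on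
  \<open>L\<^sup>2(G)\<close>. The supremum is over a set bounded by the \<open>L\<^sup>1\<close>-norm of \<open>f\<close>.
\<close>

definition reduced_norm :: "('a::t2_space) monoid \<Rightarrow> ('a \<Rightarrow> complex) \<Rightarrow> real" where
  "reduced_norm G f =
     (SUP \<xi>\<in>{\<xi>. square_integrable (left_haar G) \<xi> \<and> norm_L2 (left_haar G) \<xi> \<le> 1}.
        norm_L2 (left_haar G) (convol G f \<xi>))"


section \<open>Length functions and property \<open>(T\<^sub>S\<^sub>c\<^sub>h\<^sub>u\<^sub>r, G, K)\<close>\<close>

definition length_function :: "('a::t2_space) monoid \<Rightarrow> ('a \<Rightarrow> real) \<Rightarrow> bool" where
  "length_function G len \<longleftrightarrow>
     continuous_on (carrier G) len \<and>
     (\<forall>g\<in>carrier G. len g \<ge> 0) \<and>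
     len \<one>\<^bsub>G\<^esub> = 0 \<and>
     (\<forall>g\<in>carrier G. len (inv\<^bsub>G\<^esub> g) = len g) \<and>
     (\<forall>g\<in>carrier G. \<forall>h\<in>carrier G. len (g \<otimes>\<^bsub>G\<^esub> h) \<le> len g + len h)"

definition length_ball :: "('a::t2_space) monoid \<Rightarrow> ('a \<Rightarrow> real) \<Rightarrow> nat \<Rightarrow> 'a set" where
  "length_ball G len n = {g \<in> carrier G. len g \<le> real n}"

definition biinvariant :: "('a::t2_space) monoid \<Rightarrow> 'a set \<Rightarrow> ('a \<Rightarrow> complex) \<Rightarrow> bool" where
  "biinvariant G K c \<longleftrightarrow>
     (\<forall>g\<in>carrier G. \<forall>k\<in>K. \<forall>k'\<in>K. c (k \<otimes>\<^bsub>G\<^esub> g \<otimes>\<^bsub>G\<^esub> k') = c g)"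

definition C0 :: "('a::t2_space) monoid \<Rightarrow> ('a \<Rightarrow> real) set" where
  "C0 G = {\<phi>. continuous_on (carrier G) \<phi> \<and>
     (\<forall>\<epsilon>>0. \<exists>Q. compact Q \<and> Q \<subseteq> carrier G \<and> (\<forall>g\<in>carrier G - Q. \<bar>\<phi> g\<bar> < \<epsilon>))}"

text \<open>Extended-real valued, since the restricted Schur multiplier may be unbounded.\<close>

definition schur_norm ::
    "('a::t2_space) monoid \<Rightarrow> 'a set \<Rightarrow> ('a \<Rightarrow> real) \<Rightarrow> nat \<Rightarrow> ('a \<Rightarrow> complex) \<Rightarrow> ereal" where
  "schur_norm G L len n c =
     (SUP f\<in>{f \<in> Cc (G\<lparr>carrier := L\<rparr>).
              supp_on (G\<lparr>carrier := L\<rparr>) f \<subseteq> length_ball G len n \<and>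
              reduced_norm (G\<lparr>carrier := L\<rparr>) f \<le> 1}.
        ereal (reduced_norm (G\<lparr>carrier := L\<rparr>) (\<lambda>h. c h * f h)))"

definition T_Schur_setting :: "('a::t2_space) monoid \<Rightarrow> 'a set \<Rightarrow> 'a set \<Rightarrow> bool" where
  "T_Schur_setting G K L \<longleftrightarrow>
     locally_compact_group G \<and> \<not> compact (carrier G) \<and>
     subgroup K G \<and> compact K \<and> K \<noteq> carrier G \<and>
     subgroup L G \<and> closedin (top_of_set (carrier G)) L \<and> \<not> compact L"

text \<open>\<open>has_T_Schur G K L\<close>: the subgroup \<open>L\<close> has property \<open>(T\<^sub>S\<^sub>c\<^sub>h\<^sub>u\<^sub>r, G, K)\<close>.\<close>

definition has_T_Schur :: "('a::t2_space) monoid \<Rightarrow> 'a set \<Rightarrow> 'a set \<Rightarrow> bool" where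
  "has_T_Schur G K L \<longleftrightarrow>
     T_Schur_setting G K L \<and>
     (\<forall>len. length_function G len \<longrightarrow>
       (\<exists>s\<^sub>0>0. \<forall>s\<in>{0..<s\<^sub>0}. \<exists>\<phi>\<in>C0 G. \<forall>C>0. \<forall>c.
          continuous_on (carrier G) c \<and> biinvariant G K c \<and>
          (\<forall>n. schur_norm G L len n c \<le> ereal (C * exp (s * real n))) \<longrightarrow>
          (\<exists>c_inf. \<forall>g\<in>carrier G. cmod (c g - c_inf) \<le> C * \<phi> g)))"


section \<open>The symplectic groups\<close>

text \<open>
  The Laurent series field in \<open>\<pi>\<close> over \<open>'q\<close> is \<open>'q fls\<close>, with \<open>\<pi> = fls_X\<close> and its
  valuation metric; matrices carry the product topology. In the index type \<open>4\<close> the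
  numeral \<open>4\<close> equals \<open>0\<close>, so its order is not the row order; \<open>vector\<close> fills the
  positions \<open>1, 2, 3, 4\<close> in this order.
\<close>

definition J4 :: "('r::comm_ring_1)^4^4" where
  "J4 = vector [vector [ 0,  0, 0, 1],
                vector [ 0,  0, 1, 0],
                vector [ 0, -1, 0, 0],
                vector [-1,  0, 0, 0]]"

definition Sp4 :: "('r::comm_ring_1) set \<Rightarrow> ('r^4^4) set" where
  "Sp4 R = {A. (\<forall>i j. A $ i $ j \<in> R) \<and> A ** J4 ** transpose A = J4}"

definition power_series_ring :: "('q::field) fls set" where
  "power_series_ring = range fps_to_fls"

definition polys_in_X_inv :: "('q::field) fls set" where
  "polys_in_X_inv = range (\<lambda>p::'q poly. poly (map_poly fls_const p) fls_X_inv)"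

definition G_Sp4 :: "(('q::field) fls^4^4) monoid" where
  "G_Sp4 = \<lparr>carrier = Sp4 UNIV, mult = (**), one = mat 1\<rparr>"

definition K_Sp4 :: "(('q::field) fls^4^4) set" where
  "K_Sp4 = Sp4 power_series_ring"

definition Gamma_Sp4 :: "(('q::field) fls^4^4) set" where
  "Gamma_Sp4 = Sp4 polys_in_X_inv"

definition upper_unipotent :: "(('r::comm_ring_1)^4^4) set" where
  "upper_unipotent =
     {A. \<exists>a b c d e f.
        A = vector [vector [1, a, b, c],
                    vector [0, 1, d, e],
                    vector [0, 0, 1, f],
                    vector [0, 0, 0, 1]]}"

definition H_Sp4 :: "(('q::field) fls^4^4) set" where
  "H_Sp4 = Gamma_Sp4 \<inter> upper_unipotent"

end

theory Submission
  imports Defs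
begin

text \<open>
  Write \<open>t\<close> for the inverse of \<open>\<pi>\<close>. By the Cartan decomposition a \<open>K\<close>-biinvariant function is a function
  \<open>c(i, j)\<close> of \<open>i \<ge> j \<ge> 0\<close>, where \<open>i\<close> is the maximal degree in \<open>t\<close> of an entry and \<open>i + j\<close> that of a
  \<open>2 \<times> 2\<close> minor. To compare \<open>c\<close> at two points we test the Schur multiplier on a difference
  \<open>f = \<Sum>\<^sub>s (\<delta>(h\<^sub>s z\<^sub>1) - \<delta>(h\<^sub>s z\<^sub>2))\<close> of two families of unipotent elements of constant type.
  Since the unipotent group over a finite field is locally finite, the trivial representation
  bounds \<open>\<bar>\<Sum> c f\<bar>\<close> by the reduced norm of \<open>c f\<close>, while the norm of \<open>f\<close> is small because in
  \<open>f\<^sup>* f\<close> all but few pairs \<open>(s, s')\<close> cancel: a translation of \<open>s\<close> and \<open>s'\<close> turns the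
  \<open>z\<^sub>1\<close>-terms into \<open>z\<^sub>2\<close>-terms. A quadratic phase in the Siegel radical (where
  characteristic \<open>\<noteq> 2\<close> enters) compares \<open>c(i, j)\<close> with \<open>c(i, j + 1)\<close> up to \<open>q\<^sup>-\<^sup>(\<^sup>i\<^sup>-\<^sup>j\<^sup>)\<^sup>/\<^sup>2\<close>, and
  commutators in the Klingen radical compare \<open>c(i, j)\<close> with \<open>c(i + 1, j - 1)\<close> up to a constant
  times \<open>q\<^sup>-\<^sup>j\<^sup>/\<^sup>2\<close>. A zigzag of such moves reaches infinity at an exponentially small cost, which
  absorbs the factor \<open>e\<^sup>s\<^sup>n\<close> for small \<open>s\<close>. All test functions live on \<open>H\<close>, so the argument applies
  verbatim to any discrete subgroup between \<open>H\<close> and \<open>\<Gamma>\<close>.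
\<close>

text \<open>A second meaning of \<open>$\<close> would make long matrix expressions exponentially ambiguous.\<close>

no_notation fps_nth (infixl "$" 75)

notation fls_nth (infixl "$$" 75)

section \<open>A zigzag in the Weyl chamber\<close>

text \<open>No single move leads to infinity: the Siegel comparison keeps \<open>i\<close> fixed,
  the Klingen comparison keeps \<open>i + j\<close> fixed, and each becomes worthless at one wall of
  the chamber. On the ray \<open>j = i div 2\<close> both walls are far away and either move gains
  about \<open>q^(-i/4)\<close>. The half-integral exponents come from counting. A family
  \<open>S\<close> yields a function of norm at most twice the square root of the number of bad
  pairs, while the trivial representation sees \<open>card S\<close> equal terms; so a comparison
  costs the square root of the proportion of bad pairs. A pair is bad when its difference has small
  degree, because the compensating translation is a quotient by that difference and would have too
  large a degree. The rate is \<open>\<theta> = q^(-1/16)\<close>: the moves gain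
  \<open>\<theta>^8\<close> per unit of distance from the wall, hence about
  \<open>\<theta>^(4 * i)\<close> on the ray, whereas for small \<open>s\<close> the factor
  \<open>exp (s * n)\<close> at the radius needed for height \<open>i\<close> costs only a constant
  times \<open>\<theta>^(-i)\<close>. What remains is summable along the ray and decays in
  \<open>i\<close>.\<close>

lemma Suc_mult_power_le:
  fixes \<theta> :: real
  assumes "0 < \<theta>" "\<theta> < 1"
  shows "real (Suc i) * \<theta> ^ i \<le> 1 / (1 - \<theta>)"
proof -
  have "real (Suc i) * \<theta> ^ i = (\<Sum>k\<in>{..i}. \<theta> ^ i)" by simp
  also have "\<dots> \<le> (\<Sum>k\<in>{..i}. \<theta> ^ k)"
    using assms by (intro sum_mono power_decreasing) auto
  also have "\<dots> \<le> (\<Sum>k. \<theta> ^ k)"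
    using assms by (intro sum_le_suminf) (auto intro: summable_geometric)
  also have "\<dots> = 1 / (1 - \<theta>)" using assms by (simp add: suminf_geometric)
  finally show ?thesis .
qed

lemma geometric_Cauchy_limit:
  fixes u :: "nat \<Rightarrow> complex" and \<theta> D :: real
  assumes \<theta>: "0 < \<theta>" "\<theta> < 1" and u: "\<And>i. cmod (u i - u (Suc i)) \<le> D * \<theta> ^ i"
  obtains l where "\<And>i. cmod (u i - l) \<le> D / (1 - \<theta>) * \<theta> ^ i"
proof -
  have summ: "summable (\<lambda>i. D * \<theta> ^ i)"
    using \<theta> by (intro summable_mult summable_geometric) auto
  have sn: "summable (\<lambda>i. cmod (u (Suc i) - u i))"
    using u by (intro summable_comparison_test'[OF summ]) (auto simp: norm_minus_commute)
  then have s: "summable (\<lambda>i. u (Suc i) - u i)" by (rule summable_norm_cancel)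
  define l where "l = u 0 + (\<Sum>i. u (Suc i) - u i)"
  have "cmod (u i - l) \<le> D / (1 - \<theta>) * \<theta> ^ i" for i
  proof -
    have "(\<Sum>k. u (Suc k) - u k) = (\<Sum>k. u (Suc (k + i)) - u (k + i)) + (\<Sum>k<i. u (Suc k) - u k)"
      using suminf_split_initial_segment[OF s, of i] by simp
    also have "(\<Sum>k<i. u (Suc k) - u k) = u i - u 0"
      by (rule sum_lessThan_telescope)
    finally have "l - u i = (\<Sum>k. u (Suc (k + i)) - u (k + i))" by (simp add: l_def)
    then have "cmod (u i - l) = cmod (\<Sum>k. u (Suc (k + i)) - u (k + i))"
      by (metis norm_minus_commute)
    also have "\<dots> \<le> (\<Sum>k. cmod (u (Suc (k + i)) - u (k + i)))"
      using summable_iff_shift[of "\<lambda>i. cmod (u (Suc i) - u i)" i] sn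
      by (intro summable_norm) simp
    also have "\<dots> \<le> (\<Sum>k. D * \<theta> ^ i * \<theta> ^ k)"
    proof (intro suminf_le)
      show "summable (\<lambda>k. cmod (u (Suc (k + i)) - u (k + i)))"
        using summable_iff_shift[of "\<lambda>i. cmod (u (Suc i) - u i)" i] sn by simp
      show "summable (\<lambda>k. D * \<theta> ^ i * \<theta> ^ k)"
        using \<theta> by (intro summable_mult summable_geometric) auto
      show "cmod (u (Suc (k + i)) - u (k + i)) \<le> D * \<theta> ^ i * \<theta> ^ k" for k
        using u[of "k + i"] by (simp add: norm_minus_commute power_add mult_ac)
    qed
    also have "\<dots> = D / (1 - \<theta>) * \<theta> ^ i"
      using \<theta> by (subst suminf_mult) (auto simp: suminf_geometric intro: summable_geometric)
    finally show ?thesis .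
  qed
  then show ?thesis by (rule that)
qed

text \<open>
  The move from \<open>(i, j)\<close> to \<open>(i, j + 1)\<close> is cheap far from the diagonal, the move to
  \<open>(i + 1, j - 1)\<close> is cheap far from \<open>j = 0\<close>; together they connect every point to the ray
  \<open>j = i div 2\<close>.
\<close>

lemma zigzag:
  fixes \<theta> W :: real
  assumes \<theta>: "0 < \<theta>" "\<theta> < 1" and W: "0 < W"
  obtains A where "A > 0" "\<And>C (c :: nat \<Rightarrow> nat \<Rightarrow> complex). C > 0 \<Longrightarrow>
    (\<And>i j. j \<le> i \<Longrightarrow> cmod (c i j) \<le> C * W * (1/\<theta>) ^ i) \<Longrightarrow>
    (\<And>i j. j < i \<Longrightarrow> cmod (c i j - c i (Suc j)) \<le> C * W * (1/\<theta>) ^ i * (\<theta>^8) ^ (i - j)) \<Longrightarrow>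
    (\<And>i j. 1 \<le> j \<Longrightarrow> j \<le> i \<Longrightarrow> cmod (c i j - c (Suc i) (j - 1)) \<le> C * W * (1/\<theta>) ^ i * (\<theta>^8) ^ j) \<Longrightarrow>
    \<exists>l. \<forall>i j. j \<le> i \<longrightarrow> cmod (c i j - l) \<le> C * (A * \<theta> ^ i)"
proof -
  \<comment> \<open>\<open>T\<close> is the full geometric series, \<open>Q\<close> the cost of one
    step along the ray, and \<open>A\<close> adds the tail along the ray to the distance from the
    ray.\<close>
  define T where "T = 1 / (1 - \<theta>)"
  define Q where "Q = (2 / \<theta> ^ 5 + T) * W"
  define A where "A = Q * T + T * W"
  have T: "T > 0" using \<theta> by (simp add: T_def)
  have Q: "Q > 0" using \<theta> W T by (simp add: Q_def add_pos_pos)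
  have A: "A > 0" using Q T W by (simp add: A_def add_pos_pos)
  \<comment> \<open>The loss \<open>(1/\<theta>) ^ i\<close> uses up \<open>i\<close> of the at
    least \<open>k\<close> factors \<open>\<theta>\<close> gained by the move.\<close>
  have weight: "(1/\<theta>) ^ i * (\<theta>^8) ^ n \<le> \<theta> ^ (k - i)" if "k \<le> 8 * n" "i \<le> k" for i n k :: nat
  proof -
    have "(1/\<theta>) ^ i * (\<theta>^8) ^ n \<le> (1/\<theta>) ^ i * \<theta> ^ k"
      using that \<theta> by (intro mult_left_mono) (auto simp: power_mult[symmetric] intro: power_decreasing)
    also have "\<dots> = \<theta> ^ (k - i)"
      using that \<theta> by (simp add: power_diff power_divide)
    finally show ?thesis .
  qed
  have *: "\<exists>l. \<forall>i j. j \<le> i \<longrightarrow> cmod (c i j - l) \<le> C * (A * \<theta> ^ i)"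
    if C: "C > 0"
      and M0: "\<And>i j. j \<le> i \<Longrightarrow> cmod (c i j) \<le> C * W * (1/\<theta>) ^ i"
      and M1: "\<And>i j. j < i \<Longrightarrow> cmod (c i j - c i (Suc j)) \<le> C * W * (1/\<theta>) ^ i * (\<theta>^8) ^ (i - j)"
      and M2: "\<And>i j. 1 \<le> j \<Longrightarrow> j \<le> i \<Longrightarrow>
        cmod (c i j - c (Suc i) (j - 1)) \<le> C * W * (1/\<theta>) ^ i * (\<theta>^8) ^ j"
    for C :: real and c :: "nat \<Rightarrow> nat \<Rightarrow> complex"
  proof -
    have CW: "C * W > 0" using C W by simp
    define u where "u i = c i (i div 2)" for i
    \<comment> \<open>Below the ray \<open>i - j\<close> is at least \<open>i / 2\<close>, so each
      step gains \<open>\<theta> ^ (4 * i)\<close> and keeps \<open>\<theta> ^ (3 * i)\<close> after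
      the loss.\<close>
    have low': "cmod (c i (i div 2 - n) - u i) \<le> real n * (C * W * \<theta> ^ (3 * i))" if "n \<le> i div 2" for i n
      using that
    proof (induction n)
      case 0 then show ?case by (simp add: u_def)
    next
      case (Suc n)
      define j where "j = i div 2 - Suc n"
      have j: "Suc j = i div 2 - n" "j < i" using Suc.prems by (auto simp: j_def)
      have "(1/\<theta>) ^ i * (\<theta>^8) ^ (i - j) \<le> \<theta> ^ (4 * i - i)"
        by (rule weight) (auto simp: j_def)
      also have "4 * i - i = 3 * i" by simp
      finally have "C * W * ((1/\<theta>) ^ i * (\<theta>^8) ^ (i - j)) \<le> C * W * \<theta> ^ (3 * i)"
        using CW by (intro mult_left_mono) auto
      then have "cmod (c i j - c i (Suc j)) \<le> C * W * \<theta> ^ (3 * i)"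
        using M1[OF j(2)] by (simp only: mult.assoc)
      moreover have "cmod (c i (Suc j) - u i) \<le> real n * (C * W * \<theta> ^ (3 * i))"
        using Suc j by simp
      moreover have "cmod (c i j - u i) \<le> cmod (c i j - c i (Suc j)) + cmod (c i (Suc j) - u i)"
        by (rule norm_diff_triangle_ineq[of "c i j" "c i (Suc j)" "c i (Suc j)" "u i", simplified])
      ultimately show ?case unfolding j_def[symmetric] by (simp add: algebra_simps)
    qed
    have low: "cmod (c i j - u i) \<le> C * W * T * \<theta> ^ (2 * i)" if "j \<le> i div 2" for i j
    proof -
      have "cmod (c i j - u i) \<le> real (i div 2 - j) * (C * W * \<theta> ^ (3 * i))"
        using low'[of "i div 2 - j" i] that by simp
      also have "\<dots> \<le> real (Suc i) * (C * W * \<theta> ^ (3 * i))"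
        using CW \<theta> by (intro mult_right_mono) auto
      \<comment> \<open>One of the three factors \<open>\<theta> ^ i\<close> pays for the number of
        steps.\<close>
      also have "\<dots> = C * W * (real (Suc i) * \<theta> ^ i) * \<theta> ^ (2 * i)"
        by (simp add: power_add[symmetric] mult_ac)
      also have "\<dots> \<le> C * W * T * \<theta> ^ (2 * i)"
        using CW \<theta> Suc_mult_power_le[OF \<theta>, of i]
        by (intro mult_right_mono mult_left_mono) (auto simp: T_def)
      finally show ?thesis .
    qed
    have up: "\<theta> ^ (2 * i) \<le> \<theta> ^ i" "\<theta> ^ (3 * i) \<le> \<theta> ^ i" for i
      using \<theta> by (auto intro!: power_decreasing)
    have step: "cmod (u i - u (Suc i)) \<le> C * Q * \<theta> ^ i" for i
    \<comment> \<open>For \<open>i < 2\<close> the ray point has \<open>j = 0\<close> and no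
      antidiagonal move starts there; the pointwise bound takes over, and
      \<open>2 / \<theta> ^ 5\<close> is large enough for both cases.\<close>
    proof (cases "i < 2")
      case True
      have "cmod (u i - u (Suc i)) \<le> cmod (u i) + cmod (u (Suc i))" by (rule norm_triangle_ineq4)
      also have "\<dots> \<le> C * W * (1/\<theta>) ^ i + C * W * (1/\<theta>) ^ Suc i"
        unfolding u_def by (intro add_mono M0) auto
      also have "\<dots> \<le> C * W * (1/\<theta>) ^ 2 + C * W * (1/\<theta>) ^ 2"
        using True \<theta> CW by (intro add_mono mult_left_mono power_increasing) auto
      also have "\<dots> = C * W * (2 / \<theta> ^ 5) * \<theta> ^ 3"
        using \<theta> by (simp add: field_simps eval_nat_numeral)
      also have "\<dots> \<le> C * W * (2 / \<theta> ^ 5) * \<theta> ^ i"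
        using True \<theta> CW by (intro mult_left_mono power_decreasing) auto
      also have "\<dots> \<le> C * W * (2 / \<theta> ^ 5 + T) * \<theta> ^ i"
        using \<theta> CW T by (intro mult_right_mono mult_left_mono) auto
      finally show ?thesis by (simp add: Q_def mult_ac)
    next
      case False
      define j where "j = i div 2"
      have j: "1 \<le> j" "j \<le> i" using False by (auto simp: j_def)
      \<comment> \<open>Rounding in \<open>i div 2\<close> costs up to four factors, whence
        \<open>4 * i - 4\<close>.\<close>
      have "(1/\<theta>) ^ i * (\<theta>^8) ^ j \<le> \<theta> ^ ((4 * i - 4) - i)"
        by (rule weight) (use False in \<open>auto simp: j_def\<close>)
      also have "\<dots> \<le> 2 / \<theta> ^ 5 * \<theta> ^ i"
      proof -
        have "\<theta> ^ (5 + ((4 * i - 4) - i)) \<le> \<theta> ^ i"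
          using \<theta> False by (intro power_decreasing) auto
        then have "\<theta> ^ 5 * \<theta> ^ ((4 * i - 4) - i) \<le> 2 * \<theta> ^ i"
          using \<theta> zero_less_power[OF \<theta>(1), of i] unfolding power_add by linarith
        then show ?thesis using \<theta> by (simp add: field_simps)
      qed
      finally have "C * W * ((1/\<theta>) ^ i * (\<theta>^8) ^ j) \<le> C * W * (2 / \<theta> ^ 5 * \<theta> ^ i)"
        using CW by (intro mult_left_mono) auto
      then have 1: "cmod (u i - c (Suc i) (j - 1)) \<le> C * W * (2 / \<theta> ^ 5) * \<theta> ^ i"
        using M2[OF j] by (simp add: u_def j_def mult_ac)
      have "cmod (c (Suc i) (j - 1) - u (Suc i)) \<le> C * W * T * \<theta> ^ (2 * Suc i)"
        by (rule low) (auto simp: j_def)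
      also have "\<dots> \<le> C * W * T * \<theta> ^ i"
        using \<theta> CW T by (intro mult_left_mono power_decreasing) auto
      finally have "cmod (u i - u (Suc i)) \<le> C * W * (2 / \<theta> ^ 5) * \<theta> ^ i + C * W * T * \<theta> ^ i"
        using 1 norm_diff_triangle_le by blast
      then show ?thesis by (simp add: Q_def algebra_simps)
    qed
    obtain l where l: "\<And>i. cmod (u i - l) \<le> C * Q / (1 - \<theta>) * \<theta> ^ i"
      using geometric_Cauchy_limit[OF \<theta>, of u "C * Q"] step by blast
    \<comment> \<open>Above the ray the way down is the antidiagonal, which raises \<open>i\<close>;
      therefore \<open>j\<close> is the induction variable and \<open>i\<close> stays
      arbitrary.\<close>
    have "cmod (c i j - l) \<le> C * (A * \<theta> ^ i)" if "j \<le> i" for i j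
      using that
    proof (induction j arbitrary: i)
      case 0
      show ?case
      proof -
        have "cmod (c i 0 - u i) \<le> C * W * T * \<theta> ^ i"
          using low[of 0 i] up(1)[of i] CW T mult_left_mono[of "\<theta> ^ (2 * i)" "\<theta> ^ i" "C * W * T"] by simp
        then have "cmod (c i 0 - l) \<le> C * W * T * \<theta> ^ i + C * Q / (1 - \<theta>) * \<theta> ^ i"
          using l norm_diff_triangle_le by blast
        also have "\<dots> \<le> C * (A * \<theta> ^ i)"
          using C W T \<theta> by (simp add: A_def T_def algebra_simps)
        finally show ?thesis .
      qed
    next
      case (Suc j)
      show ?case
      proof (cases "Suc j \<le> i div 2")
        case True
        have "cmod (c i (Suc j) - u i) \<le> C * W * T * \<theta> ^ i"
          using low[OF True] up(1)[of i] CW T mult_left_mono[of "\<theta> ^ (2 * i)" "\<theta> ^ i" "C * W * T"] by simp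
        then have "cmod (c i (Suc j) - l) \<le> C * W * T * \<theta> ^ i + C * Q / (1 - \<theta>) * \<theta> ^ i"
          using l norm_diff_triangle_le by blast
        also have "\<dots> \<le> C * (A * \<theta> ^ i)"
          using C W T \<theta> by (simp add: A_def T_def algebra_simps)
        finally show ?thesis .
      next
        case False
        have "(1/\<theta>) ^ i * (\<theta>^8) ^ Suc j \<le> \<theta> ^ (4 * i - i)"
          by (rule weight) (use False in auto)
        also have "\<dots> \<le> \<theta> ^ i" using \<theta> by (intro power_decreasing) auto
        finally have "C * W * ((1/\<theta>) ^ i * (\<theta>^8) ^ Suc j) \<le> C * W * \<theta> ^ i"
          using CW by (intro mult_left_mono) auto
        then have 1: "cmod (c i (Suc j) - c (Suc i) j) \<le> C * W * \<theta> ^ i"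
          using M2[of "Suc j" i] Suc.prems by (simp add: mult_ac)
        have "cmod (c (Suc i) j - l) \<le> C * (A * \<theta> ^ Suc i)"
          using Suc.IH[of "Suc i"] Suc.prems by simp
        with 1 have "cmod (c i (Suc j) - l) \<le> C * W * \<theta> ^ i + C * (A * \<theta> ^ Suc i)"
          using norm_diff_triangle_le by blast
        also have "\<dots> = C * ((W + A * \<theta>) * \<theta> ^ i)" by (simp add: algebra_simps)
        also have "\<dots> \<le> C * (A * \<theta> ^ i)"
        proof -
          \<comment> \<open>Since \<open>T * (1 - \<theta>) = 1\<close> and \<open>A\<close>
            dominates \<open>T * W\<close>, the geometric series of antidiagonal steps is already
            contained in \<open>A\<close>.\<close>
          have "W = (T * W) * (1 - \<theta>)" using \<theta> by (simp add: T_def)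
          also have "\<dots> \<le> A * (1 - \<theta>)"
            using \<theta> Q T W by (intro mult_right_mono) (auto simp: A_def)
          finally have "W + A * \<theta> \<le> A" by (simp add: algebra_simps)
          then show ?thesis using C \<theta> by (intro mult_left_mono mult_right_mono) auto
        qed
        finally show ?thesis .
      qed
    qed
    then show ?thesis by blast
  qed
  show ?thesis by (rule that[OF A *])
qed

section \<open>Convolution operators on discrete groups\<close>

locale discrete_group = group R for R :: "('a::t2_space) monoid" (structure) +
  assumes openin_carrier: "A \<subseteq> carrier R \<Longrightarrow> openin (top_of_set (carrier R)) A"
begin

lemma finite_if_compact:
  assumes "compact Q" "Q \<subseteq> carrier R"
  shows "finite Q"
proof -
  have "\<exists>U. open U \<and> U \<inter> Q = {x}" if "x \<in> Q" for x
  proof -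
    have "openin (top_of_set (carrier R)) {x}"
      using assms that by (intro openin_carrier) auto
    then obtain U where "open U" "{x} = carrier R \<inter> U"
      unfolding openin_open by blast
    then show ?thesis using assms that by (intro exI[of _ U]) auto
  qed
  then have "discrete Q"
    unfolding discrete_def isolated_in_def by metis
  with assms show ?thesis using discrete_compact_finite_iff by blast
qed

lemma sets_haar: "sets (restrict_space borel (carrier R)) = Pow (carrier R)"
proof
  show "Pow (carrier R) \<subseteq> sets (restrict_space borel (carrier R))"
  proof
    fix A assume "A \<in> Pow (carrier R)"
    then obtain U where "open U" "A = carrier R \<inter> U"
      using openin_carrier[of A] by (auto simp: openin_open)
    then show "A \<in> sets (restrict_space borel (carrier R))"
      by (auto simp: sets_restrict_space)
  qed
qed (auto simp: sets_restrict_space)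

lemma emeasure_count_space_eq_SUP:
  assumes "U \<subseteq> carrier R"
  shows "emeasure (count_space (carrier R)) U =
    (SUP Q\<in>{Q. compact Q \<and> Q \<subseteq> U}. emeasure (count_space (carrier R)) Q)" (is "?l = ?r")
proof (rule antisym)
  show "?r \<le> ?l" using assms by (intro SUP_least emeasure_mono) auto
  show "?l \<le> ?r"
  proof (cases "finite U")
    case True
    then show ?thesis by (intro SUP_upper) (auto intro: finite_imp_compact)
  next
    case False
    have "of_nat n \<le> ?r" for n
    proof -
      obtain Q where Q: "finite Q" "card Q = n" "Q \<subseteq> U"
        using infinite_arbitrarily_large[OF False] by blast
      then have "emeasure (count_space (carrier R)) Q \<le> ?r"
        by (intro SUP_upper) (auto intro: finite_imp_compact)
      then show ?thesis using Q assms by simp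
    qed
    then have "?r = \<infinity>"
      by (metis ennreal_Ex_less_of_nat not_le infinity_ennreal_def less_top)
    then show ?thesis by (simp only: infinity_ennreal_def top_greatest)
  qed
qed

text \<open>\<open>left_haar\<close> is a choice, so a witness must exist before anything can be
  said about the chosen measure.\<close>

lemma is_left_haar_count_space: "is_left_haar R (count_space (carrier R))"
proof -
  let ?\<mu> = "count_space (carrier R)"
  have "emeasure ?\<mu> A = (INF U\<in>{U. openin (top_of_set (carrier R)) U \<and> A \<subseteq> U}. emeasure ?\<mu> U)"
    if "A \<subseteq> carrier R" for A
  proof (rule antisym)
    show "emeasure ?\<mu> A \<le> (INF U\<in>{U. openin (top_of_set (carrier R)) U \<and> A \<subseteq> U}. emeasure ?\<mu> U)"
      by (intro INF_greatest emeasure_mono) (auto dest: openin_imp_subset)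
    show "(INF U\<in>{U. openin (top_of_set (carrier R)) U \<and> A \<subseteq> U}. emeasure ?\<mu> U) \<le> emeasure ?\<mu> A"
      using that by (intro INF_lower) (auto intro: openin_carrier)
  qed
  moreover have "emeasure ?\<mu> U = (SUP Q\<in>{Q. compact Q \<and> Q \<subseteq> U}. emeasure ?\<mu> Q)"
    if "openin (top_of_set (carrier R)) U" for U
    using openin_imp_subset[OF that] by (rule emeasure_count_space_eq_SUP)
  moreover have "emeasure ?\<mu> ((\<lambda>x. g \<otimes> x) ` A) = emeasure ?\<mu> A"
    if "g \<in> carrier R" "A \<subseteq> carrier R" for g A
  proof -
    have inj: "inj_on (\<lambda>x. g \<otimes> x) A"
      using that by (auto simp: inj_on_def subset_iff)
    have "(\<lambda>x. g \<otimes> x) ` A \<subseteq> carrier R" using that by auto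
    then show ?thesis using that inj
      by (auto simp: emeasure_count_space card_image finite_image_iff)
  qed
  moreover have "emeasure ?\<mu> Q < \<infinity>" if "compact Q" "Q \<subseteq> carrier R" for Q
    using finite_if_compact[OF that] that by (simp add: of_nat_less_top)
  moreover have "emeasure ?\<mu> (carrier R) \<noteq> 0"
    using one_closed by (auto simp: emeasure_count_space)
  ultimately show ?thesis
    unfolding is_left_haar_def sets_haar by simp
qed

text \<open>Left invariance gives all points the same mass, compact sets are finite, and inner
  regularity carries the resulting formula from finite sets to all sets. The mass is nonzero because
  the whole group has nonzero measure.\<close>

lemma left_haar_eq_density:
  obtains a :: real where "a > 0" "left_haar R = density (count_space (carrier R)) (\<lambda>_. ennreal a)"
proof -
  let ?c = "count_space (carrier R)"
  define \<mu> where "\<mu> = left_haar R"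
  have haar: "is_left_haar R \<mu>"
    unfolding \<mu>_def left_haar_def by (rule someI, rule is_left_haar_count_space)
  have sets: "sets \<mu> = Pow (carrier R)" using haar by (simp add: is_left_haar_def sets_haar)
  define m where "m = emeasure \<mu> {\<one>}"
  have "m < \<infinity>" using haar unfolding is_left_haar_def m_def by (meson compact_sing empty_subsetI insert_subset one_closed)
  have single: "emeasure \<mu> {g} = m" if "g \<in> carrier R" for g
  proof -
    have "{\<one>} \<in> sets \<mu>" by (simp add: sets)
    then have "emeasure \<mu> ((\<lambda>x. g \<otimes> x) ` {\<one>}) = emeasure \<mu> {\<one>}"
      using haar that unfolding is_left_haar_def by blast
    then show ?thesis using that by (simp add: m_def)
  qed
  have fin: "emeasure \<mu> Q = m * emeasure ?c Q" if "finite Q" "Q \<subseteq> carrier R" for Q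
  proof -
    have "emeasure \<mu> Q = (\<Sum>g\<in>Q. emeasure \<mu> {g})"
      using that by (intro emeasure_eq_sum_singleton) (auto simp: sets)
    also have "\<dots> = (\<Sum>g\<in>Q. m)" using that single by (intro sum.cong) auto
    finally show ?thesis using that by (simp add: mult.commute)
  qed
  have all: "emeasure \<mu> A = m * emeasure ?c A" if "A \<subseteq> carrier R" for A
  proof -
    have "emeasure \<mu> A = (SUP Q\<in>{Q. compact Q \<and> Q \<subseteq> A}. emeasure \<mu> Q)"
      using haar openin_carrier[OF that] unfolding is_left_haar_def by blast
    also have "\<dots> = (SUP Q\<in>{Q. compact Q \<and> Q \<subseteq> A}. m * emeasure ?c Q)"
      using that by (intro SUP_cong refl fin finite_if_compact) auto
    also have "\<dots> = m * emeasure ?c A"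
      unfolding emeasure_count_space_eq_SUP[OF that] SUP_mult_left_ennreal ..
    finally show ?thesis .
  qed
  have "m \<noteq> 0"
    using haar all[of "carrier R"] by (auto simp: is_left_haar_def)
  then have m: "m = ennreal (enn2real m)" "enn2real m > 0"
    using \<open>m < \<infinity>\<close> by (auto simp: enn2real_positive_iff less_top zero_less_iff_neq_zero)
  have "\<mu> = density ?c (\<lambda>_. m)"
    by (rule measure_eqI) (auto simp: sets all emeasure_density_const)
  then show ?thesis using that m by (metis \<mu>_def)
qed

section \<open>Square-summable functions and sums of translations\<close>

definition l2 :: "('a \<Rightarrow> complex) \<Rightarrow> bool" where
  "l2 \<xi> \<longleftrightarrow> integrable (count_space (carrier R)) (\<lambda>x. (cmod (\<xi> x))\<^sup>2)"

definition l2_sq :: "('a \<Rightarrow> complex) \<Rightarrow> real" where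
  "l2_sq \<xi> = (LINT x|count_space (carrier R). (cmod (\<xi> x))\<^sup>2)"

definition translates :: "('a \<Rightarrow> complex) \<Rightarrow> 'a set \<Rightarrow> ('a \<Rightarrow> complex) \<Rightarrow> 'a \<Rightarrow> complex" where
  "translates f F \<xi> x = (\<Sum>y\<in>F. f y * \<xi> (inv y \<otimes> x))"

lemma bij_betw_translate: "g \<in> carrier R \<Longrightarrow> bij_betw (\<lambda>x. g \<otimes> x) (carrier R) (carrier R)"
  by (rule bij_betwI[where g = "\<lambda>x. inv g \<otimes> x"]) (auto simp: m_assoc[symmetric])

lemma l2_translate: "g \<in> carrier R \<Longrightarrow> l2 \<xi> \<Longrightarrow> l2 (\<lambda>x. \<xi> (g \<otimes> x))"
  unfolding l2_def
  by (subst integrable_bij_count_space[OF bij_betw_translate, of g "\<lambda>x. (cmod (\<xi> x))\<^sup>2"]) auto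

lemma l2_sq_translate: "g \<in> carrier R \<Longrightarrow> l2_sq (\<lambda>x. \<xi> (g \<otimes> x)) = l2_sq \<xi>"
  unfolding l2_sq_def
  by (subst integral_bij_count_space[OF bij_betw_translate, of g "\<lambda>x. (cmod (\<xi> x))\<^sup>2"]) auto

lemma l2_sq_nonneg: "l2_sq \<xi> \<ge> 0"
  unfolding l2_sq_def by (rule integral_nonneg_AE) auto

lemma integrable_mult_cnj:
  assumes "l2 \<xi>" "l2 \<eta>"
  shows "integrable (count_space (carrier R)) (\<lambda>x. \<xi> x * cnj (\<eta> x))"
proof (rule Bochner_Integration.integrable_bound)
  show "integrable (count_space (carrier R)) (\<lambda>x. (cmod (\<xi> x))\<^sup>2 + (cmod (\<eta> x))\<^sup>2)"
    using assms unfolding l2_def by (rule Bochner_Integration.integrable_add)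
  show "AE x in count_space (carrier R).
    cmod (\<xi> x * cnj (\<eta> x)) \<le> norm ((cmod (\<xi> x))\<^sup>2 + (cmod (\<eta> x))\<^sup>2)"
  proof (intro AE_I2)
    fix x
    have "2 * (cmod (\<xi> x) * cmod (\<eta> x)) \<le> (cmod (\<xi> x))\<^sup>2 + (cmod (\<eta> x))\<^sup>2"
      using sum_squares_bound[of "cmod (\<xi> x)" "cmod (\<eta> x)"] by simp
    moreover have "0 \<le> cmod (\<xi> x) * cmod (\<eta> x)" by simp
    ultimately have "cmod (\<xi> x) * cmod (\<eta> x) \<le> (cmod (\<xi> x))\<^sup>2 + (cmod (\<eta> x))\<^sup>2"
      by linarith
    then show "cmod (\<xi> x * cnj (\<eta> x)) \<le> norm ((cmod (\<xi> x))\<^sup>2 + (cmod (\<eta> x))\<^sup>2)"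
      by (simp add: norm_mult)
  qed
qed auto

text \<open>The arithmetic-geometric mean inequality replaces Cauchy-Schwarz; nothing is lost when
  both functions are translates of one another and so have equal norm.\<close>

lemma inner_bound:
  assumes "l2 \<xi>" "l2 \<eta>"
  shows "cmod (LINT x|count_space (carrier R). \<xi> x * cnj (\<eta> x)) \<le> (l2_sq \<xi> + l2_sq \<eta>) / 2"
proof -
  have "cmod (LINT x|count_space (carrier R). \<xi> x * cnj (\<eta> x))
     \<le> (LINT x|count_space (carrier R). cmod (\<xi> x * cnj (\<eta> x)))"
    by (rule integral_norm_bound)
  also have "\<dots> \<le> (LINT x|count_space (carrier R). ((cmod (\<xi> x))\<^sup>2 + (cmod (\<eta> x))\<^sup>2) / 2)"
  proof (rule integral_mono)
    show "integrable (count_space (carrier R)) (\<lambda>x. cmod (\<xi> x * cnj (\<eta> x)))"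
      using integrable_mult_cnj[OF assms] by (rule integrable_norm)
    show "integrable (count_space (carrier R)) (\<lambda>x. ((cmod (\<xi> x))\<^sup>2 + (cmod (\<eta> x))\<^sup>2) / 2)"
      using assms unfolding l2_def by auto
    show "cmod (\<xi> x * cnj (\<eta> x)) \<le> ((cmod (\<xi> x))\<^sup>2 + (cmod (\<eta> x))\<^sup>2) / 2" for x
      using sum_squares_bound[of "cmod (\<xi> x)" "cmod (\<eta> x)"] by (simp add: norm_mult)
  qed
  also have "\<dots> = (l2_sq \<xi> + l2_sq \<eta>) / 2"
    using assms unfolding l2_def l2_sq_def by simp
  finally show ?thesis .
qed

lemma of_real_l2_sq: "of_real (l2_sq \<xi>) = (LINT x|count_space (carrier R). \<xi> x * cnj (\<xi> x))"
  unfolding l2_sq_def by (simp add: complex_norm_square[symmetric] flip: integral_complex_of_real)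

lemma l2_diff:
  assumes "l2 \<xi>" "l2 \<eta>"
  shows "l2 (\<lambda>x. \<xi> x - \<eta> x)" "l2_sq (\<lambda>x. \<xi> x - \<eta> x) \<le> 2 * l2_sq \<xi> + 2 * l2_sq \<eta>"
proof -
  have le: "(cmod (\<xi> x - \<eta> x))\<^sup>2 \<le> 2 * (cmod (\<xi> x))\<^sup>2 + 2 * (cmod (\<eta> x))\<^sup>2" for x
  proof -
    have "(cmod (\<xi> x - \<eta> x))\<^sup>2 \<le> (cmod (\<xi> x) + cmod (\<eta> x))\<^sup>2"
      by (intro power_mono norm_triangle_ineq4) auto
    also have "\<dots> \<le> 2 * (cmod (\<xi> x))\<^sup>2 + 2 * (cmod (\<eta> x))\<^sup>2"
      using sum_squares_bound[of "cmod (\<xi> x)" "cmod (\<eta> x)"] by (simp add: power2_sum)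
    finally show ?thesis .
  qed
  have i: "integrable (count_space (carrier R)) (\<lambda>x. 2 * (cmod (\<xi> x))\<^sup>2 + 2 * (cmod (\<eta> x))\<^sup>2)"
    using assms unfolding l2_def by auto
  show d: "l2 (\<lambda>x. \<xi> x - \<eta> x)"
    unfolding l2_def by (rule Bochner_Integration.integrable_bound[OF i]) (auto intro: le)
  have "l2_sq (\<lambda>x. \<xi> x - \<eta> x) \<le>
      (LINT x|count_space (carrier R). 2 * (cmod (\<xi> x))\<^sup>2 + 2 * (cmod (\<eta> x))\<^sup>2)"
    unfolding l2_sq_def by (intro integral_mono i le) (use d in \<open>simp add: l2_def\<close>)
  also have "\<dots> = 2 * l2_sq \<xi> + 2 * l2_sq \<eta>"
    using assms unfolding l2_def l2_sq_def by simp
  finally show "l2_sq (\<lambda>x. \<xi> x - \<eta> x) \<le> 2 * l2_sq \<xi> + 2 * l2_sq \<eta>" .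
qed

text \<open>Young's inequality for convolution with the finitely supported restriction of
  \<open>f\<close> to \<open>F\<close>, obtained from Cauchy-Schwarz with weights
  \<open>cmod (f y)\<close>. It makes the supremum in \<open>reduced_norm\<close> finite and
  computes the norm bound for a point mass.\<close>

lemma l2_translates:
  assumes \<xi>: "l2 \<xi>" and F: "F \<subseteq> carrier R"
  shows "l2 (translates f F \<xi>)" "l2_sq (translates f F \<xi>) \<le> (\<Sum>y\<in>F. cmod (f y))\<^sup>2 * l2_sq \<xi>"
proof -
  let ?c = "count_space (carrier R)"
  define N where "N = (\<Sum>y\<in>F. cmod (f y))"
  let ?g = "\<lambda>x. N * (\<Sum>y\<in>F. cmod (f y) * (cmod (\<xi> (inv y \<otimes> x)))\<^sup>2)"
  have le: "(cmod (translates f F \<xi> x))\<^sup>2 \<le> ?g x" for x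
  proof -
    have "(cmod (translates f F \<xi> x))\<^sup>2 \<le> (\<Sum>y\<in>F. cmod (f y) * cmod (\<xi> (inv y \<otimes> x)))\<^sup>2"
      unfolding translates_def
      by (intro power_mono order.trans[OF norm_sum]) (auto simp: norm_mult)
    also have "\<dots> = (\<Sum>y\<in>F. sqrt (cmod (f y)) * (sqrt (cmod (f y)) * cmod (\<xi> (inv y \<otimes> x))))\<^sup>2"
      by (simp add: mult.assoc[symmetric])
    also have "\<dots> \<le> (\<Sum>y\<in>F. (sqrt (cmod (f y)))\<^sup>2) * (\<Sum>y\<in>F. (sqrt (cmod (f y)) * cmod (\<xi> (inv y \<otimes> x)))\<^sup>2)"
      by (rule Cauchy_Schwarz_ineq_sum)
    also have "\<dots> = ?g x" by (simp add: power_mult_distrib N_def)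
    finally show ?thesis .
  qed
  have t: "integrable ?c (\<lambda>x. (cmod (\<xi> (inv y \<otimes> x)))\<^sup>2)" if "y \<in> F" for y
    using l2_translate[of "inv y" \<xi>] \<xi> that F by (auto simp: l2_def)
  have i: "integrable ?c ?g" using t by auto
  show d: "l2 (translates f F \<xi>)"
    unfolding l2_def by (rule Bochner_Integration.integrable_bound[OF i]) (auto intro: le order.trans[OF _ abs_ge_self])
  have "l2_sq (translates f F \<xi>) \<le> (LINT x|?c. ?g x)"
    unfolding l2_sq_def by (intro integral_mono i le) (use d in \<open>simp add: l2_def\<close>)
  also have "\<dots> = N * (\<Sum>y\<in>F. cmod (f y) * l2_sq (\<lambda>x. \<xi> (inv y \<otimes> x)))"
    using t by (simp add: l2_sq_def)
  also have "\<dots> = N * (\<Sum>y\<in>F. cmod (f y) * l2_sq \<xi>)"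
    using F by (intro arg_cong[where f = "\<lambda>x. N * x"] sum.cong) (auto simp: l2_sq_translate)
  also have "\<dots> = N\<^sup>2 * l2_sq \<xi>" by (simp add: N_def power2_eq_square mult.assoc flip: sum_distrib_right)
  finally show "l2_sq (translates f F \<xi>) \<le> (\<Sum>y\<in>F. cmod (f y))\<^sup>2 * l2_sq \<xi>" by (simp add: N_def)
qed

text \<open>
  Expanding the square gives a sum over pairs \<open>(s, s')\<close>. The shift \<open>\<sigma>\<close> matches the
  \<open>z\<^sub>1\<close>-terms of the good pairs with their \<open>z\<^sub>2\<close>-terms, so only the bad pairs survive.
\<close>

lemma l2_sq_pair_cancellation:
  assumes S: "finite S" and h: "\<And>s. s \<in> S \<Longrightarrow> h s \<in> carrier R"
    and v: "\<And>s s'. s \<in> S \<Longrightarrow> s' \<in> S \<Longrightarrow> v (s, s') \<in> carrier R \<and> h s \<otimes> v (s, s') = h s'"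
    and w: "w \<in> carrier R" and z2: "z2 \<in> carrier R" and z1: "z1 = w \<otimes> z2"
    and Good: "Good \<subseteq> S \<times> S" and \<sigma>: "bij_betw \<sigma> Good Good"
    and shift: "\<And>p. p \<in> Good \<Longrightarrow> v (\<sigma> p) = w \<otimes> v p"
    and \<xi>: "l2 \<xi>"
  shows "l2_sq (\<lambda>x. \<Sum>s\<in>S. \<xi> (inv (h s \<otimes> z1) \<otimes> x) - \<xi> (inv (h s \<otimes> z2) \<otimes> x))
    \<le> 4 * real (card (S \<times> S - Good)) * l2_sq \<xi>"
proof -
  let ?c = "count_space (carrier R)"
  have z1c: "z1 \<in> carrier R" using w z2 z1 by simp
  \<comment> \<open>The sum over \<open>s\<close> becomes a sum of the translates of the single
    vector \<open>\<zeta>\<close> by the \<open>h s\<close>.\<close>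
  define \<zeta> where "\<zeta> x = \<xi> (inv z1 \<otimes> x) - \<xi> (inv z2 \<otimes> x)" for x
  have \<zeta>: "l2 \<zeta>"
    using l2_diff(1)[OF l2_translate[OF inv_closed[OF z1c] \<xi>] l2_translate[OF inv_closed[OF z2] \<xi>]]
    by (simp add: \<zeta>_def[abs_def])
  have \<zeta>_le: "l2_sq \<zeta> \<le> 4 * l2_sq \<xi>"
    unfolding \<zeta>_def using l2_diff(2)[of "\<lambda>x. \<xi> (inv z1 \<otimes> x)" "\<lambda>x. \<xi> (inv z2 \<otimes> x)"] z1c z2 \<xi>
    by (simp add: l2_translate l2_sq_translate)
  \<comment> \<open>\<open>A\<close> is a matrix coefficient of \<open>\<zeta>\<close>; expanding
    \<open>\<zeta>\<close> in the first slot only writes it as a difference of two values of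
    \<open>B\<close>, and these can be matched between different pairs.\<close>
  define A where "A y = (LINT x|?c. \<zeta> (y \<otimes> x) * cnj (\<zeta> x))" for y
  define B where "B y = (LINT x|?c. \<xi> (y \<otimes> x) * cnj (\<zeta> x))" for y
  have A_le: "cmod (A y) \<le> 4 * l2_sq \<xi>" if "y \<in> carrier R" for y
    using inner_bound[of "\<lambda>x. \<zeta> (y \<otimes> x)" \<zeta>] that \<zeta> \<zeta>_le
    unfolding A_def by (simp add: l2_translate l2_sq_translate)
  have A_eq: "A y = B (inv z1 \<otimes> y) - B (inv z2 \<otimes> y)" if y: "y \<in> carrier R" for y
  proof -
    have "A y = (LINT x|?c. \<xi> (inv z1 \<otimes> y \<otimes> x) * cnj (\<zeta> x) - \<xi> (inv z2 \<otimes> y \<otimes> x) * cnj (\<zeta> x))"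
      unfolding A_def using y z1c z2
      by (intro Bochner_Integration.integral_cong) (auto simp: \<zeta>_def algebra_simps m_assoc)
    also have "\<dots> = B (inv z1 \<otimes> y) - B (inv z2 \<otimes> y)"
      unfolding B_def
      using integrable_mult_cnj[OF l2_translate[OF _ \<xi>] \<zeta>, of "inv z1 \<otimes> y"]
        integrable_mult_cnj[OF l2_translate[OF _ \<xi>] \<zeta>, of "inv z2 \<otimes> y"] y z1c z2
      by (intro Bochner_Integration.integral_diff) auto
    finally show ?thesis .
  qed
  define L where "L s x = \<zeta> (inv (h s) \<otimes> x)" for s x
  have L: "l2 (L s)" if "s \<in> S" for s
    using l2_translate[OF inv_closed[OF h[OF that]] \<zeta>] by (simp add: L_def[abs_def])
  \<comment> \<open>The substitution \<open>x \<mapsto> h s' \<otimes> x\<close> shows that the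
    inner product depends on \<open>inv (h s) \<otimes> h s'\<close> alone.\<close>
  have pair: "(LINT x|?c. L s x * cnj (L s' x)) = A (v (s, s'))" if s: "s \<in> S" "s' \<in> S" for s s'
  proof -
    have hv: "v (s, s') = inv (h s) \<otimes> h s'"
      using v[OF s] h[OF s(1)] h[OF s(2)] by (intro inv_solve_left[THEN iffD2]) auto
    have "(LINT x|?c. L s x * cnj (L s' x)) = (LINT x|?c. L s (h s' \<otimes> x) * cnj (L s' (h s' \<otimes> x)))"
      by (rule integral_bij_count_space[OF bij_betw_translate[OF h[OF s(2)]], symmetric])
    also have "\<dots> = A (v (s, s'))"
      unfolding A_def
    proof (intro Bochner_Integration.integral_cong refl)
      fix x assume "x \<in> space ?c"
      then have x: "x \<in> carrier R" by simp
      have "inv (h s) \<otimes> (h s' \<otimes> x) = v (s, s') \<otimes> x"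
        using x h s by (simp add: hv m_assoc)
      moreover have "inv (h s') \<otimes> (h s' \<otimes> x) = x"
        using x h s by (simp add: m_assoc[symmetric])
      ultimately show "L s (h s' \<otimes> x) * cnj (L s' (h s' \<otimes> x)) = \<zeta> (v (s, s') \<otimes> x) * cnj (\<zeta> x)"
        by (simp add: L_def)
    qed
    finally show ?thesis .
  qed
  have vc: "v p \<in> carrier R" if "p \<in> S \<times> S" for p
    using v that by (cases p) auto
  have good: "(\<Sum>p\<in>Good. A (v p)) = 0"
  proof -
    \<comment> \<open>Here \<open>z1 = w \<otimes> z2\<close> enters: the factor \<open>w\<close>
      gained by \<open>\<sigma>\<close> is cancelled by \<open>inv z1\<close>.\<close>
    have *: "B (inv z1 \<otimes> v (\<sigma> p)) = B (inv z2 \<otimes> v p)" if "p \<in> Good" for p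
    proof -
      have p: "v p \<in> carrier R" using vc that Good by blast
      have "inv z1 \<otimes> v (\<sigma> p) = inv z2 \<otimes> (inv w \<otimes> (w \<otimes> v p))"
        using p w z2 by (simp add: z1 shift[OF that] inv_mult_group m_assoc)
      also have "\<dots> = inv z2 \<otimes> v p"
        using p w by (simp add: m_assoc[symmetric])
      finally show ?thesis by simp
    qed
    have "(\<Sum>p\<in>Good. A (v p)) = (\<Sum>p\<in>Good. B (inv z1 \<otimes> v p)) - (\<Sum>p\<in>Good. B (inv z2 \<otimes> v p))"
      using Good vc by (subst sum_subtractf[symmetric], intro sum.cong A_eq) auto
    also have "(\<Sum>p\<in>Good. B (inv z1 \<otimes> v p)) = (\<Sum>p\<in>Good. B (inv z1 \<otimes> v (\<sigma> p)))"
      by (rule sum.reindex_bij_betw[OF \<sigma>, symmetric])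
    also have "\<dots> = (\<Sum>p\<in>Good. B (inv z2 \<otimes> v p))"
      using * by (intro sum.cong) auto
    finally show ?thesis by simp
  qed
  have eq: "(\<Sum>s\<in>S. \<xi> (inv (h s \<otimes> z1) \<otimes> x) - \<xi> (inv (h s \<otimes> z2) \<otimes> x)) = (\<Sum>s\<in>S. L s x)"
    if x: "x \<in> carrier R" for x
    using x h z1c z2 by (intro sum.cong) (auto simp: L_def \<zeta>_def inv_mult_group m_assoc)
  have "of_real (l2_sq (\<lambda>x. \<Sum>s\<in>S. \<xi> (inv (h s \<otimes> z1) \<otimes> x) - \<xi> (inv (h s \<otimes> z2) \<otimes> x)))
      = of_real (l2_sq (\<lambda>x. \<Sum>s\<in>S. L s x))"
    unfolding l2_sq_def by (intro arg_cong[where f = of_real] Bochner_Integration.integral_cong) (auto simp: eq)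
  also have "\<dots> = (LINT x|?c. (\<Sum>p\<in>S \<times> S. L (fst p) x * cnj (L (snd p) x)))"
    unfolding of_real_l2_sq by (simp add: sum_product sum.cartesian_product split_def)
  also have "\<dots> = (\<Sum>p\<in>S \<times> S. (LINT x|?c. L (fst p) x * cnj (L (snd p) x)))"
    by (intro Bochner_Integration.integral_sum integrable_mult_cnj L) auto
  also have "\<dots> = (\<Sum>p\<in>S \<times> S. A (v p))"
    by (intro sum.cong) (auto simp: pair)
  also have "\<dots> = (\<Sum>p\<in>S \<times> S - Good. A (v p)) + (\<Sum>p\<in>Good. A (v p))"
    using S Good by (intro sum.subset_diff) auto
  finally have "of_real (l2_sq (\<lambda>x. \<Sum>s\<in>S. \<xi> (inv (h s \<otimes> z1) \<otimes> x) - \<xi> (inv (h s \<otimes> z2) \<otimes> x)))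
      = (\<Sum>p\<in>S \<times> S - Good. A (v p))"
    by (simp add: good)
  then have "cmod (of_real (l2_sq (\<lambda>x. \<Sum>s\<in>S. \<xi> (inv (h s \<otimes> z1) \<otimes> x) - \<xi> (inv (h s \<otimes> z2) \<otimes> x))))
      \<le> (\<Sum>p\<in>S \<times> S - Good. 4 * l2_sq \<xi>)"
    by (simp only:) (intro sum_norm_le A_le vc, auto)
  then show ?thesis by (simp add: l2_sq_nonneg mult_ac)
qed

end

section \<open>Reduced norms under an unknown normalisation of Haar measure\<close>

context discrete_group
begin

definition haar_mass :: real where
  "haar_mass = (SOME a. a > 0 \<and> left_haar R = density (count_space (carrier R)) (\<lambda>_. ennreal a))"

lemma haar_mass:
  "haar_mass > 0" "left_haar R = density (count_space (carrier R)) (\<lambda>_. ennreal haar_mass)"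
  using someI_ex[of "\<lambda>a. a > 0 \<and> left_haar R = density (count_space (carrier R)) (\<lambda>_. ennreal a)"]
    left_haar_eq_density unfolding haar_mass_def by blast+

lemma integral_left_haar:
  fixes f :: "'a \<Rightarrow> 'b::{banach, second_countable_topology}"
  shows "(LINT x|left_haar R. f x) = haar_mass *\<^sub>R (LINT x|count_space (carrier R). f x)"
  using haar_mass(1) by (simp add: haar_mass(2) integral_density)

lemma norm_L2_left_haar: "norm_L2 (left_haar R) \<xi> = sqrt (haar_mass * l2_sq \<xi>)"
  by (simp add: norm_L2_def integral_left_haar l2_sq_def)

lemma square_integrable_left_haar: "square_integrable (left_haar R) \<xi> \<longleftrightarrow> l2 \<xi>"
  using haar_mass(1) by (simp add: square_integrable_def l2_def haar_mass(2) integrable_density)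

lemma convol_eq_translates:
  assumes F: "finite F" "F \<subseteq> carrier R" and f: "\<And>y. y \<in> carrier R \<Longrightarrow> y \<notin> F \<Longrightarrow> f y = 0"
  shows "convol R f \<xi> x = of_real haar_mass * translates f F \<xi> x"
proof -
  let ?g = "\<lambda>y. f y * \<xi> (inv y \<otimes> x)"
  have sub: "{y \<in> carrier R. ?g y \<noteq> 0} \<subseteq> F" using f by auto
  then have "(LINT y|count_space (carrier R). ?g y) = (\<Sum>y | y \<in> carrier R \<and> ?g y \<noteq> 0. ?g y)"
    using F by (intro lebesgue_integral_count_space_finite_support) (auto intro: finite_subset)
  also have "\<dots> = (\<Sum>y\<in>F. ?g y)"
    using F sub by (intro sum.mono_neutral_left) auto
  finally show ?thesis
    by (simp add: convol_def integral_left_haar translates_def scaleR_conv_of_real)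
qed

lemma norm_L2_convol:
  assumes F: "finite F" "F \<subseteq> carrier R" and f: "\<And>y. y \<in> carrier R \<Longrightarrow> y \<notin> F \<Longrightarrow> f y = 0"
  shows "norm_L2 (left_haar R) (convol R f \<xi>) = haar_mass * sqrt (haar_mass * l2_sq (translates f F \<xi>))"
proof -
  have "l2_sq (convol R f \<xi>) = haar_mass\<^sup>2 * l2_sq (translates f F \<xi>)"
    using haar_mass(1)
    by (simp add: l2_sq_def convol_eq_translates[OF F f] norm_mult power_mult_distrib)
  then show ?thesis using haar_mass(1)
    by (simp add: norm_L2_left_haar real_sqrt_mult)
qed

lemma reduced_norm_le:
  assumes F: "finite F" "F \<subseteq> carrier R" and f: "\<And>y. y \<in> carrier R \<Longrightarrow> y \<notin> F \<Longrightarrow> f y = 0"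
    and M: "M \<ge> 0" "\<And>\<xi>. l2 \<xi> \<Longrightarrow> l2_sq (translates f F \<xi>) \<le> M\<^sup>2 * l2_sq \<xi>"
  shows "reduced_norm R f \<le> haar_mass * M"
  unfolding reduced_norm_def
proof (rule cSUP_least)
  have "l2 (\<lambda>_. 0)" "l2_sq (\<lambda>_. 0) = 0" by (simp_all add: l2_def l2_sq_def)
  then show "{\<xi>. square_integrable (left_haar R) \<xi> \<and> norm_L2 (left_haar R) \<xi> \<le> 1} \<noteq> {}"
    by (auto simp: square_integrable_left_haar norm_L2_left_haar intro!: exI[of _ "\<lambda>_. 0"])
next
  fix \<xi> assume "\<xi> \<in> {\<xi>. square_integrable (left_haar R) \<xi> \<and> norm_L2 (left_haar R) \<xi> \<le> 1}"
  then have \<xi>: "l2 \<xi>" "haar_mass * l2_sq \<xi> \<le> 1"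
    by (auto simp: square_integrable_left_haar norm_L2_left_haar)
  have "haar_mass * l2_sq (translates f F \<xi>) \<le> M\<^sup>2 * (haar_mass * l2_sq \<xi>)"
    using M(2)[OF \<xi>(1)] haar_mass(1) by (simp add: mult.left_commute)
  also have "\<dots> \<le> M\<^sup>2" using \<xi>(2) by (simp add: mult_left_le)
  finally have "sqrt (haar_mass * l2_sq (translates f F \<xi>)) \<le> M"
    using M(1) real_le_lsqrt by blast
  then show "norm_L2 (left_haar R) (convol R f \<xi>) \<le> haar_mass * M"
    using haar_mass(1) by (simp add: norm_L2_convol[OF F f])
qed

text \<open>A real supremum bounds its members only if the set is bounded above, which
  \<open>l2_translates\<close> provides.\<close>

lemma norm_L2_convol_le_reduced_norm:
  assumes F: "finite F" "F \<subseteq> carrier R" and f: "\<And>y. y \<in> carrier R \<Longrightarrow> y \<notin> F \<Longrightarrow> f y = 0"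
    and \<xi>: "l2 \<xi>" "haar_mass * l2_sq \<xi> \<le> 1"
  shows "norm_L2 (left_haar R) (convol R f \<xi>) \<le> reduced_norm R f"
  unfolding reduced_norm_def
proof (rule cSUP_upper)
  show "\<xi> \<in> {\<xi>. square_integrable (left_haar R) \<xi> \<and> norm_L2 (left_haar R) \<xi> \<le> 1}"
    using \<xi> by (simp add: square_integrable_left_haar norm_L2_left_haar)
  show "bdd_above ((\<lambda>\<xi>. norm_L2 (left_haar R) (convol R f \<xi>)) `
      {\<xi>. square_integrable (left_haar R) \<xi> \<and> norm_L2 (left_haar R) \<xi> \<le> 1})"
  proof (rule bdd_aboveI2)
    fix \<xi> assume "\<xi> \<in> {\<xi>. square_integrable (left_haar R) \<xi> \<and> norm_L2 (left_haar R) \<xi> \<le> 1}"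
    then have \<xi>: "l2 \<xi>" "haar_mass * l2_sq \<xi> \<le> 1"
      by (auto simp: square_integrable_left_haar norm_L2_left_haar)
    let ?M = "\<Sum>y\<in>F. cmod (f y)"
    have "haar_mass * l2_sq (translates f F \<xi>) \<le> ?M\<^sup>2 * (haar_mass * l2_sq \<xi>)"
      using l2_translates(2)[OF \<xi>(1) F(2), of f] haar_mass(1) by (simp add: mult.left_commute)
    also have "\<dots> \<le> ?M\<^sup>2" using \<xi>(2) by (simp add: mult_left_le)
    finally have "sqrt (haar_mass * l2_sq (translates f F \<xi>)) \<le> ?M"
      by (intro real_le_lsqrt) (auto intro: sum_nonneg)
    then show "norm_L2 (left_haar R) (convol R f \<xi>) \<le> haar_mass * ?M"
      using haar_mass(1) by (simp add: norm_L2_convol[OF F f])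
  qed
qed

text \<open>The normalised indicator of \<open>E\<close> plays the part of the trivial representation.\<close>

lemma reduced_norm_ge_sum:
  assumes F: "finite F" "F \<subseteq> carrier R" and f: "\<And>y. y \<in> carrier R \<Longrightarrow> y \<notin> F \<Longrightarrow> f y = 0"
    and E: "finite E" "E \<noteq> {}" "E \<subseteq> carrier R"
    and FE: "\<And>x y. y \<in> F \<Longrightarrow> x \<in> E \<Longrightarrow> inv y \<otimes> x \<in> E"
  shows "haar_mass * cmod (\<Sum>y\<in>F. f y) \<le> reduced_norm R f"
proof -
  define t where "t = 1 / sqrt (haar_mass * card E)"
  define \<xi> where "\<xi> x = (if x \<in> E then complex_of_real t else 0)" for x
  have cE: "card E > 0" using E by (simp add: card_gt_0_iff)
  have t2: "t\<^sup>2 = 1 / (haar_mass * card E)"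
    using haar_mass(1) by (simp add: t_def power_divide)
  have l2: "l2 \<xi>"
  proof -
    have "integrable (count_space (carrier R)) (\<lambda>x. t\<^sup>2 * indicator E x)"
      using E by (intro integrable_mult_right integrable_real_indicator) (auto simp: of_nat_less_top)
    moreover have "(cmod (\<xi> x))\<^sup>2 = t\<^sup>2 * indicator E x" for x by (simp add: \<xi>_def indicator_def)
    ultimately show ?thesis by (simp add: l2_def)
  qed
  have "l2_sq \<xi> = (\<Sum>x\<in>E. (cmod (\<xi> x))\<^sup>2)"
  proof -
    have "l2_sq \<xi> = (\<Sum>x | x \<in> carrier R \<and> (cmod (\<xi> x))\<^sup>2 \<noteq> 0. (cmod (\<xi> x))\<^sup>2)"
      unfolding l2_sq_def using E
      by (intro lebesgue_integral_count_space_finite_support) (auto simp: \<xi>_def)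
    also have "\<dots> = (\<Sum>x\<in>E. (cmod (\<xi> x))\<^sup>2)"
      using E by (intro sum.mono_neutral_left) (auto simp: \<xi>_def)
    finally show ?thesis .
  qed
  then have unit: "haar_mass * l2_sq \<xi> = 1"
    using haar_mass(1) cE by (simp add: \<xi>_def t2)
  \<comment> \<open>For \<open>x\<close> in \<open>E\<close> every argument
    \<open>inv y \<otimes> x\<close> lies in \<open>E\<close> again, so all translates have the
    common value \<open>t\<close> there.\<close>
  have val: "translates f F \<xi> x = t * (\<Sum>y\<in>F. f y)" if "x \<in> E" for x
    using FE that by (simp add: translates_def \<xi>_def sum_distrib_left mult.commute)
  have "card E * (t * cmod (\<Sum>y\<in>F. f y))\<^sup>2 = (\<Sum>x\<in>E. (cmod (translates f F \<xi> x))\<^sup>2)"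
    by (simp add: val norm_mult power_mult_distrib)
  also have "\<dots> = (LINT x|count_space (carrier R). indicator E x *\<^sub>R (cmod (translates f F \<xi> x))\<^sup>2)"
    using E by (subst lebesgue_integral_count_space_finite_support)
      (auto intro!: sum.mono_neutral_right simp: indicator_def split: if_splits)
  also have "\<dots> \<le> l2_sq (translates f F \<xi>)"
    unfolding l2_sq_def
  proof (rule integral_mono)
    show "integrable (count_space (carrier R)) (\<lambda>x. (cmod (translates f F \<xi> x))\<^sup>2)"
      using l2_translates(1)[OF l2 F(2)] by (simp add: l2_def)
    then show "integrable (count_space (carrier R)) (\<lambda>x. indicator E x *\<^sub>R (cmod (translates f F \<xi> x))\<^sup>2)"
      using E by (intro integrable_mult_indicator) auto
  qed (auto simp: indicator_def)
  finally have "haar_mass * (card E * (t * cmod (\<Sum>y\<in>F. f y))\<^sup>2) \<le> haar_mass * l2_sq (translates f F \<xi>)"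
    using haar_mass(1) by simp
  moreover have "haar_mass * (card E * (t * cmod (\<Sum>y\<in>F. f y))\<^sup>2) = (cmod (\<Sum>y\<in>F. f y))\<^sup>2"
    using haar_mass(1) cE by (simp add: power_mult_distrib t2)
  ultimately have "cmod (\<Sum>y\<in>F. f y) \<le> sqrt (haar_mass * l2_sq (translates f F \<xi>))"
    by (simp add: real_le_rsqrt)
  then have "haar_mass * cmod (\<Sum>y\<in>F. f y) \<le> norm_L2 (left_haar R) (convol R f \<xi>)"
    using haar_mass(1) by (simp add: norm_L2_convol[OF F f])
  also have "\<dots> \<le> reduced_norm R f"
    using norm_L2_convol_le_reduced_norm[OF F f l2] unit by simp
  finally show ?thesis .
qed

lemma supp_on_subset:
  assumes "F \<subseteq> carrier R" "\<And>y. y \<in> carrier R \<Longrightarrow> y \<notin> F \<Longrightarrow> f y = 0"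
  shows "supp_on R f \<subseteq> F"
  unfolding supp_on_def
proof (rule closure_of_minimal)
  show "{x \<in> carrier R. f x \<noteq> 0} \<subseteq> F" using assms by auto
  show "closedin (top_of_set (carrier R)) F"
    using assms(1) openin_carrier[of "carrier R - F"] by (simp add: closedin_def)
qed

lemma finite_support_in_Cc:
  assumes "finite F" "F \<subseteq> carrier R" "\<And>y. y \<in> carrier R \<Longrightarrow> y \<notin> F \<Longrightarrow> f y = 0"
  shows "f \<in> Cc R"
proof -
  have "continuous_on (carrier R) f"
    unfolding continuous_on_open_invariant
  proof (intro allI impI)
    fix B :: "complex set" assume "open B"
    have "openin (top_of_set (carrier R)) (f -` B \<inter> carrier R)" by (rule openin_carrier) auto
    then show "\<exists>A. open A \<and> A \<inter> carrier R = f -` B \<inter> carrier R"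
      unfolding openin_open by blast
  qed
  moreover have "finite (supp_on R f)"
    by (rule finite_subset[OF supp_on_subset[OF assms(2,3)] assms(1)])
  ultimately show ?thesis by (simp add: Cc_def finite_imp_compact)
qed

end

section \<open>Testing restricted Schur multipliers on finitely supported functions\<close>

text \<open>The upper norm bound \<open>M\<close> makes a multiple of \<open>f\<close> admissible,
  and the trivial representation bounds the image under the multiplier from below. Both estimates
  carry one factor \<open>haar_mass\<close>, so the normalisation of the measure disappears from the
  conclusion.\<close>

lemma schur_norm_test:
  assumes dg: "discrete_group (G\<lparr>carrier := L\<rparr>)"
    and F: "finite F" "F \<subseteq> L" "F \<subseteq> length_ball G len n"
    and f: "\<And>y. y \<notin> F \<Longrightarrow> f y = 0"
    and M: "M > 0"
      "\<And>\<xi>. discrete_group.l2 (G\<lparr>carrier := L\<rparr>) \<xi> \<Longrightarrow>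
        discrete_group.l2_sq (G\<lparr>carrier := L\<rparr>) (discrete_group.translates (G\<lparr>carrier := L\<rparr>) f F \<xi>)
          \<le> M\<^sup>2 * discrete_group.l2_sq (G\<lparr>carrier := L\<rparr>) \<xi>"
    and E: "finite E" "E \<noteq> {}" "E \<subseteq> L"
    and FE: "\<And>x y. y \<in> F \<Longrightarrow> x \<in> E \<Longrightarrow> inv\<^bsub>G\<lparr>carrier := L\<rparr>\<^esub> y \<otimes>\<^bsub>G\<^esub> x \<in> E"
    and c: "schur_norm G L len n c \<le> ereal C"
  shows "cmod (\<Sum>y\<in>F. c y * f y) \<le> M * C"
proof -
  interpret R: discrete_group "G\<lparr>carrier := L\<rparr>" by (rule dg)
  let ?R = "G\<lparr>carrier := L\<rparr>"
  define r where "r = complex_of_real (1 / (R.haar_mass * M))"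
  define f' where "f' y = r * f y" for y
  have r: "cmod r = 1 / (R.haar_mass * M)" using R.haar_mass(1) M(1) by (simp add: r_def norm_divide norm_mult)
  have f'0: "\<And>y. y \<in> carrier ?R \<Longrightarrow> y \<notin> F \<Longrightarrow> f' y = 0" using f by (simp add: f'_def)
  have F': "F \<subseteq> carrier ?R" using F by simp
  have "reduced_norm ?R f' \<le> R.haar_mass * (1 / R.haar_mass)"
  proof (rule R.reduced_norm_le[OF F(1) F' f'0])
    show "0 \<le> 1 / R.haar_mass" using R.haar_mass(1) by simp
    fix \<xi> assume \<xi>: "R.l2 \<xi>"
    have "R.translates f' F \<xi> = (\<lambda>x. r * R.translates f F \<xi> x)"
      by (simp add: R.translates_def f'_def sum_distrib_left mult.assoc fun_eq_iff)
    then have "R.l2_sq (R.translates f' F \<xi>) = (cmod r)\<^sup>2 * R.l2_sq (R.translates f F \<xi>)"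
      by (simp add: R.l2_sq_def norm_mult power_mult_distrib)
    also have "\<dots> \<le> (cmod r)\<^sup>2 * (M\<^sup>2 * R.l2_sq \<xi>)"
      using M(2)[OF \<xi>] by (intro mult_left_mono) auto
    also have "\<dots> = (1 / R.haar_mass)\<^sup>2 * R.l2_sq \<xi>"
      using M(1) unfolding r by (simp add: field_simps power_mult_distrib)
    finally show "R.l2_sq (R.translates f' F \<xi>) \<le> (1 / R.haar_mass)\<^sup>2 * R.l2_sq \<xi>" .
  qed
  then have n1: "reduced_norm ?R f' \<le> 1" using R.haar_mass(1) by simp
  have "f' \<in> Cc ?R" by (rule R.finite_support_in_Cc[OF F(1) F' f'0])
  moreover have "supp_on ?R f' \<subseteq> length_ball G len n"
    by (rule order_trans[OF R.supp_on_subset[OF F' f'0] F(3)])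
  ultimately have "ereal (reduced_norm ?R (\<lambda>h. c h * f' h)) \<le> schur_norm G L len n c"
    unfolding schur_norm_def using n1 by (intro SUP_upper) simp
  with c have "reduced_norm ?R (\<lambda>h. c h * f' h) \<le> C"
    by (metis ereal_less_eq(3) order_trans)
  moreover have "R.haar_mass * cmod (\<Sum>y\<in>F. c y * f' y) \<le> reduced_norm ?R (\<lambda>h. c h * f' h)"
    using E FE f'0 by (intro R.reduced_norm_ge_sum[OF F(1) F', where E = E]) auto
  moreover have "R.haar_mass * cmod (\<Sum>y\<in>F. c y * f' y) = cmod (\<Sum>y\<in>F. c y * f y) / M"
  proof -
    have "(\<Sum>y\<in>F. c y * f' y) = r * (\<Sum>y\<in>F. c y * f y)"
      by (simp add: f'_def sum_distrib_left mult_ac)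
    then show ?thesis using R.haar_mass(1) by (simp only: norm_mult r) simp
  qed
  ultimately have "cmod (\<Sum>y\<in>F. c y * f y) / M \<le> C" by simp
  then show ?thesis using M(1) by (simp add: field_simps)
qed

text \<open>A point mass acts by a translation, an isometry, so the test applies with
  \<open>M = 1\<close>.\<close>

lemma schur_norm_point_bound:
  assumes dg: "discrete_group (G\<lparr>carrier := L\<rparr>)"
    and y: "y \<in> L" "y \<in> length_ball G len n"
    and E: "finite E" "E \<noteq> {}" "E \<subseteq> L" "\<And>x. x \<in> E \<Longrightarrow> inv\<^bsub>G\<lparr>carrier := L\<rparr>\<^esub> y \<otimes>\<^bsub>G\<^esub> x \<in> E"
    and c: "schur_norm G L len n c \<le> ereal C"
  shows "cmod (c y) \<le> C"
proof -
  interpret R: discrete_group "G\<lparr>carrier := L\<rparr>" by (rule dg)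
  have "cmod (\<Sum>x\<in>{y}. c x * (if x = y then 1 else 0)) \<le> 1 * C"
  proof (rule schur_norm_test[OF dg _ _ _ _ _ _ E(1-3) _ c])
    show "inv\<^bsub>G\<lparr>carrier := L\<rparr>\<^esub> y' \<otimes>\<^bsub>G\<^esub> x \<in> E" if "y' \<in> {y}" "x \<in> E" for x y'
      using that E(4) by simp
    show "finite {y}" "{y} \<subseteq> L" "{y} \<subseteq> length_ball G len n" "(0::real) < 1"
      "\<And>x. x \<notin> {y} \<Longrightarrow> (if x = y then 1 else 0 :: complex) = 0" using y by simp_all
    fix \<xi> assume "R.l2 \<xi>"
    then show "R.l2_sq (R.translates (\<lambda>x. if x = y then 1 else 0) {y} \<xi>) \<le> 1\<^sup>2 * R.l2_sq \<xi>"
      using R.l2_translates(2)[of \<xi> "{y}" "\<lambda>x. if x = y then 1 else 0"] y by simp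
  qed
  then show ?thesis by simp
qed

text \<open>The norm bound \<open>M\<close> is twice the square root of the number of bad pairs,
  from \<open>l2_sq_pair_cancellation\<close>; \<open>bad\<close> keeps it positive, so that
  dividing by it makes sense.\<close>

lemma schur_norm_difference_bound:
  assumes dg: "discrete_group (G\<lparr>carrier := L\<rparr>)"
    and S: "finite S" and h: "\<And>s. s \<in> S \<Longrightarrow> h s \<in> L"
    and v: "\<And>s s'. s \<in> S \<Longrightarrow> s' \<in> S \<Longrightarrow> v (s, s') \<in> L \<and> h s \<otimes>\<^bsub>G\<^esub> v (s, s') = h s'"
    and w: "w \<in> L" and z2: "z2 \<in> L" and z1: "z1 = w \<otimes>\<^bsub>G\<^esub> z2"
    and Good: "Good \<subseteq> S \<times> S" and \<sigma>: "bij_betw \<sigma> Good Good"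
    and shift: "\<And>p. p \<in> Good \<Longrightarrow> v (\<sigma> p) = w \<otimes>\<^bsub>G\<^esub> v p"
    and bad: "card (S \<times> S - Good) > 0"
    and ball: "\<And>s. s \<in> S \<Longrightarrow> h s \<otimes>\<^bsub>G\<^esub> z1 \<in> length_ball G len n"
      "\<And>s. s \<in> S \<Longrightarrow> h s \<otimes>\<^bsub>G\<^esub> z2 \<in> length_ball G len n"
    and E: "finite E" "E \<noteq> {}" "E \<subseteq> L"
    and FE: "\<And>s x. s \<in> S \<Longrightarrow> x \<in> E \<Longrightarrow> inv\<^bsub>G\<lparr>carrier := L\<rparr>\<^esub> (h s \<otimes>\<^bsub>G\<^esub> z1) \<otimes>\<^bsub>G\<^esub> x \<in> E"
      "\<And>s x. s \<in> S \<Longrightarrow> x \<in> E \<Longrightarrow> inv\<^bsub>G\<lparr>carrier := L\<rparr>\<^esub> (h s \<otimes>\<^bsub>G\<^esub> z2) \<otimes>\<^bsub>G\<^esub> x \<in> E"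
    and c: "schur_norm G L len n c \<le> ereal C"
  shows "cmod (\<Sum>s\<in>S. c (h s \<otimes>\<^bsub>G\<^esub> z1) - c (h s \<otimes>\<^bsub>G\<^esub> z2))
    \<le> 2 * sqrt (real (card (S \<times> S - Good))) * C"
proof -
  interpret R: discrete_group "G\<lparr>carrier := L\<rparr>" by (rule dg)
  let ?R = "G\<lparr>carrier := L\<rparr>"
  \<comment> \<open>The values are summed over \<open>s\<close> because translates for different
    \<open>s\<close> may coincide and must then be counted with multiplicity.\<close>
  define f :: "'a \<Rightarrow> complex" where
    "f y = (\<Sum>s\<in>S. (if h s \<otimes>\<^bsub>G\<^esub> z1 = y then 1 else 0) - (if h s \<otimes>\<^bsub>G\<^esub> z2 = y then 1 else 0))" for y
  define F where "F = (\<lambda>s. h s \<otimes>\<^bsub>G\<^esub> z1) ` S \<union> (\<lambda>s. h s \<otimes>\<^bsub>G\<^esub> z2) ` S"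
  have finF: "finite F" using S by (simp add: F_def)
  have z1L: "z1 \<in> L" using R.m_closed[of w z2] w z2 z1 by simp
  have mc: "x \<otimes>\<^bsub>G\<^esub> y \<in> L" if "x \<in> L" "y \<in> L" for x y using R.m_closed[of x y] that by simp
  have FL: "F \<subseteq> L" using h z1L z2 mc by (auto simp: F_def)
  have sum: "(\<Sum>y\<in>F. f y * g y) = (\<Sum>s\<in>S. g (h s \<otimes>\<^bsub>G\<^esub> z1) - g (h s \<otimes>\<^bsub>G\<^esub> z2))" for g :: "'a \<Rightarrow> complex"
  proof -
    have "(\<Sum>y\<in>F. f y * g y) = (\<Sum>s\<in>S. \<Sum>y\<in>F.
        (if h s \<otimes>\<^bsub>G\<^esub> z1 = y then g y else 0) - (if h s \<otimes>\<^bsub>G\<^esub> z2 = y then g y else 0))"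
      unfolding f_def sum_distrib_right
      by (subst sum.swap) (intro sum.cong refl, simp add: left_diff_distrib if_distrib cong: if_cong)
    also have "\<dots> = (\<Sum>s\<in>S. g (h s \<otimes>\<^bsub>G\<^esub> z1) - g (h s \<otimes>\<^bsub>G\<^esub> z2))"
      using finF by (intro sum.cong refl) (auto simp: sum_subtractf F_def)
    finally show ?thesis .
  qed
  have cancel: "R.l2_sq (\<lambda>x. \<Sum>s\<in>S.
        \<xi> (inv\<^bsub>?R\<^esub> (h s \<otimes>\<^bsub>?R\<^esub> z1) \<otimes>\<^bsub>?R\<^esub> x) - \<xi> (inv\<^bsub>?R\<^esub> (h s \<otimes>\<^bsub>?R\<^esub> z2) \<otimes>\<^bsub>?R\<^esub> x))
      \<le> 4 * real (card (S \<times> S - Good)) * R.l2_sq \<xi>" if "R.l2 \<xi>" for \<xi>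
  proof (rule R.l2_sq_pair_cancellation[where v = v and w = w and \<sigma> = \<sigma>, OF S _ _ _ _ _ Good \<sigma> _ that])
    show "h s \<in> carrier ?R" if "s \<in> S" for s using h[OF that] by simp
    show "v (s, s') \<in> carrier ?R \<and> h s \<otimes>\<^bsub>?R\<^esub> v (s, s') = h s'" if "s \<in> S" "s' \<in> S" for s s'
      using v[OF that] by simp
    show "w \<in> carrier ?R" "z2 \<in> carrier ?R" using w z2 by simp_all
    show "z1 = w \<otimes>\<^bsub>?R\<^esub> z2" using z1 by simp
    show "v (\<sigma> p) = w \<otimes>\<^bsub>?R\<^esub> v p" if "p \<in> Good" for p using shift[OF that] by simp
  qed
  have "cmod (\<Sum>y\<in>F. c y * f y) \<le> 2 * sqrt (real (card (S \<times> S - Good))) * C"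
  proof (rule schur_norm_test[OF dg finF FL _ _ _ _ E _ c])
    show "F \<subseteq> length_ball G len n" using ball by (auto simp: F_def)
    show "f y = 0" if "y \<notin> F" for y using that by (auto simp: f_def F_def intro!: sum.neutral)
    show "0 < 2 * sqrt (real (card (S \<times> S - Good)))" using bad by simp
    show "inv\<^bsub>G\<lparr>carrier := L\<rparr>\<^esub> y \<otimes>\<^bsub>G\<^esub> x \<in> E" if "y \<in> F" "x \<in> E" for x y
      using that FE by (auto simp: F_def)
    fix \<xi> assume \<xi>: "R.l2 \<xi>"
    have "R.translates f F \<xi> = (\<lambda>x. \<Sum>s\<in>S.
        \<xi> (inv\<^bsub>G\<lparr>carrier := L\<rparr>\<^esub> (h s \<otimes>\<^bsub>G\<^esub> z1) \<otimes>\<^bsub>G\<^esub> x) - \<xi> (inv\<^bsub>G\<lparr>carrier := L\<rparr>\<^esub> (h s \<otimes>\<^bsub>G\<^esub> z2) \<otimes>\<^bsub>G\<^esub> x))"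
      by (simp add: R.translates_def sum fun_eq_iff)
    then show "R.l2_sq (R.translates f F \<xi>) \<le> (2 * sqrt (real (card (S \<times> S - Good))))\<^sup>2 * R.l2_sq \<xi>"
      using cancel[OF \<xi>] by (simp add: power_mult_distrib)
  qed
  then show ?thesis using sum[of c] by (simp add: mult.commute)
qed

section \<open>Laurent series and polynomials in the inverse variable\<close>

text \<open>Degree at most \<open>n\<close> in \<open>fls_X_inv\<close>. Integer \<open>n\<close>
  lets one notion serve for pole orders (\<open>n > 0\<close>), the ring of integers
  (\<open>n = 0\<close>) and closeness to zero (\<open>n < 0\<close>).\<close>

definition fls_bdd :: "int \<Rightarrow> 'q::field fls \<Rightarrow> bool" where
  "fls_bdd n x \<longleftrightarrow> (\<forall>k < - n. x $$ k = 0)"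

lemma fls_bdd_iff_subdegree: "fls_bdd n x \<longleftrightarrow> x = 0 \<or> - n \<le> fls_subdegree x"
proof
  assume "fls_bdd n x"
  then show "x = 0 \<or> - n \<le> fls_subdegree x"
    unfolding fls_bdd_def by (meson nth_fls_subdegree_nonzero not_le)
qed (auto simp: fls_bdd_def)

lemma fls_bdd_0 [simp]: "fls_bdd n 0"
  by (simp add: fls_bdd_def)

lemma fls_bdd_1 [simp]: "fls_bdd n 1 \<longleftrightarrow> 0 \<le> n"
  by (simp add: fls_bdd_iff_subdegree)

lemma fls_bdd_mono: "fls_bdd m x \<Longrightarrow> m \<le> n \<Longrightarrow> fls_bdd n x"
  by (simp add: fls_bdd_def)

lemma fls_bdd_uminus [simp]: "fls_bdd n (- x) \<longleftrightarrow> fls_bdd n x"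
  by (simp add: fls_bdd_def)

lemma fls_bdd_add: "fls_bdd n x \<Longrightarrow> fls_bdd n y \<Longrightarrow> fls_bdd n (x + y)"
  by (simp add: fls_bdd_def)

lemma fls_bdd_diff: "fls_bdd n x \<Longrightarrow> fls_bdd n y \<Longrightarrow> fls_bdd n (x - y)"
  by (simp add: fls_bdd_def)

lemma fls_bdd_sum: "(\<And>i. i \<in> I \<Longrightarrow> fls_bdd n (f i)) \<Longrightarrow> fls_bdd n (sum f I)"
  by (induction I rule: infinite_finite_induct) (auto intro: fls_bdd_add)

lemma fls_bdd_mult: "fls_bdd m x \<Longrightarrow> fls_bdd n y \<Longrightarrow> fls_bdd (m + n) (x * y)"
  by (cases "x = 0 \<or> y = 0") (auto simp: fls_bdd_iff_subdegree)

lemma fls_bdd_mult_left: "fls_bdd 0 x \<Longrightarrow> fls_bdd n y \<Longrightarrow> fls_bdd n (x * y)"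
  using fls_bdd_mult[of 0 x n y] by simp

lemma fls_bdd_divide: "x \<noteq> 0 \<Longrightarrow> fls_bdd (- fls_subdegree x) y \<Longrightarrow> fls_bdd 0 (y / x)"
  by (cases "y = 0") (auto simp: fls_bdd_iff_subdegree fls_divide_subdegree)

lemma power_series_ring_eq: "power_series_ring = {x. fls_bdd 0 x}"
proof
  show "power_series_ring \<subseteq> {x::'a fls. fls_bdd 0 x}"
    by (auto simp: power_series_ring_def fls_bdd_def)
  show "{x::'a fls. fls_bdd 0 x} \<subseteq> power_series_ring"
  proof
    fix x :: "'a fls" assume "x \<in> {x. fls_bdd 0 x}"
    then have "x = fps_to_fls (fls_regpart x)"
      by (intro fls_eqI) (auto simp: fls_bdd_def)
    then show "x \<in> power_series_ring" by (auto simp: power_series_ring_def)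
  qed
qed

definition poly_fls :: "'q::field poly \<Rightarrow> 'q fls" where
  "poly_fls p = poly (map_poly fls_const p) fls_X_inv"

lemma poly_fls_0 [simp]: "poly_fls 0 = 0"
  by (simp add: poly_fls_def)

lemma poly_fls_pCons: "poly_fls (pCons a p) = fls_const a + fls_X_inv * poly_fls p"
  by (simp add: poly_fls_def map_poly_pCons)

lemma poly_fls_nth: "poly_fls p $$ k = (if k \<le> 0 then coeff p (nat (- k)) else 0)"
proof (induction p arbitrary: k)
  case (pCons a p)
  have "k < 0 \<Longrightarrow> nat (- k) = Suc (nat (- (k + 1)))" by simp
  then show ?case
    by (cases "k < 0"; cases "k = 0") (auto simp: poly_fls_pCons pCons.IH fls_X_inv_times_conv_shift)
qed auto

lemma poly_fls_eq_iff [simp]: "poly_fls p = poly_fls q \<longleftrightarrow> p = q"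
proof
  assume "poly_fls p = poly_fls q"
  then have "poly_fls p $$ (- int k) = poly_fls q $$ (- int k)" for k by simp
  then show "p = q" by (intro poly_eqI) (simp add: poly_fls_nth)
qed simp

lemma poly_fls_add: "poly_fls (p + q) = poly_fls p + poly_fls q"
  by (intro fls_eqI) (simp add: poly_fls_nth)

lemma poly_fls_uminus: "poly_fls (- p) = - poly_fls p"
  by (intro fls_eqI) (simp add: poly_fls_nth)

lemma poly_fls_diff: "poly_fls (p - q) = poly_fls p - poly_fls q"
  by (intro fls_eqI) (simp add: poly_fls_nth)

lemma poly_fls_smult: "poly_fls (smult a p) = fls_const a * poly_fls p"
  by (intro fls_eqI) (simp add: poly_fls_nth)

lemma poly_fls_mult: "poly_fls (p * q) = poly_fls p * poly_fls q"
proof (induction p)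
  case (pCons a p)
  then show ?case
    by (simp add: poly_fls_pCons poly_fls_add poly_fls_smult mult_pCons_left algebra_simps)
qed simp

lemma poly_fls_1 [simp]: "poly_fls 1 = 1"
  by (intro fls_eqI) (auto simp: poly_fls_nth coeff_1)

lemmas poly_fls_hom = poly_fls_add poly_fls_uminus poly_fls_diff poly_fls_mult

lemma fls_bdd_poly_fls [simp]: "fls_bdd (int n) (poly_fls p) \<longleftrightarrow> degree p \<le> n"
proof
  assume *: "fls_bdd (int n) (poly_fls p)"
  show "degree p \<le> n"
  proof (rule degree_le, intro allI impI)
    fix k assume "n < k"
    then show "coeff p k = 0"
      using * unfolding fls_bdd_def by (auto simp: poly_fls_nth dest!: spec[of _ "- int k"])
  qed
next
  assume "degree p \<le> n"
  then show "fls_bdd (int n) (poly_fls p)"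
    by (auto simp: fls_bdd_def poly_fls_nth intro!: coeff_eq_0)
qed

lemma polys_in_X_inv_eq: "polys_in_X_inv = range poly_fls"
  by (simp add: polys_in_X_inv_def poly_fls_def)

lemma polys_in_X_inv_eq_nth: "polys_in_X_inv = {x. \<forall>k>0. x $$ k = 0}"
proof
  show "polys_in_X_inv \<subseteq> {x::'a fls. \<forall>k>0. x $$ k = 0}"
    by (auto simp: polys_in_X_inv_eq poly_fls_nth)
  show "{x::'a fls. \<forall>k>0. x $$ k = 0} \<subseteq> polys_in_X_inv"
  proof
    fix x :: "'a fls" assume x: "x \<in> {x. \<forall>k>0. x $$ k = 0}"
    define p where "p = Abs_poly (\<lambda>k. x $$ (- int k))"
    have "\<forall>\<^sub>\<infinity>k. x $$ (- int k) = 0"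
      by (rule MOST_nat[THEN iffD2], rule exI[of _ "nat (- fls_subdegree x)"]) auto
    then have "coeff p k = x $$ (- int k)" for k
      by (simp add: p_def Abs_poly_inverse)
    then have "poly_fls p = x" using x by (intro fls_eqI) (auto simp: poly_fls_nth)
    then show "x \<in> polys_in_X_inv" by (auto simp: polys_in_X_inv_eq)
  qed
qed

text \<open>Stated by coefficients, so that zero belongs to it for every \<open>n\<close> and the
  cardinality is \<open>q ^ n\<close> even for \<open>n = 0\<close>.\<close>

definition polys_below :: "nat \<Rightarrow> 'q::field poly set" where
  "polys_below n = {p. \<forall>k\<ge>n. coeff p k = 0}"

lemma polys_below_Suc: "(polys_below (Suc n) :: 'q::field poly set) = (\<lambda>(a, p). pCons a p) ` (UNIV \<times> polys_below n)"
proof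
  show "(polys_below (Suc n) :: 'q poly set) \<subseteq> (\<lambda>(a, p). pCons a p) ` (UNIV \<times> polys_below n)"
  proof
    fix p :: "'q poly" assume p: "p \<in> polys_below (Suc n)"
    obtain a q where pq: "p = pCons a q" by (rule pCons_cases)
    have "coeff q k = 0" if "n \<le> k" for k
      using p that unfolding polys_below_def pq
      by (metis (mono_tags, lifting) Suc_le_mono coeff_pCons_Suc mem_Collect_eq)
    then have "q \<in> polys_below n" by (simp add: polys_below_def)
    then show "p \<in> (\<lambda>(a, p). pCons a p) ` (UNIV \<times> polys_below n)" using pq by auto
  qed
qed (auto simp: polys_below_def coeff_pCons split: nat.splits)

lemma polys_below_0: "polys_below 0 = {0}"
  by (auto simp: polys_below_def poly_eq_iff)

lemma finite_polys_below [simp]: "finite (polys_below n :: 'q::{field,finite} poly set)"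
  by (induction n) (simp_all add: polys_below_0 polys_below_Suc)

lemma card_polys_below: "card (polys_below n :: 'q::{field,finite} poly set) = CARD('q) ^ n"
proof (induction n)
  case (Suc n)
  have "inj_on (\<lambda>(a, p). pCons a p) (UNIV \<times> polys_below n :: ('q \<times> 'q poly) set)"
    by (auto simp: inj_on_def)
  then show ?case by (simp add: polys_below_Suc card_image Suc card_cartesian_product)
qed (simp add: polys_below_0)

lemma polys_below_iff: "p \<in> polys_below n \<longleftrightarrow> p = 0 \<or> degree p < n"
proof
  assume "p \<in> polys_below n"
  then show "p = 0 \<or> degree p < n"
    by (metis (mono_tags, lifting) leading_coeff_0_iff mem_Collect_eq not_le polys_below_def)
qed (auto simp: polys_below_def intro: coeff_eq_0)

lemma polys_below_Suc_iff: "p \<in> polys_below (Suc n) \<longleftrightarrow> degree p \<le> n"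
  by (auto simp: polys_below_iff)

lemma polys_below_add: "p \<in> polys_below n \<Longrightarrow> q \<in> polys_below n \<Longrightarrow> p + q \<in> polys_below n"
  and polys_below_diff: "p \<in> polys_below n \<Longrightarrow> q \<in> polys_below n \<Longrightarrow> p - q \<in> polys_below n"
  and zero_in_polys_below [simp]: "0 \<in> polys_below n"
  by (simp_all add: polys_below_def)

section \<open>The topological group of symplectic matrices\<close>

lemma vector_4 [simp]:
  "vector [a, b, c, d] $ (1::4) = a" "vector [a, b, c, d] $ (2::4) = b"
  "vector [a, b, c, d] $ (3::4) = c" "vector [a, b, c, d] $ (4::4) = (d::'a::zero)"
  by (simp_all add: vector_def)

lemma vec_eq_iff_4: "(x::'a^4) = y \<longleftrightarrow> x$1 = y$1 \<and> x$2 = y$2 \<and> x$3 = y$3 \<and> x$4 = y$4"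
  by (simp add: vec_eq_iff forall_4)

lemma matrix_mult_nth_4: "((A::'a::semiring_1^4^4) ** B) $ i $ j =
    A$i$1 * B$1$j + A$i$2 * B$2$j + A$i$3 * B$3$j + A$i$4 * B$4$j"
  by (simp add: matrix_matrix_mult_def sum_4)

lemma J4_nth:
  "J4$1$1 = 0" "J4$1$2 = 0" "J4$1$3 = 0" "J4$1$4 = 1"
  "J4$2$1 = 0" "J4$2$2 = 0" "J4$2$3 = 1" "J4$2$4 = 0"
  "J4$3$1 = 0" "J4$3$2 = -1" "J4$3$3 = 0" "J4$3$4 = 0"
  "J4$4$1 = -1" "J4$4$2 = 0" "J4$4$3 = 0" "J4$4$4 = (0::'a::comm_ring_1)"
  by (simp_all add: J4_def)

lemma mat_nth: "mat x $ i $ j = (if i = j then x else 0)"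
  by (simp add: mat_def)

lemma transpose_nth [simp]: "transpose A $ i $ j = A $ j $ i"
  by (simp add: transpose_def)

lemma J4_mult_J4: "J4 ** J4 = - mat (1::'a::comm_ring_1)"
  by (simp add: vec_eq_iff_4 matrix_mult_nth_4 J4_nth mat_nth)

lemma matrix_mult_uminus: "(- A) ** B = - (A ** B)" "A ** (- B) = - (A ** B)"
  for A :: "'a::ring_1^'n^'m" and B :: "'a^'k^'n"
  by (simp_all add: vec_eq_iff matrix_matrix_mult_def sum_negf)

lemma matrix_mult_diff_expand:
  "A ** B - A0 ** B0 = (A - A0) ** B + A0 ** (B - B0)"
  for A A0 :: "'a::ring_1^'n^'m" and B B0 :: "'a^'k^'n"
  by (simp add: vec_eq_iff matrix_matrix_mult_def algebra_simps sum_subtractf sum.distrib)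

text \<open>Solves \<open>A ** J4 ** transpose A = J4\<close> for the inverse, using that
  \<open>J4\<close> squares to minus the identity.\<close>

definition Sp4_inverse :: "'r::comm_ring_1^4^4 \<Rightarrow> 'r^4^4" where
  "Sp4_inverse A = - (J4 ** transpose A ** J4)"

lemma Sp4_UNIV_iff: "A \<in> Sp4 UNIV \<longleftrightarrow> A ** J4 ** transpose A = J4"
  by (simp add: Sp4_def)

lemma Sp4_right_inverse: "A \<in> Sp4 UNIV \<Longrightarrow> A ** Sp4_inverse A = mat 1"
proof -
  assume "A \<in> Sp4 UNIV"
  then have "A ** J4 ** transpose A ** J4 = J4 ** J4" by (simp add: Sp4_UNIV_iff)
  then show ?thesis
    by (simp add: Sp4_inverse_def matrix_mult_uminus J4_mult_J4 matrix_mul_assoc)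
qed

lemma Sp4_left_inverse: "A \<in> Sp4 UNIV \<Longrightarrow> Sp4_inverse A ** A = mat 1" for A :: "'a::field^4^4"
  using Sp4_right_inverse matrix_left_right_inverse by blast

lemma Sp4_mult: "A \<in> Sp4 UNIV \<Longrightarrow> B \<in> Sp4 UNIV \<Longrightarrow> A ** B \<in> Sp4 UNIV"
proof -
  assume A: "A \<in> Sp4 UNIV" and B: "B \<in> Sp4 UNIV"
  have "A ** B ** J4 ** transpose (A ** B) = A ** (B ** J4 ** transpose B) ** transpose A"
    unfolding matrix_transpose_mul by (simp only: matrix_mul_assoc)
  then show ?thesis using A B by (simp only: Sp4_UNIV_iff)
qed

lemma Sp4_one: "mat 1 \<in> Sp4 UNIV"
  by (simp add: Sp4_UNIV_iff transpose_mat)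

lemma Sp4_transpose_eq: "A \<in> Sp4 UNIV \<Longrightarrow> transpose A ** J4 ** A = J4" for A :: "'a::field^4^4"
proof -
  assume A: "A \<in> Sp4 UNIV"
  have "J4 ** (- (J4 ** transpose A ** J4) ** A) = J4"
    using Sp4_left_inverse[OF A] by (simp add: Sp4_inverse_def)
  moreover have "J4 ** (- (J4 ** transpose A ** J4) ** A) = - (J4 ** J4) ** (transpose A ** J4 ** A)"
    by (simp add: matrix_mult_uminus matrix_mul_assoc)
  ultimately show ?thesis by (simp add: J4_mult_J4)
qed

lemma Sp4_inverse_in: "A \<in> Sp4 UNIV \<Longrightarrow> Sp4_inverse A \<in> Sp4 UNIV" for A :: "'a::field^4^4"
proof -
  assume A: "A \<in> Sp4 UNIV"
  let ?B = "Sp4_inverse A"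
  have "?B ** J4 ** transpose ?B = ?B ** (A ** J4 ** transpose A) ** transpose ?B"
    using A by (simp only: Sp4_UNIV_iff)
  also have "\<dots> = (?B ** A) ** J4 ** transpose (?B ** A)"
    unfolding matrix_transpose_mul by (simp only: matrix_mul_assoc)
  also have "\<dots> = J4" unfolding Sp4_left_inverse[OF A] transpose_mat by simp
  finally show ?thesis by (simp add: Sp4_UNIV_iff)
qed

lemma group_G_Sp4: "group (G_Sp4 :: ('q::field fls^4^4) monoid)"
proof (rule groupI)
  fix A B C :: "'q fls^4^4"
  show "A \<in> carrier G_Sp4 \<Longrightarrow> B \<in> carrier G_Sp4 \<Longrightarrow> A \<otimes>\<^bsub>G_Sp4\<^esub> B \<in> carrier G_Sp4"
    by (simp add: G_Sp4_def Sp4_mult)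
  show "A \<otimes>\<^bsub>G_Sp4\<^esub> B \<otimes>\<^bsub>G_Sp4\<^esub> C = A \<otimes>\<^bsub>G_Sp4\<^esub> (B \<otimes>\<^bsub>G_Sp4\<^esub> C)"
    by (simp add: G_Sp4_def matrix_mul_assoc)
  show "A \<in> carrier G_Sp4 \<Longrightarrow> \<exists>B\<in>carrier G_Sp4. B \<otimes>\<^bsub>G_Sp4\<^esub> A = \<one>\<^bsub>G_Sp4\<^esub>"
    by (auto simp: G_Sp4_def intro!: bexI[of _ "Sp4_inverse A"] Sp4_left_inverse Sp4_inverse_in)
qed (simp_all add: G_Sp4_def Sp4_one)

lemma carrier_G_Sp4 [simp]: "carrier G_Sp4 = Sp4 UNIV"
  and mult_G_Sp4 [simp]: "A \<otimes>\<^bsub>G_Sp4\<^esub> B = A ** B"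
  and one_G_Sp4 [simp]: "\<one>\<^bsub>G_Sp4\<^esub> = mat 1"
  by (simp_all add: G_Sp4_def)

lemma inv_G_Sp4: "A \<in> Sp4 UNIV \<Longrightarrow> inv\<^bsub>G_Sp4\<^esub> A = Sp4_inverse A"
  using group.inv_equality[OF group_G_Sp4, of "Sp4_inverse A" A]
  by (simp add: Sp4_left_inverse Sp4_inverse_in)

lemma Sp4_subset: "Sp4 R \<subseteq> Sp4 UNIV"
  by (auto simp: Sp4_def)

lemma subgroup_Sp4:
  fixes R :: "'q::field fls set"
  assumes R: "0 \<in> R" "1 \<in> R" "\<And>x y. x \<in> R \<Longrightarrow> y \<in> R \<Longrightarrow> x + y \<in> R"
    "\<And>x. x \<in> R \<Longrightarrow> - x \<in> R" "\<And>x y. x \<in> R \<Longrightarrow> y \<in> R \<Longrightarrow> x * y \<in> R"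
  shows "subgroup (Sp4 R) G_Sp4"
proof -
  have entries: "\<forall>i j. (A ** B) $ i $ j \<in> R"
    if "\<forall>i j. A $ i $ j \<in> R" "\<forall>i j. B $ i $ j \<in> R" for A B :: "'q fls^4^4"
    using that R by (auto simp: matrix_mult_nth_4)
  have J: "\<forall>i j. (J4 :: 'q fls^4^4) $ i $ j \<in> R"
    using R by (simp add: forall_4 J4_nth)
  show ?thesis
  proof
    show "Sp4 R \<subseteq> carrier G_Sp4" using Sp4_subset by simp
    show "A \<otimes>\<^bsub>G_Sp4\<^esub> B \<in> Sp4 R" if "A \<in> Sp4 R" "B \<in> Sp4 R" for A B
      using that entries[of A B] Sp4_mult[of A B] by (auto simp: Sp4_def)
    show "\<one>\<^bsub>G_Sp4\<^esub> \<in> Sp4 R" using R Sp4_one by (auto simp: Sp4_def mat_nth)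
    show "inv\<^bsub>G_Sp4\<^esub> A \<in> Sp4 R" if A: "A \<in> Sp4 R" for A
    proof -
      have A': "A \<in> Sp4 UNIV" "\<forall>i j. transpose A $ i $ j \<in> R" using A by (auto simp: Sp4_def)
      have "\<forall>i j. (J4 ** transpose A ** J4) $ i $ j \<in> R"
        using entries J A'(2) by blast
      then have "\<forall>i j. Sp4_inverse A $ i $ j \<in> R" using R(4) by (simp add: Sp4_inverse_def)
      then show ?thesis using Sp4_inverse_in[OF A'(1)] by (simp add: inv_G_Sp4[OF A'(1)] Sp4_def)
    qed
  qed
qed

lemma subgroup_K_Sp4: "subgroup K_Sp4 G_Sp4"
  unfolding K_Sp4_def power_series_ring_eq
  by (rule subgroup_Sp4) (auto intro: fls_bdd_add fls_bdd_mult_left)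

lemma subgroup_Gamma_Sp4: "subgroup Gamma_Sp4 G_Sp4"
proof -
  have "0 = poly_fls 0" "1 = poly_fls 1" by simp_all
  then show ?thesis
    unfolding Gamma_Sp4_def polys_in_X_inv_eq
    by (intro subgroup_Sp4) (auto simp flip: poly_fls_hom simp del: poly_fls_0 poly_fls_1)
qed

section \<open>Degree bounds, the metric topology and compactness\<close>

definition mat_bdd :: "int \<Rightarrow> 'q::field fls^4^4 \<Rightarrow> bool" where
  "mat_bdd n A \<longleftrightarrow> (\<forall>i j. fls_bdd n (A $ i $ j))"

lemma K_Sp4_eq: "K_Sp4 = {A \<in> Sp4 UNIV. mat_bdd 0 A}"
  by (auto simp: K_Sp4_def power_series_ring_eq Sp4_def mat_bdd_def)

lemma mat_bdd_add: "mat_bdd n A \<Longrightarrow> mat_bdd n B \<Longrightarrow> mat_bdd n (A + B)"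
  by (simp add: mat_bdd_def fls_bdd_add)

lemma mat_bdd_uminus [simp]: "mat_bdd n (- A) \<longleftrightarrow> mat_bdd n A"
  by (simp add: mat_bdd_def)

lemma mat_bdd_diff: "mat_bdd n A \<Longrightarrow> mat_bdd n B \<Longrightarrow> mat_bdd n (A - B)"
  by (simp add: mat_bdd_def fls_bdd_diff)

lemma mat_bdd_mono: "mat_bdd m A \<Longrightarrow> m \<le> n \<Longrightarrow> mat_bdd n A"
  by (auto simp: mat_bdd_def intro: fls_bdd_mono)

lemma mat_bdd_transpose [simp]: "mat_bdd n (transpose A) \<longleftrightarrow> mat_bdd n A"
  by (auto simp: mat_bdd_def)

lemma mat_bdd_mult: "mat_bdd m A \<Longrightarrow> mat_bdd n B \<Longrightarrow> mat_bdd (m + n) (A ** B)"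
  by (simp add: mat_bdd_def matrix_mult_nth_4 fls_bdd_add fls_bdd_mult)

lemma mat_bdd_exists: "\<exists>N. mat_bdd (int N) A"
proof -
  define N where "N = Max (range (\<lambda>(i, j). nat (- fls_subdegree (A $ i $ j))))"
  have "nat (- fls_subdegree (A $ i $ j)) \<le> N" for i j
    unfolding N_def by (intro Max_ge) (auto intro: rev_image_eqI[of "(i, j)"])
  then have "- int N \<le> fls_subdegree (A $ i $ j)" for i j
    using nat_le_iff[of "- fls_subdegree (A $ i $ j)" N] by (simp add: minus_le_iff)
  then have "mat_bdd (int N) A"
    unfolding mat_bdd_def fls_bdd_iff_subdegree by blast
  then show ?thesis by blast
qed

lemma dist_fls_less_iff: "dist x y < inverse (2 ^ n) \<longleftrightarrow> fls_bdd (- int n - 1) (x - y)"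
  for x y :: "'q::field fls"
proof (cases "x = y \<or> fls_subdegree (x - y) < 0")
  case True
  have "inverse (2 ^ n) \<le> (1::real)" by (simp add: inverse_le_1_iff)
  also have "(1::real) \<le> 2 ^ nat (- fls_subdegree (x - y))" by simp
  finally show ?thesis using True
    by (auto simp: dist_fls_def fls_bdd_iff_subdegree not_less)
next
  case False
  then show ?thesis
    by (auto simp: dist_fls_def fls_bdd_iff_subdegree)
qed

lemma mat_bdd_if_dist_less:
  assumes "dist A B < inverse (2 ^ n)"
  shows "mat_bdd (- int n - 1) (A - B)"
proof -
  have "dist (A $ i $ j) (B $ i $ j) \<le> dist A B" for i j
    using dist_vec_nth_le[of "A $ i" j "B $ i"] dist_vec_nth_le[of A i B] by simp
  then show ?thesis
    using assms by (auto simp: mat_bdd_def simp flip: dist_fls_less_iff intro: le_less_trans)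
qed

text \<open>The factor 16 counts the entries: each of the two nested Euclidean distances is bounded
  by the sum of its four coordinates.\<close>

lemma dist_le_if_mat_bdd:
  assumes "mat_bdd (- int n - 1) (A - B)"
  shows "dist A B \<le> 16 * inverse (2 ^ n)"
proof -
  have e: "dist (A $ i $ j) (B $ i $ j) \<le> inverse (2 ^ n)" for i j
    using assms by (intro less_imp_le) (simp add: dist_fls_less_iff mat_bdd_def)
  have "dist (A $ i) (B $ i) \<le> 4 * inverse (2 ^ n)" for i
  proof -
    have "dist (A $ i) (B $ i) \<le> (\<Sum>j\<in>UNIV. dist (A $ i $ j) (B $ i $ j))"
      unfolding dist_vec_def by (rule L2_set_le_sum) simp
    also have "\<dots> \<le> (\<Sum>j\<in>(UNIV::4 set). inverse (2 ^ n))" by (intro sum_mono e)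
    finally show ?thesis by simp
  qed
  note r = this
  have "dist A B \<le> (\<Sum>i\<in>UNIV. dist (A $ i) (B $ i))"
    unfolding dist_vec_def[of A B] by (rule L2_set_le_sum) simp
  also have "\<dots> \<le> (\<Sum>i\<in>(UNIV::4 set). 4 * inverse (2 ^ n))" by (intro sum_mono r)
  finally show ?thesis by simp
qed

lemma mat_small_exists:
  assumes "\<epsilon> > 0"
  obtains n where "\<And>A B :: 'q::field fls^4^4. mat_bdd (- int n) (A - B) \<Longrightarrow> dist A B < \<epsilon>"
proof -
  obtain n where n: "inverse (2 ^ n) < \<epsilon> / 16"
    using real_arch_pow_inv[of "\<epsilon> / 16" "1/2"] assms by (auto simp: power_one_over inverse_eq_divide)
  have "dist A B < \<epsilon>" if "mat_bdd (- int (Suc n)) (A - B)" for A B :: "'q fls^4^4"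
  proof -
    have "mat_bdd (- int n - 1) (A - B)" using that by (rule mat_bdd_mono) simp
    then show ?thesis using dist_le_if_mat_bdd n by fastforce
  qed
  then show ?thesis by (rule that)
qed

lemma continuous_on_matrix_mult:
  "continuous_on (S \<times> T) (\<lambda>(A :: 'q::field fls^4^4, B :: 'q fls^4^4). A ** B)"
  unfolding continuous_on_iff
proof (intro ballI allI impI)
  fix p :: "('q fls^4^4) \<times> ('q fls^4^4)" and \<epsilon> :: real assume "0 < \<epsilon>"
  then obtain n where n: "\<And>A B :: 'q fls^4^4. mat_bdd (- int n) (A - B) \<Longrightarrow> dist A B < \<epsilon>"
    using mat_small_exists by blast
  obtain A0 B0 where p: "p = (A0, B0)" by force
  obtain a b where ab: "mat_bdd (int a) A0" "mat_bdd (int b) B0" using mat_bdd_exists by meson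
  \<comment> \<open>In either summand of the product difference the unperturbed factor contributes
    degree at most \<open>a\<close> or \<open>b\<close>; \<open>m\<close> outweighs both and leaves
    \<open>n\<close>.\<close>
  define m where "m = a + b + n"
  show "\<exists>d>0. \<forall>p'\<in>S \<times> T. dist p' p < d \<longrightarrow>
    dist (case p' of (A, B) \<Rightarrow> A ** B) (case p of (A, B) \<Rightarrow> A ** B) < \<epsilon>"
  proof (intro exI[of _ "inverse (2 ^ m)"] conjI ballI impI)
    fix p' assume d: "dist p' p < inverse (2 ^ m)"
    obtain A B where p': "p' = (A, B)" by force
    have A: "mat_bdd (- int m - 1) (A - A0)"
      using d dist_fst_le[of p' p] by (intro mat_bdd_if_dist_less) (simp add: p p')
    have B: "mat_bdd (- int m - 1) (B - B0)"
      using d dist_snd_le[of p' p] by (intro mat_bdd_if_dist_less) (simp add: p p')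
    have "mat_bdd (int b) (B0 + (B - B0))"
      by (rule mat_bdd_add[OF ab(2)]) (rule mat_bdd_mono[OF B], simp)
    then have "mat_bdd (int b) B" by simp
    then have "mat_bdd (- int n) ((A - A0) ** B)"
      by (rule mat_bdd_mono[OF mat_bdd_mult[OF A]]) (simp add: m_def)
    moreover have "mat_bdd (- int n) (A0 ** (B - B0))"
      by (rule mat_bdd_mono[OF mat_bdd_mult[OF ab(1) B]]) (simp add: m_def)
    ultimately have "mat_bdd (- int n) (A ** B - A0 ** B0)"
      unfolding matrix_mult_diff_expand by (rule mat_bdd_add)
    then show "dist (case p' of (A, B) \<Rightarrow> A ** B) (case p of (A, B) \<Rightarrow> A ** B) < \<epsilon>"
      using n by (simp add: p p')
  qed simp
qed

lemma continuous_on_matrix_mult' [continuous_intros]: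
  fixes f g :: "'b::topological_space \<Rightarrow> 'q::field fls^4^4"
  assumes "continuous_on S f" "continuous_on S g"
  shows "continuous_on S (\<lambda>x. f x ** g x)"
  using continuous_on_compose2[OF continuous_on_matrix_mult[of UNIV UNIV] continuous_on_Pair[OF assms]]
  by simp

lemma continuous_on_transpose:
  "continuous_on S (transpose :: 'q::field fls^4^4 \<Rightarrow> _)"
  unfolding continuous_on_iff
proof (intro ballI allI impI)
  fix B :: "'q fls^4^4" and \<epsilon> :: real assume "0 < \<epsilon>"
  then obtain n where n: "\<And>A B :: 'q fls^4^4. mat_bdd (- int n) (A - B) \<Longrightarrow> dist A B < \<epsilon>"
    using mat_small_exists by blast
  have t: "transpose A - transpose B = transpose (A - B)" for A by (simp add: vec_eq_iff)
  show "\<exists>d>0. \<forall>A\<in>S. dist A B < d \<longrightarrow> dist (transpose A) (transpose B) < \<epsilon>"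
  proof (intro exI[of _ "inverse (2 ^ n)"] conjI ballI impI n)
    fix A assume "dist A B < inverse (2 ^ n)"
    then have "mat_bdd (- int n - 1) (A - B)" by (rule mat_bdd_if_dist_less)
    then show "mat_bdd (- int n) (transpose A - transpose B)"
      unfolding t by (auto intro: mat_bdd_mono)
  qed simp
qed

lemma continuous_on_Sp4_inverse: "continuous_on S (Sp4_inverse :: 'q::field fls^4^4 \<Rightarrow> _)"
proof -
  have eq: "Sp4_inverse A = (- J4) ** transpose A ** J4" for A :: "'q fls^4^4"
    by (simp add: Sp4_inverse_def matrix_mult_uminus)
  show ?thesis
    unfolding eq[abs_def] by (intro continuous_intros continuous_on_transpose)
qed

lemma closed_Sp4: "closed (Sp4 UNIV :: ('q::field fls^4^4) set)"
proof -
  have "Sp4 UNIV = {A :: 'q fls^4^4. A ** J4 ** transpose A = J4}" by (simp add: Sp4_def)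
  then show ?thesis by (auto intro!: closed_Collect_eq continuous_intros continuous_on_transpose)
qed

text \<open>At distance below 1 only coefficients of positive powers of \<open>fls_X\<close> differ,
  so nonnegative degree bounds are locally constant. This gives openness of the bounded sets and
  continuity of \<open>height\<close>.\<close>

lemma mat_bdd_if_dist_less_1:
  assumes "dist A B < 1" "mat_bdd (int n) A"
  shows "mat_bdd (int n) B"
proof -
  have "mat_bdd (- int 0 - 1) (A - B)"
    using assms(1) by (intro mat_bdd_if_dist_less) simp
  then have "mat_bdd (int n) (A - B)" by (rule mat_bdd_mono) simp
  then have "mat_bdd (int n) (A - (A - B))"
    by (rule mat_bdd_diff[OF assms(2)])
  then show ?thesis by simp
qed

lemma open_mat_bdd: "open {A. mat_bdd (int n) A}"
  unfolding open_dist
proof (intro ballI exI[of _ 1] conjI allI impI)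
  fix A B assume "A \<in> {A. mat_bdd (int n) A}" "dist B A < 1"
  then show "B \<in> {A. mat_bdd (int n) A}"
    using mat_bdd_if_dist_less_1[of A B n] by (simp add: dist_commute)
qed simp

text \<open>Tychonoff: the set is a continuous image of a product of finite discrete spaces, one
  factor for each coefficient.\<close>

lemma compact_mat_bdd: "compact {A :: ('q::{field,finite}) fls^4^4. mat_bdd (int N) A}"
proof -
  let ?X = "product_topology (\<lambda>_. discrete_topology (UNIV :: 'q set)) (UNIV :: (4 \<times> 4 \<times> nat) set)"
  define \<Phi> :: "(4 \<times> 4 \<times> nat \<Rightarrow> 'q) \<Rightarrow> 'q fls^4^4" where
    "\<Phi> f = (\<chi> i j. fls_shift (int N) (fps_to_fls (Abs_fps (\<lambda>k. f (i, j, k)))))" for f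
  have nth: "\<Phi> f $ i $ j $$ k = (if k < - int N then 0 else f (i, j, nat (k + int N)))" for f i j k
    by (simp add: \<Phi>_def)
  have "compact_space ?X"
    by (simp add: compact_space_product_topology compact_space_discrete_topology)
  moreover have "continuous_map ?X euclidean \<Phi>"
    unfolding continuous_map_def
  proof (intro conjI allI impI)
    fix U :: "('q fls^4^4) set" assume "openin euclidean U"
    then have U: "open U" by simp
    show "openin ?X {f \<in> topspace ?X. \<Phi> f \<in> U}"
    proof (subst openin_subopen, intro ballI)
      fix f assume "f \<in> {f \<in> topspace ?X. \<Phi> f \<in> U}"
      then obtain \<epsilon> where \<epsilon>: "\<epsilon> > 0" "\<And>B. dist B (\<Phi> f) < \<epsilon> \<Longrightarrow> B \<in> U"
        using U unfolding open_dist by auto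
      obtain n where n: "\<And>A B :: 'q fls^4^4. mat_bdd (- int n) (A - B) \<Longrightarrow> dist A B < \<epsilon>"
        using mat_small_exists \<epsilon>(1) by blast
      \<comment> \<open>Coordinate \<open>k\<close> is the coefficient of the power
        \<open>k - N\<close>; fixing the coordinates below \<open>n + N\<close> therefore fixes all
        coefficients below \<open>n\<close>.\<close>
      define V where "V = Pi\<^sub>E UNIV (\<lambda>(i, j, k). if k < n + N then {f (i, j, k)} else UNIV :: 'q set)"
      have "openin ?X V"
        unfolding V_def
      proof (subst openin_PiE_gen, intro disjI2 conjI ballI)
        have "{p \<in> UNIV. (case p of (i, j, k) \<Rightarrow> if k < n + N then {f (i, j, k)} else UNIV) \<noteq> topspace (discrete_topology UNIV)}
            \<subseteq> UNIV \<times> UNIV \<times> {..< n + N}"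
          by (auto split: if_splits)
        then show "finite {p \<in> UNIV. (case p of (i, j, k) \<Rightarrow> if k < n + N then {f (i, j, k)} else UNIV) \<noteq> topspace (discrete_topology UNIV)}"
          by (rule finite_subset) simp
      qed auto
      moreover have "f \<in> V" by (auto simp: V_def)
      moreover have "V \<subseteq> {f \<in> topspace ?X. \<Phi> f \<in> U}"
      proof
        fix g assume g: "g \<in> V"
        have *: "g (i, j, k) = f (i, j, k)" if "k < n + N" for i j k
          using g that unfolding V_def by (auto dest!: PiE_mem[of _ _ _ "(i, j, k)"])
        have "mat_bdd (- int n) (\<Phi> g - \<Phi> f)"
          unfolding mat_bdd_def fls_bdd_def by (auto simp: nth intro!: *)
        then show "g \<in> {f \<in> topspace ?X. \<Phi> f \<in> U}" using n \<epsilon>(2) by simp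
      qed
      ultimately show "\<exists>T. openin ?X T \<and> f \<in> T \<and> T \<subseteq> {f \<in> topspace ?X. \<Phi> f \<in> U}" by blast
    qed
  qed auto
  ultimately have "compactin euclidean (\<Phi> ` topspace ?X)"
    using image_compactin compact_space_def by blast
  moreover have "\<Phi> ` topspace ?X = {A. mat_bdd (int N) A}"
  proof
    show "\<Phi> ` topspace ?X \<subseteq> {A. mat_bdd (int N) A}"
      by (auto simp: mat_bdd_def fls_bdd_def nth)
    show "{A. mat_bdd (int N) A} \<subseteq> \<Phi> ` topspace ?X"
    proof
      fix A :: "'q fls^4^4" assume "A \<in> {A. mat_bdd (int N) A}"
      then have "A = \<Phi> (\<lambda>(i, j, k). A $ i $ j $$ (int k - int N))"
        unfolding vec_eq_iff mat_bdd_def fls_bdd_def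
        by (auto intro!: fls_eqI simp: nth)
      then show "A \<in> \<Phi> ` topspace ?X" by auto
    qed
  qed
  ultimately show ?thesis by simp
qed

section \<open>Cartan decomposition\<close>

text \<open>Equal or reversed indices give minors that vanish or change sign, so no ordering of rows
  and columns has to be carried along.\<close>

definition minors_bdd :: "int \<Rightarrow> 'q::field fls^4^4 \<Rightarrow> bool" where
  "minors_bdd n A \<longleftrightarrow>
    (\<forall>i k j l. fls_bdd n (A $ i $ j * A $ k $ l - A $ i $ l * A $ k $ j))"

lemma minors_bdd_transpose: "minors_bdd n A \<Longrightarrow> minors_bdd n (transpose A)"
  unfolding minors_bdd_def transpose_nth by (metis mult.commute)

text \<open>A form of Cauchy-Binet, summed over all ordered pairs of inner indices: minors of the
  product are integral combinations of minors of \<open>B\<close>.\<close>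

lemma minors_bdd_mult_left:
  assumes A: "mat_bdd 0 A" and B: "minors_bdd n B"
  shows "minors_bdd n (A ** B)"
  unfolding minors_bdd_def
proof (intro allI)
  fix i k j l
  have "(A ** B) $ i $ j * (A ** B) $ k $ l - (A ** B) $ i $ l * (A ** B) $ k $ j =
    (\<Sum>p\<in>UNIV. \<Sum>q\<in>UNIV. (A $ i $ p * A $ k $ q) * (B $ p $ j * B $ q $ l - B $ p $ l * B $ q $ j))"
    unfolding matrix_matrix_mult_def
    by (simp add: sum_product sum_subtractf[symmetric] algebra_simps)
  also have "fls_bdd n \<dots>"
    using A B unfolding mat_bdd_def minors_bdd_def
    by (intro fls_bdd_sum fls_bdd_mult_left) auto
  finally show "fls_bdd n ((A ** B) $ i $ j * (A ** B) $ k $ l - (A ** B) $ i $ l * (A ** B) $ k $ j)" .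
qed

lemma minors_bdd_mult_right:
  assumes "mat_bdd 0 B" "minors_bdd n A"
  shows "minors_bdd n (A ** B)"
proof -
  have "minors_bdd n (transpose B ** transpose A)"
    using assms by (intro minors_bdd_mult_left minors_bdd_transpose) auto
  from minors_bdd_transpose[OF this] show ?thesis by (simp add: matrix_transpose_mul)
qed

lemma K_Sp4_mult: "A \<in> K_Sp4 \<Longrightarrow> B \<in> K_Sp4 \<Longrightarrow> A ** B \<in> K_Sp4"
  using subgroup.m_closed[OF subgroup_K_Sp4] by fastforce

lemma K_Sp4_one: "mat 1 \<in> K_Sp4"
  using subgroup.one_closed[OF subgroup_K_Sp4] by simp

lemma K_Sp4_in_Sp4: "A \<in> K_Sp4 \<Longrightarrow> A \<in> Sp4 UNIV"
  by (simp add: K_Sp4_eq)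

lemma K_Sp4_inverse: "A \<in> K_Sp4 \<Longrightarrow> Sp4_inverse A \<in> K_Sp4"
  using subgroup.m_inv_closed[OF subgroup_K_Sp4] by (metis K_Sp4_in_Sp4 inv_G_Sp4)

lemma Sp4_transpose: "A \<in> Sp4 UNIV \<Longrightarrow> transpose A \<in> Sp4 UNIV" for A :: "'a::field^4^4"
  using Sp4_transpose_eq[of A] by (simp add: Sp4_UNIV_iff transpose_transpose)

lemma K_Sp4_transpose: "A \<in> K_Sp4 \<Longrightarrow> transpose A \<in> K_Sp4"
  by (simp add: K_Sp4_eq Sp4_transpose)

definition K_equiv :: "'q::field fls^4^4 \<Rightarrow> 'q fls^4^4 \<Rightarrow> bool" where
  "K_equiv A B \<longleftrightarrow> (\<exists>k\<in>K_Sp4. \<exists>k'\<in>K_Sp4. A = k ** B ** k')"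

lemma K_equiv_trans: "K_equiv A B \<Longrightarrow> K_equiv B C \<Longrightarrow> K_equiv A C"
  unfolding K_equiv_def
proof (elim bexE)
  fix k k' l l' assume "k \<in> K_Sp4" "k' \<in> K_Sp4" "l \<in> K_Sp4" "l' \<in> K_Sp4" "A = k ** B ** k'" "B = l ** C ** l'"
  then show "\<exists>k\<in>K_Sp4. \<exists>k'\<in>K_Sp4. A = k ** C ** k'"
    by (intro bexI[of _ "k ** l"] bexI[of _ "l' ** k'"]) (auto simp: K_Sp4_mult matrix_mul_assoc)
qed

lemma K_equiv_sym: "K_equiv A B \<Longrightarrow> K_equiv B A"
  unfolding K_equiv_def
proof (elim bexE)
  fix k k' assume k: "k \<in> K_Sp4" "k' \<in> K_Sp4" and A: "A = k ** B ** k'"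
  have "Sp4_inverse k ** A ** Sp4_inverse k' = (Sp4_inverse k ** k) ** B ** (k' ** Sp4_inverse k')"
    unfolding A by (simp only: matrix_mul_assoc)
  also have "\<dots> = B"
    using k by (simp add: Sp4_left_inverse Sp4_right_inverse K_Sp4_in_Sp4)
  finally show "\<exists>k\<in>K_Sp4. \<exists>k'\<in>K_Sp4. B = k ** A ** k'"
    using k by (metis K_Sp4_inverse)
qed

lemma K_equiv_mult_left: "k \<in> K_Sp4 \<Longrightarrow> K_equiv (k ** A) A"
  unfolding K_equiv_def by (intro bexI[of _ k] bexI[of _ "mat 1"]) (auto intro: K_Sp4_one)

lemma K_equiv_mult_right: "k \<in> K_Sp4 \<Longrightarrow> K_equiv (A ** k) A"
  unfolding K_equiv_def by (intro bexI[of _ k] bexI[of _ "mat 1"]) (auto intro: K_Sp4_one)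

lemma K_equiv_in_Sp4: "K_equiv A B \<Longrightarrow> B \<in> Sp4 UNIV \<Longrightarrow> A \<in> Sp4 UNIV"
  unfolding K_equiv_def by (auto simp: Sp4_mult K_Sp4_in_Sp4)

lemma K_equiv_mat_bdd: "K_equiv A B \<Longrightarrow> mat_bdd n A \<longleftrightarrow> mat_bdd n B"
proof -
  have *: "mat_bdd n A" if "K_equiv A B" "mat_bdd n B" for A B
    using that mat_bdd_mult[of 0 _ n _] mat_bdd_mult[of n _ 0 _]
    unfolding K_equiv_def K_Sp4_eq by fastforce
  assume "K_equiv A B"
  then show ?thesis using * K_equiv_sym by blast
qed

lemma K_equiv_minors_bdd: "K_equiv A B \<Longrightarrow> minors_bdd n A \<longleftrightarrow> minors_bdd n B"
proof -
  have *: "minors_bdd n A" if "K_equiv A B" "minors_bdd n B" for A B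
    using that minors_bdd_mult_left minors_bdd_mult_right
    unfolding K_equiv_def K_Sp4_eq by blast
  assume "K_equiv A B"
  then show ?thesis using * K_equiv_sym by blast
qed

definition Cartan_diag :: "'q::field fls \<Rightarrow> 'q fls \<Rightarrow> 'q fls^4^4" where
  "Cartan_diag x y =
    vector [vector [x, 0, 0, 0], vector [0, y, 0, 0], vector [0, 0, inverse y, 0], vector [0, 0, 0, inverse x]]"

definition block_mat :: "'q::field fls \<Rightarrow> 'q fls \<Rightarrow> 'q fls \<Rightarrow> 'q fls \<Rightarrow> 'q fls \<Rightarrow> 'q fls^4^4" where
  "block_mat x p q r s =
    vector [vector [x, 0, 0, 0], vector [0, p, q, 0], vector [0, r, s, 0], vector [0, 0, 0, inverse x]]"

text \<open>The unipotent radical opposite to the Klingen one. Its three parameters fill the first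
  column below the pivot, as an elimination step requires.\<close>

definition lower_Heisenberg :: "'q::field fls \<Rightarrow> 'q fls \<Rightarrow> 'q fls \<Rightarrow> 'q fls^4^4" where
  "lower_Heisenberg y1 y2 y3 =
    vector [vector [1, 0, 0, 0], vector [y1, 1, 0, 0], vector [y2, 0, 1, 0], vector [y3, y2, - y1, 1]]"

lemmas mat4_simps = vec_eq_iff_4 matrix_mult_nth_4 J4_nth

lemma lower_Heisenberg_in_K:
  assumes "fls_bdd 0 y1" "fls_bdd 0 y2" "fls_bdd 0 y3"
  shows "lower_Heisenberg y1 y2 y3 \<in> K_Sp4"
  using assms
  by (simp add: K_Sp4_eq Sp4_UNIV_iff mat4_simps lower_Heisenberg_def mat_bdd_def forall_4)

lemma block_mat_in_K:
  assumes "fls_bdd 0 p" "fls_bdd 0 q" "fls_bdd 0 r" "fls_bdd 0 s" "p * s - q * r = 1"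
  shows "block_mat 1 p q r s \<in> K_Sp4"
  using assms
  by (simp add: K_Sp4_eq Sp4_UNIV_iff mat4_simps block_mat_def mat_bdd_def forall_4 algebra_simps)

lemma Cartan_diag_in_K:
  assumes "x \<noteq> 0" "fls_subdegree x = 0" "y \<noteq> 0" "fls_subdegree y = 0"
  shows "Cartan_diag x y \<in> K_Sp4"
  using assms
  by (simp add: K_Sp4_eq Sp4_UNIV_iff mat4_simps Cartan_diag_def mat_bdd_def forall_4 fls_bdd_iff_subdegree)

text \<open>Weyl group elements with integral entries; \<open>J4\<close> and \<open>w1\<close>
  suffice because only the first row is prescribed, and there no sign appears.\<close>

lemma row_to_first:
  obtains w :: "'q::field fls^4^4" where "w \<in> K_Sp4" "\<And>(A :: 'q fls^4^4) s. (w ** A) $ 1 $ s = A $ r $ s"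
proof -
  define w1 :: "'q fls^4^4" where
    "w1 = vector [vector [0, 1, 0, 0], vector [1, 0, 0, 0], vector [0, 0, 0, 1], vector [0, 0, 1, 0]]"
  have w1: "w1 \<in> K_Sp4"
    by (simp add: K_Sp4_eq Sp4_UNIV_iff mat4_simps w1_def mat_bdd_def forall_4)
  have J: "(J4 :: 'q fls^4^4) \<in> K_Sp4"
    by (simp add: K_Sp4_eq Sp4_UNIV_iff mat4_simps mat_bdd_def forall_4)
  consider "r = 1" | "r = 2" | "r = 3" | "r = 4" using exhaust_4 by blast
  then show ?thesis
  proof cases
    case 1 then show ?thesis using K_Sp4_one by (intro that[of "mat 1"]) auto
  next
    case 2 then show ?thesis using w1 by (intro that[of w1]) (auto simp: matrix_mult_nth_4 w1_def)
  next
    case 3 then show ?thesis using w1 J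
      by (intro that[of "w1 ** J4"]) (auto simp: matrix_mult_nth_4 w1_def J4_nth intro: K_Sp4_mult)
  next
    case 4 then show ?thesis using J by (intro that[of J4]) (auto simp: matrix_mult_nth_4 J4_nth)
  qed
qed

lemma clear_first_column:
  assumes x: "A $ 1 $ 1 \<noteq> 0" and bdd: "mat_bdd (- fls_subdegree (A $ 1 $ 1)) A"
  obtains k where "k \<in> K_Sp4" "\<And>j. (k ** A) $ 1 $ j = A $ 1 $ j"
    "(k ** A) $ 2 $ 1 = 0" "(k ** A) $ 3 $ 1 = 0" "(k ** A) $ 4 $ 1 = 0"
    "\<And>i. k $ 1 $ i = (if i = 1 then 1 else 0)"
proof -
  define x where "x = A $ 1 $ 1"
  have O: "fls_bdd 0 (A $ i $ 1 / x)" for i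
    using x bdd unfolding x_def mat_bdd_def by (intro fls_bdd_divide) auto
  \<comment> \<open>The quotients taken entrywise also clear the last entry: in row 4 the
    contributions of rows 2 and 3 cancel by the alternating sign in
    \<open>lower_Heisenberg\<close>.\<close>
  define k where "k = lower_Heisenberg (- (A $ 2 $ 1 / x)) (- (A $ 3 $ 1 / x)) (- (A $ 4 $ 1 / x))"
  have x0: "x \<noteq> 0" using x by (simp add: x_def)
  show ?thesis
  proof (rule that[of k])
    show "k \<in> K_Sp4" unfolding k_def using O by (intro lower_Heisenberg_in_K) simp_all
    show "(k ** A) $ 1 $ j = A $ 1 $ j" for j
      by (simp add: k_def lower_Heisenberg_def matrix_mult_nth_4)
    show "k $ 1 $ i = (if i = 1 then 1 else 0)" for i
      using exhaust_4[of i] by (auto simp: k_def lower_Heisenberg_def)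
    show "(k ** A) $ 2 $ 1 = 0" "(k ** A) $ 3 $ 1 = 0" "(k ** A) $ 4 $ 1 = 0"
      using x0 by (simp_all add: k_def lower_Heisenberg_def matrix_mult_nth_4 field_simps flip: x_def)
  qed
qed

text \<open>The symplectic relations, in their row form and in their column form, turn a cleared
  first row and column into a cleared last column and row, leaving an \<open>SL2\<close>
  block.\<close>

lemma Sp4_first_row_column:
  fixes C :: "'q::field fls^4^4"
  assumes C: "C \<in> Sp4 UNIV" and x: "C $ 1 $ 1 \<noteq> 0"
    and row: "C $ 1 $ 2 = 0" "C $ 1 $ 3 = 0" "C $ 1 $ 4 = 0"
    and col: "C $ 2 $ 1 = 0" "C $ 3 $ 1 = 0" "C $ 4 $ 1 = 0"
  shows "C = block_mat (C $ 1 $ 1) (C $ 2 $ 2) (C $ 2 $ 3) (C $ 3 $ 2) (C $ 3 $ 3)"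
    "C $ 2 $ 2 * C $ 3 $ 3 - C $ 2 $ 3 * C $ 3 $ 2 = 1"
proof -
  have R: "(C ** J4 ** transpose C) $ i $ j = J4 $ i $ j" for i j
    using C by (simp add: Sp4_UNIV_iff)
  have L: "(transpose C ** J4 ** C) $ i $ j = J4 $ i $ j" for i j
    using Sp4_transpose_eq[OF C] by simp
  have "C $ 1 $ 1 * C $ 4 $ 4 = 1" "C $ 2 $ 4 = 0" "C $ 3 $ 4 = 0"
    using R[of 1 4] R[of 1 2] R[of 1 3] x row by (simp_all add: matrix_mult_nth_4 J4_nth)
  moreover have "C $ 4 $ 2 = 0" "C $ 4 $ 3 = 0"
    using L[of 1 2] L[of 1 3] x col by (simp_all add: matrix_mult_nth_4 J4_nth)
  moreover show "C $ 2 $ 2 * C $ 3 $ 3 - C $ 2 $ 3 * C $ 3 $ 2 = 1"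
    using R[of 2 3] col by (simp add: matrix_mult_nth_4 J4_nth)
  ultimately show "C = block_mat (C $ 1 $ 1) (C $ 2 $ 2) (C $ 2 $ 3) (C $ 3 $ 2) (C $ 3 $ 3)"
    using row col x by (simp add: vec_eq_iff_4 block_mat_def field_simps)
qed

lemma max_entry:
  assumes "A \<noteq> (0 :: 'q::field fls^4^4)"
  obtains r s where "A $ r $ s \<noteq> 0" "mat_bdd (- fls_subdegree (A $ r $ s)) A"
proof -
  let ?P = "{p. A $ fst p $ snd p \<noteq> 0}"
  have "?P \<noteq> {}" using assms by (auto simp: vec_eq_iff)
  then obtain p where p: "p \<in> ?P" "\<And>q. q \<in> ?P \<Longrightarrow> fls_subdegree (A $ fst p $ snd p) \<le> fls_subdegree (A $ fst q $ snd q)"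
    using arg_min_if_finite[of ?P "\<lambda>p. fls_subdegree (A $ fst p $ snd p)"]
    by (metis (mono_tags, lifting) finite not_le_imp_less)
  have "mat_bdd (- fls_subdegree (A $ fst p $ snd p)) A"
    unfolding mat_bdd_def fls_bdd_iff_subdegree using p(2)[of "(i, j)" for i j] by fastforce
  then show ?thesis using p(1) that by blast
qed

text \<open>The pivot has maximal degree, so all elimination quotients are integral. Rows are
  handled as columns of the transpose, since \<open>K_Sp4\<close> is stable under
  transposition.\<close>

lemma K_equiv_block_mat:
  fixes A :: "'q::field fls^4^4"
  assumes A: "A \<in> Sp4 UNIV"
  obtains x p q r s where "K_equiv A (block_mat x p q r s)" "x \<noteq> 0" "p * s - q * r = 1"
    "mat_bdd (- fls_subdegree x) (block_mat x p q r s)"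
proof -
  have "A \<noteq> 0"
  proof
    assume "A = 0"
    then have "(0 :: 'q fls^4^4) = J4" using A by (simp add: Sp4_UNIV_iff vec_eq_iff_4 matrix_mult_nth_4 J4_nth)
    then show False by (simp add: vec_eq_iff_4 J4_nth)
  qed
  then obtain r s where rs: "A $ r $ s \<noteq> 0" "mat_bdd (- fls_subdegree (A $ r $ s)) A"
    using max_entry by blast
  define n where "n = - fls_subdegree (A $ r $ s)"
  obtain w where w: "w \<in> K_Sp4" "\<And>(A :: 'q fls^4^4) s. (w ** A) $ 1 $ s = A $ r $ s"
    by (rule row_to_first[of r]) blast
  obtain v where v: "v \<in> K_Sp4" "\<And>(A :: 'q fls^4^4) r. (v ** A) $ 1 $ r = A $ s $ r"
    by (rule row_to_first[of s]) blast
  define B where "B = w ** A ** transpose v"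
  have "transpose B = v ** transpose (w ** A)" by (simp add: B_def matrix_transpose_mul)
  then have "B $ i $ 1 = (w ** A) $ i $ s" for i by (metis transpose_nth v(2))
  then have B11: "B $ 1 $ 1 = A $ r $ s" using w(2) by simp
  have AB: "K_equiv B A"
    unfolding B_def
    using K_equiv_trans[OF K_equiv_mult_right[OF K_Sp4_transpose[OF v(1)]] K_equiv_mult_left[OF w(1)]] .
  have Bbdd: "mat_bdd n B" using rs(2) K_equiv_mat_bdd[OF AB] by (simp add: n_def)
  obtain k where k: "k \<in> K_Sp4" "\<And>j. (k ** B) $ 1 $ j = B $ 1 $ j"
    "(k ** B) $ 2 $ 1 = 0" "(k ** B) $ 3 $ 1 = 0" "(k ** B) $ 4 $ 1 = 0"
    using clear_first_column[of B] rs(1) Bbdd B11 n_def by metis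
  define D where "D = k ** B"
  have DB: "K_equiv D B" unfolding D_def by (rule K_equiv_mult_left[OF k(1)])
  have D11: "D $ 1 $ 1 = A $ r $ s" using k(2) B11 by (simp add: D_def)
  have Dbdd: "mat_bdd n D" using Bbdd K_equiv_mat_bdd[OF DB] by simp
  obtain l where l: "l \<in> K_Sp4" "\<And>j. (l ** transpose D) $ 1 $ j = transpose D $ 1 $ j"
    "(l ** transpose D) $ 2 $ 1 = 0" "(l ** transpose D) $ 3 $ 1 = 0" "(l ** transpose D) $ 4 $ 1 = 0"
    using clear_first_column[of "transpose D"] rs(1) Dbdd D11 n_def
    by (metis mat_bdd_transpose transpose_nth)
  define C where "C = D ** transpose l"
  have CT: "C $ i $ j = (l ** transpose D) $ j $ i" for i j
  proof -
    have "transpose C = l ** transpose D" by (simp add: C_def matrix_transpose_mul)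
    then show ?thesis by (metis transpose_nth)
  qed
  have CD: "K_equiv C D" unfolding C_def by (rule K_equiv_mult_right[OF K_Sp4_transpose[OF l(1)]])
  have CA: "K_equiv C A" using CD DB AB K_equiv_trans by blast
  have C11: "C $ 1 $ 1 = A $ r $ s" using CT l(2) D11 by simp
  have C: "C = block_mat (C $ 1 $ 1) (C $ 2 $ 2) (C $ 2 $ 3) (C $ 3 $ 2) (C $ 3 $ 3)"
    "C $ 2 $ 2 * C $ 3 $ 3 - C $ 2 $ 3 * C $ 3 $ 2 = 1"
    using K_equiv_in_Sp4[OF CA A] rs(1) C11 CT l(2-5) k(3-5)
    by (intro Sp4_first_row_column; simp add: D_def)+
  have "mat_bdd n C" using Dbdd K_equiv_mat_bdd[OF CD] by simp
  then show ?thesis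
    using that[of "C $ 1 $ 1" "C $ 2 $ 2" "C $ 2 $ 3" "C $ 3 $ 2" "C $ 3 $ 3"] C C11 rs(1) K_equiv_sym[OF CA]
    by (simp add: n_def)
qed

lemma K_equiv_block_mat_swap:
  "K_equiv (block_mat x p q r s) (block_mat x r s (- p) (- q))"
  "K_equiv (block_mat x p q r s) (block_mat x q (- p) s (- r))"
proof -
  have w: "block_mat 1 0 (- 1) 1 0 \<in> K_Sp4" by (rule block_mat_in_K) simp_all
  have "block_mat x p q r s = block_mat 1 0 (- 1) 1 0 ** block_mat x r s (- p) (- q)"
    by (simp add: block_mat_def mat4_simps)
  then show "K_equiv (block_mat x p q r s) (block_mat x r s (- p) (- q))"
    using K_equiv_mult_left[OF w] by metis
  have w': "block_mat 1 0 1 (- 1) 0 \<in> K_Sp4" by (rule block_mat_in_K) simp_all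
  have "block_mat x p q r s = block_mat x q (- p) s (- r) ** block_mat 1 0 1 (- 1) 0"
    by (simp add: block_mat_def mat4_simps)
  then show "K_equiv (block_mat x p q r s) (block_mat x q (- p) s (- r))"
    using K_equiv_mult_right[OF w'] by metis
qed

lemma K_equiv_block_mat_diag:
  assumes det: "p * s - q * r = 1" and p: "p \<noteq> 0"
    and bdd: "fls_bdd (- fls_subdegree p) q" "fls_bdd (- fls_subdegree p) r"
  shows "K_equiv (block_mat x p q r s) (Cartan_diag x p)"
proof -
  have k: "block_mat 1 1 0 (r / p) 1 \<in> K_Sp4"
    using fls_bdd_divide[OF p bdd(2)] by (intro block_mat_in_K) simp_all
  have k': "block_mat 1 1 (q / p) 0 1 \<in> K_Sp4"
    using fls_bdd_divide[OF p bdd(1)] by (intro block_mat_in_K) simp_all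
  have "s = inverse p + r / p * q" using det p by (simp add: field_simps)
  then have "block_mat x p q r s = block_mat 1 1 0 (r / p) 1 ** Cartan_diag x p ** block_mat 1 1 (q / p) 0 1"
    using p by (simp add: block_mat_def Cartan_diag_def mat4_simps field_simps)
  then show ?thesis unfolding K_equiv_def using k k' by blast
qed

lemma K_equiv_Cartan_diag:
  assumes A: "A \<in> Sp4 UNIV"
  obtains x y where "K_equiv A (Cartan_diag x y)" "x \<noteq> 0" "y \<noteq> 0"
    "fls_subdegree x \<le> fls_subdegree y" "fls_subdegree y \<le> 0"
proof -
  obtain x p q r s where 1: "K_equiv A (block_mat x p q r s)" "x \<noteq> 0" "p * s - q * r = 1"
    "mat_bdd (- fls_subdegree x) (block_mat x p q r s)"
    using K_equiv_block_mat[OF A] .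
  define n where "n = - fls_subdegree x"
  have b: "fls_bdd n p" "fls_bdd n q" "fls_bdd n r" "fls_bdd n s"
    using 1(4) unfolding mat_bdd_def n_def by (simp_all add: forall_4 block_mat_def)
  note diag = that
  have *: thesis if "K_equiv A (block_mat x p q r s)" "p * s - q * r = 1" "p \<noteq> 0" "fls_bdd n p"
    "fls_bdd (- fls_subdegree p) q" "fls_bdd (- fls_subdegree p) r" "fls_bdd (- fls_subdegree p) s" for p q r s
  proof (rule diag)
    show "K_equiv A (Cartan_diag x p)"
      using K_equiv_trans[OF that(1) K_equiv_block_mat_diag[OF that(2,3,5,6)]] .
    show "x \<noteq> 0" "p \<noteq> 0" by fact+
    show "fls_subdegree x \<le> fls_subdegree p" using that(3,4) by (simp add: fls_bdd_iff_subdegree n_def)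
    \<comment> \<open>The determinant is 1, so the maximal degree in the block cannot be
      negative.\<close>
    have "fls_bdd (- fls_subdegree p + - fls_subdegree p) (p * s - q * r)"
      using that(5-7) by (intro fls_bdd_diff fls_bdd_mult) (auto simp: fls_bdd_iff_subdegree)
    then show "fls_subdegree p \<le> 0" using that(2) by simp
  qed
  have max: "\<exists>a\<in>{p, q, r, s}. a \<noteq> 0 \<and> (\<forall>b\<in>{p, q, r, s}. fls_bdd (- fls_subdegree a) b)"
  proof -
    let ?S = "{a \<in> {p, q, r, s}. a \<noteq> 0}"
    have "?S \<noteq> {}"
    proof
      assume "?S = {}"
      then have "p = 0" "q = 0" by blast+
      then show False using 1(3) by simp
    qed
    then obtain a where "a \<in> ?S" "\<And>b. b \<in> ?S \<Longrightarrow> fls_subdegree a \<le> fls_subdegree b"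
      using arg_min_if_finite[of ?S fls_subdegree]
      by (metis (no_types, lifting) finite.emptyI finite_insert finite_subset mem_Collect_eq not_le_imp_less subsetI)
    then show ?thesis by (intro bexI[of _ a]) (auto simp: fls_bdd_iff_subdegree)
  qed
  have R: "K_equiv A (block_mat x r s (- p) (- q))"
    using K_equiv_trans[OF 1(1) K_equiv_block_mat_swap(1)] .
  have Q: "K_equiv A (block_mat x q (- p) s (- r))"
    using K_equiv_trans[OF 1(1) K_equiv_block_mat_swap(2)] .
  have S: "K_equiv A (block_mat x s (- r) (- q) p)"
    using K_equiv_trans[OF R K_equiv_block_mat_swap(2)] by simp
  \<comment> \<open>Whichever entry of the block is maximal, the swaps bring it into pivot position
    up to sign.\<close>
  from max show thesis
    using *[OF 1(1) 1(3)] *[OF R] *[OF Q] *[OF S] b 1(3) by (auto simp: algebra_simps)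
qed

definition Cartan_mat :: "nat \<Rightarrow> nat \<Rightarrow> 'q::field fls^4^4" where
  "Cartan_mat i j = Cartan_diag (fls_X_inv ^ i) (fls_X_inv ^ j)"

theorem Cartan_decomposition:
  assumes A: "A \<in> Sp4 UNIV"
  obtains i j where "j \<le> i" "K_equiv A (Cartan_mat i j)"
proof -
  obtain x y where xy: "K_equiv A (Cartan_diag x y)" "x \<noteq> 0" "y \<noteq> 0"
    "fls_subdegree x \<le> fls_subdegree y" "fls_subdegree y \<le> 0"
    using K_equiv_Cartan_diag[OF A] .
  define i j where "i = nat (- fls_subdegree x)" and "j = nat (- fls_subdegree y)"
  have ij: "fls_subdegree x = - int i" "fls_subdegree y = - int j" using xy by (auto simp: i_def j_def)
  define u v where "u = x / fls_X_inv ^ i" and "v = y / fls_X_inv ^ j"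
  have uv: "u \<noteq> 0" "v \<noteq> 0" "fls_subdegree u = 0" "fls_subdegree v = 0"
    "x = fls_X_inv ^ i * u" "y = fls_X_inv ^ j * v"
  proof -
    have z: "fls_X_inv ^ n \<noteq> (0 :: 'a fls)" for n by simp
    show "u \<noteq> 0" "v \<noteq> 0" using xy z by (simp_all only: u_def v_def divide_eq_0_iff simp_thms)
    show "x = fls_X_inv ^ i * u" "y = fls_X_inv ^ j * v"
      using z by (simp_all only: u_def v_def times_divide_eq_right nonzero_mult_div_cancel_left simp_thms)
    show "fls_subdegree u = 0" "fls_subdegree v = 0"
      using xy ij z unfolding u_def v_def by (subst fls_divide_subdegree; simp)+
  qed
  have "Cartan_diag x y = Cartan_mat i j ** Cartan_diag u v"
    unfolding uv(5,6) by (simp add: Cartan_mat_def Cartan_diag_def mat4_simps)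
  then have "K_equiv (Cartan_diag x y) (Cartan_mat i j)"
    using K_equiv_mult_right[OF Cartan_diag_in_K[OF uv(1,3,2,4)]] by metis
  with xy show ?thesis using that[of j i] K_equiv_trans ij by (metis neg_le_iff_le of_nat_le_iff)
qed

lemma Cartan_diag_in_Sp4: "x \<noteq> 0 \<Longrightarrow> y \<noteq> 0 \<Longrightarrow> Cartan_diag x y \<in> Sp4 UNIV"
  by (simp add: Sp4_UNIV_iff mat4_simps Cartan_diag_def)

lemma Cartan_mat_in_Sp4: "Cartan_mat i j \<in> Sp4 UNIV"
  unfolding Cartan_mat_def by (rule Cartan_diag_in_Sp4) simp_all

lemma mat_bdd_Cartan_mat: "j \<le> i \<Longrightarrow> mat_bdd (int n) (Cartan_mat i j) \<longleftrightarrow> i \<le> n"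
  by (auto simp: mat_bdd_def forall_4 Cartan_mat_def Cartan_diag_def fls_bdd_iff_subdegree)

lemma minors_bdd_Cartan_mat: "j \<le> i \<Longrightarrow> minors_bdd (int n) (Cartan_mat i j) \<longleftrightarrow> i + j \<le> n"
  by (auto simp: minors_bdd_def forall_4 Cartan_mat_def Cartan_diag_def fls_bdd_iff_subdegree)

text \<open>Degree bounds on entries and on minors are constant on double cosets of
  \<open>K_Sp4\<close>. The first read off \<open>i\<close>, the second \<open>i + j\<close>, so
  together they single out one representative.\<close>

lemma Cartan_mat_identify:
  assumes A: "A \<in> Sp4 UNIV" and ij: "j \<le> i"
    and entries: "\<And>n. mat_bdd (int n) A \<longleftrightarrow> i \<le> n"
    and minors: "\<And>n. minors_bdd (int n) A \<longleftrightarrow> i + j \<le> n"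
  shows "K_equiv A (Cartan_mat i j)"
proof -
  obtain i' j' where ij': "j' \<le> i'" "K_equiv A (Cartan_mat i' j')"
    using Cartan_decomposition[OF A] .
  have "i \<le> n \<longleftrightarrow> i' \<le> n" for n
    using entries[of n] K_equiv_mat_bdd[OF ij'(2), of "int n"] mat_bdd_Cartan_mat[OF ij'(1), of n] by blast
  then have "i' = i" by (meson order_antisym order_refl)
  moreover have "i + j \<le> n \<longleftrightarrow> i' + j' \<le> n" for n
    using minors[of n] K_equiv_minors_bdd[OF ij'(2), of "int n"] minors_bdd_Cartan_mat[OF ij'(1), of n] by blast
  then have "i' + j' = i + j" by (meson order_antisym order_refl)
  ultimately show ?thesis using ij'(2) by simp
qed

section \<open>Unipotent elements and their Cartan projections\<close>

text \<open>The last column is forced by the symplectic relations. The Siegel radical is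
  \<open>a = 0\<close>; the Klingen radical is \<open>d = 0\<close>, a Heisenberg group with centre
  \<open>c\<close>.\<close>

definition unip :: "'q::field poly \<Rightarrow> 'q poly \<Rightarrow> 'q poly \<Rightarrow> 'q poly \<Rightarrow> 'q fls^4^4" where
  "unip a b c d = vector
    [vector [1, poly_fls a, poly_fls b, poly_fls c],
     vector [0, 1, poly_fls d, poly_fls (b - a * d)],
     vector [0, 0, 1, poly_fls (- a)],
     vector [0, 0, 0, 1]]"

lemma unip_mult:
  "unip a b c d ** unip a' b' c' d' =
    unip (a + a') (b + b' + a * d') (c + c' + a * (b' - a' * d') - b * a') (d + d')"
  by (simp add: unip_def vec_eq_iff_4 matrix_mult_nth_4 poly_fls_hom algebra_simps)

lemma unip_0: "unip 0 0 0 0 = mat 1"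
  by (simp add: unip_def vec_eq_iff_4 mat_nth)

lemma unip_eq_iff [simp]: "unip a b c d = unip a' b' c' d' \<longleftrightarrow> a = a' \<and> b = b' \<and> c = c' \<and> d = d'"
  by (auto simp: unip_def vec_eq_iff_4)

lemma unip_in_Sp4: "unip a b c d \<in> Sp4 UNIV"
  by (simp add: Sp4_UNIV_iff mat4_simps unip_def poly_fls_hom algebra_simps)

lemma unip_in_H: "unip a b c d \<in> H_Sp4"
proof -
  have "(1 :: 'a fls) \<in> range poly_fls" "(0 :: 'a fls) \<in> range poly_fls"
    by (rule range_eqI[of _ _ 1], simp, rule range_eqI[of _ _ 0], simp)
  then have "unip a b c d \<in> Gamma_Sp4"
    using unip_in_Sp4[of a b c d]
    unfolding Gamma_Sp4_def polys_in_X_inv_eq Sp4_def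
    by (simp add: forall_4 unip_def)
  moreover have "unip a b c d \<in> upper_unipotent"
    unfolding upper_unipotent_def unip_def by blast
  ultimately show ?thesis by (simp add: H_Sp4_def)
qed

lemma mat_bdd_unip: "mat_bdd (int n) (unip a b c d) \<longleftrightarrow>
    degree a \<le> n \<and> degree b \<le> n \<and> degree c \<le> n \<and> degree d \<le> n \<and> degree (b - a * d) \<le> n"
  by (auto simp: mat_bdd_def forall_4 unip_def)

lemma degree_diff_commute: "degree (p - q) = degree (q - p)" for p q :: "'q::field poly"
  by (metis degree_minus minus_diff_eq)

lemma minors_bdd_unip: "minors_bdd (int n) (unip a b c d) \<longleftrightarrow>
    degree a \<le> n \<and> degree b \<le> n \<and> degree d \<le> n \<and> degree (b - a * d) \<le> n \<and> degree (a * a) \<le> n \<and>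
    degree (a * (b - a * d) - c) \<le> n \<and> degree (b * (b - a * d) - c * d) \<le> n \<and> degree (a * b + c) \<le> n"
proof -
  define e where "e = b - a * d"
  \<comment> \<open>Many minors agree up to sign; these identities collapse them to the short list
    in the statement.\<close>
  have minors: "degree (a * d - b) = degree e" "degree (c - a * e) = degree (a * e - c)"
    "degree (c * d - b * e) = degree (b * e - c * d)" "degree (- (a * b) - c) = degree (a * b + c)"
    "c + a * b = a * b + c" "degree (- (a * d) - e) = degree b" "degree (e + a * d) = degree b"
    unfolding e_def using degree_minus[of "a * b + c"] by (simp_all add: degree_diff_commute)
  have commute: "d * a = a * d" "e * a = a * e" "b * a = a * b" "e * b = b * e" "d * c = c * d"
    by simp_all
  show ?thesis
    unfolding minors_bdd_def forall_4 unip_def e_def[symmetric]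
    by (simp add: fls_bdd_poly_fls flip: poly_fls_hom poly_fls_1 poly_fls_0)
      (auto simp only: commute minors e_def[symmetric] degree_minus)
qed

text \<open>Maxima of degrees are expressed by equivalences over all \<open>n\<close>, which lets
  the simplifier discharge concrete cases without computing a maximum.\<close>

lemma K_equiv_unip:
  assumes "j \<le> i"
    and "\<And>n. degree a \<le> n \<and> degree b \<le> n \<and> degree c \<le> n \<and> degree d \<le> n \<and> degree (b - a * d) \<le> n \<longleftrightarrow> i \<le> n"
    and "\<And>n. degree a \<le> n \<and> degree b \<le> n \<and> degree d \<le> n \<and> degree (b - a * d) \<le> n \<and> degree (a * a) \<le> n \<and>
    degree (a * (b - a * d) - c) \<le> n \<and> degree (b * (b - a * d) - c * d) \<le> n \<and> degree (a * b + c) \<le> n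
      \<longleftrightarrow> i + j \<le> n"
  shows "K_equiv (unip a b c d) (Cartan_mat i j)"
  using assms by (intro Cartan_mat_identify unip_in_Sp4) (simp_all only: mat_bdd_unip minors_bdd_unip)

lemma K_equiv_unip_Siegel:
  assumes "j \<le> i" "degree b \<le> i" "degree d \<le> i" "degree c = i" "degree (b * b - c * d) = i + j"
  shows "K_equiv (unip 0 b c d) (Cartan_mat i j)"
  using assms by (intro K_equiv_unip) auto

text \<open>The sum of the two Cartan exponents is governed by \<open>a * a\<close> if
  \<open>p = 0\<close>, of degree \<open>2 * m\<close>, and by \<open>a * (b - a * d) - c\<close> if
  \<open>p = 1\<close>, of degree \<open>2 * m + 1\<close>. The lower bound on \<open>k\<close>
  makes the central coordinate the largest entry.\<close>

lemma K_equiv_unip_Klingen: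
  assumes a: "degree a = m" and b: "degree b \<le> m" and c: "degree c = k" and p: "p \<le> 1"
    and k: "m + p \<le> k" "k \<le> 2 * m"
  shows "K_equiv (unip a b c (if p = 0 then 0 else monom 1 1)) (Cartan_mat k (2 * m + p - k))"
proof (cases "p = 0")
  case True
  have le: "degree (b * b) \<le> 2 * m" "degree (a * b) \<le> 2 * m"
    using a b degree_mult_le[of b b] degree_mult_le[of a b] by simp_all
  have aa: "degree (a * a) = 2 * m"
    using a by (cases "a = 0") (auto simp: degree_mult_eq)
  have "degree (a * b - c) \<le> 2 * m" "degree (a * b + c) \<le> 2 * m"
    using le c k by (auto intro!: degree_diff_le degree_add_le)
  then show ?thesis
    using True a b c k le aa by (intro K_equiv_unip) auto
next
  case False
  then have p1: "p = 1" using p by simp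
  define d :: "'a poly" where "d = monom 1 1"
  have m: "m \<ge> 1" using k p1 by simp
  then have a0: "a \<noteq> 0" using a by auto
  have d: "d \<noteq> 0" "degree d = 1" by (simp_all add: d_def degree_monom_eq)
  have ad: "degree (a * d) = m + 1" using a0 d a by (simp add: degree_mult_eq)
  have e: "degree (b - a * d) = m + 1"
    using ad b degree_add_eq_right[of b "- (a * d)"] by simp
  then have e0: "b - a * d \<noteq> 0" by auto
  have aa: "degree (a * a) = 2 * m" "degree (a * (b - a * d)) = 2 * m + 1"
    using a0 e0 a e by (simp_all add: degree_mult_eq)
  have ae: "degree (a * (b - a * d) - c) = 2 * m + 1"
    using aa c k degree_add_eq_left[of "- c" "a * (b - a * d)"] by simp
  have ab: "degree (a * b + c) \<le> 2 * m + 1"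
    using degree_mult_le[of a b] a b c k by (intro degree_add_le) auto
  have be: "degree (b * (b - a * d) - c * d) \<le> 2 * m + 1"
    using degree_mult_le[of b "b - a * d"] degree_mult_le[of c d] b e c d k by (intro degree_diff_le) auto
  have "K_equiv (unip a b c d) (Cartan_mat k (2 * m + p - k))"
    using k a b c d e aa ae ab be p1 by (intro K_equiv_unip) auto
  then show ?thesis using False by (simp add: d_def)
qed

text \<open>The bounds are \<open>M\<close> times the heights 1, 2, 3, 1 of the corresponding
  positive roots. This makes the box closed under multiplication, and hence a finite invariant set
  for the trivial representation.\<close>

definition unip_box :: "nat \<Rightarrow> ('q::field fls^4^4) set" where
  "unip_box M = (\<lambda>(a, b, c, d). unip a b c d) `
    {(a, b, c, d). degree a \<le> M \<and> degree b \<le> 2 * M \<and> degree c \<le> 3 * M \<and> degree d \<le> M}"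

lemma finite_unip_box: "finite (unip_box M :: ('q::{field,finite} fls^4^4) set)"
proof -
  have "finite {p :: 'q poly. degree p \<le> n}" for n
  proof -
    have "{p :: 'q poly. degree p \<le> n} = polys_below (Suc n)" by (auto simp: polys_below_Suc_iff)
    then show ?thesis by simp
  qed
  then have "finite ({a :: 'q poly. degree a \<le> M} \<times> {b :: 'q poly. degree b \<le> 2 * M} \<times>
      {c :: 'q poly. degree c \<le> 3 * M} \<times> {d :: 'q poly. degree d \<le> M})"
    by (intro finite_cartesian_product)
  then show ?thesis
    unfolding unip_box_def by (rule finite_imageI[OF finite_subset[rotated]]) auto
qed

lemma unip_in_box:
  assumes "degree a \<le> M" "degree b \<le> 2 * M" "degree c \<le> 3 * M" "degree d \<le> M"
  shows "unip a b c d \<in> unip_box M"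
  unfolding unip_box_def by (rule image_eqI[of _ _ "(a, b, c, d)"]) (use assms in auto)

lemma unip_box_mult:
  assumes "x \<in> unip_box M" "y \<in> unip_box M"
  shows "x ** y \<in> unip_box M"
proof -
  obtain a b c d where x: "x = unip a b c d" "degree a \<le> M" "degree b \<le> 2 * M" "degree c \<le> 3 * M" "degree d \<le> M"
    using assms(1) by (auto simp: unip_box_def)
  obtain a' b' c' d' where y: "y = unip a' b' c' d'" "degree a' \<le> M" "degree b' \<le> 2 * M" "degree c' \<le> 3 * M" "degree d' \<le> M"
    using assms(2) by (auto simp: unip_box_def)
  have mult: "degree (p * q) \<le> n" if "degree p \<le> m" "degree q \<le> l" "m + l \<le> n" for p q :: "'a poly" and m n l
    using degree_mult_le[of p q] that by linarith
  show ?thesis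
    unfolding x(1) y(1) unip_mult
    using x(2-5) y(2-5)
    by (intro unip_in_box degree_add_le degree_diff_le mult[of _ M _ M] mult[of _ M _ "2 * M"] mult[of _ "2 * M" _ M]) auto
qed

lemma unip_box_subset: "unip_box M \<subseteq> H_Sp4"
  by (auto simp: unip_box_def unip_in_H)

lemma unip_box_nonempty: "unip_box M \<noteq> {}"
  using unip_in_box[of 0 M 0 0 0] by auto

text \<open>An injective self-map of a finite set is onto, so stability under \<open>y\<close>
  implies stability under its inverse.\<close>

lemma (in group) inv_mult_mem_if_finite:
  assumes E: "finite E" "E \<subseteq> carrier G" and y: "y \<in> carrier G" "\<And>x. x \<in> E \<Longrightarrow> y \<otimes> x \<in> E" and x: "x \<in> E"
  shows "inv y \<otimes> x \<in> E"
proof -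
  have "inj_on (\<lambda>x. y \<otimes> x) E" using E(2) y(1) by (auto simp: inj_on_def subset_iff)
  then have "(\<lambda>x. y \<otimes> x) ` E = E" using E(1) y(2) by (intro endo_inj_surj) auto
  then obtain z where "z \<in> E" "x = y \<otimes> z" using x by blast
  then show ?thesis using E(2) y(1) by (simp add: m_assoc[symmetric] subset_iff)
qed

lemma card_difference_pairs:
  fixes A B :: "'a::ab_group_add set"
  assumes A: "finite A" "\<And>x y. x \<in> A \<Longrightarrow> y \<in> A \<Longrightarrow> x + y \<in> A" and B: "B \<subseteq> A"
  shows "card {(x, y). x \<in> A \<and> y \<in> A \<and> y - x \<in> B} = card A * card B"
proof -
  have "bij_betw (\<lambda>(x, b). (x, x + b)) (A \<times> B) {(x, y). x \<in> A \<and> y \<in> A \<and> y - x \<in> B}"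
    by (rule bij_betwI[where g = "\<lambda>(x, y). (x, y - x)"]) (use A B in auto)
  then show ?thesis by (simp add: bij_betw_same_card[symmetric] card_cartesian_product)
qed

section \<open>Comparing neighbouring values of a biinvariant function\<close>

text \<open>Converts a count of \<open>q ^ x\<close> bad pairs in a family of \<open>q ^ y\<close>
  elements into the gain of the move.\<close>

lemma sqrt_power_divide:
  fixes q :: real
  assumes "0 < q" "2 * y = x + d"
  shows "sqrt (q ^ x) / q ^ y = (1 / sqrt q) ^ d"
proof -
  define r where "r = sqrt q"
  have r: "r > 0" "q = r ^ 2" using assms(1) by (simp_all add: r_def)
  have "q ^ y = r ^ x * r ^ d"
    unfolding r(2) power_mult[symmetric] assms(2) power_add ..
  moreover have "sqrt (q ^ x) = r ^ x" by (simp add: r_def real_sqrt_power)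
  ultimately show ?thesis using r(1) by (simp add: power_divide flip: r_def)
qed

text \<open>\<open>N\<close> bounds the heights of the test elements, \<open>n\<close> is the radius
  of a length ball containing all elements up to that height, and \<open>C\<close> bounds the
  multiplier at this one radius.\<close>

locale schur_bound =
  fixes L :: "('q::{field,finite} fls^4^4) set" and len :: "'q fls^4^4 \<Rightarrow> real"
    and n :: nat and c :: "'q fls^4^4 \<Rightarrow> complex" and C :: real and N :: nat
  assumes discrete: "discrete_group (G_Sp4\<lparr>carrier := L\<rparr>)"
    and H_subset: "H_Sp4 \<subseteq> L"
    and biinvariant: "biinvariant G_Sp4 K_Sp4 c"
    and in_ball: "\<And>i j g. j \<le> i \<Longrightarrow> i \<le> N \<Longrightarrow> K_equiv g (Cartan_mat i j) \<Longrightarrow> g \<in> length_ball G_Sp4 len n"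
    and schur_norm: "schur_norm G_Sp4 L len n c \<le> ereal C"
begin

lemma unip_in_L [simp]: "unip a b d e \<in> L"
  using unip_in_H H_subset by blast

lemma c_K_equiv: "K_equiv g (Cartan_mat i j) \<Longrightarrow> c g = c (Cartan_mat i j)"
  using biinvariant Cartan_mat_in_Sp4[of i j] unfolding K_equiv_def biinvariant_def by auto

lemma box_inv_mult:
  assumes "y \<in> unip_box M" "x \<in> unip_box M"
  shows "inv\<^bsub>G_Sp4\<lparr>carrier := L\<rparr>\<^esub> y \<otimes>\<^bsub>G_Sp4\<^esub> x \<in> unip_box M"
proof -
  interpret R: discrete_group "G_Sp4\<lparr>carrier := L\<rparr>" by (rule discrete)
  have "unip_box M \<subseteq> L" using unip_box_subset H_subset by blast
  then have "inv\<^bsub>G_Sp4\<lparr>carrier := L\<rparr>\<^esub> y \<otimes>\<^bsub>G_Sp4\<lparr>carrier := L\<rparr>\<^esub> x \<in> unip_box M"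
    using assms by (intro R.inv_mult_mem_if_finite) (auto intro: finite_unip_box unip_box_mult)
  then show ?thesis by simp
qed

lemma unip_box_L: "unip_box M \<subseteq> L"
  using unip_box_subset H_subset by blast

lemma point_bound:
  assumes "j \<le> i" "i \<le> N"
  shows "cmod (c (Cartan_mat i j)) \<le> C"
proof -
  let ?y = "unip 0 0 (monom 1 i) (monom 1 j) :: 'q fls^4^4"
  have K: "K_equiv ?y (Cartan_mat i j)"
    using assms(1) by (intro K_equiv_unip_Siegel) (auto simp: degree_monom_eq degree_mult_eq)
  have "cmod (c ?y) \<le> C"
  proof (rule schur_norm_point_bound[OF discrete _ _ finite_unip_box unip_box_nonempty unip_box_L _ schur_norm])
    show "?y \<in> length_ball G_Sp4 len n" using in_ball[OF assms K] .
    show "inv\<^bsub>G_Sp4\<lparr>carrier := L\<rparr>\<^esub> ?y \<otimes>\<^bsub>G_Sp4\<^esub> x \<in> unip_box i" if "x \<in> unip_box i" for x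
      using assms(1) that by (intro box_inv_mult unip_in_box) (auto simp: degree_monom_eq)
  qed simp
  then show ?thesis using c_K_equiv[OF K] by simp
qed

text \<open>Each of the two families has constant Cartan type, so the tested sum is
  \<open>card S\<close> times a single difference of values of \<open>c\<close>.\<close>

lemma difference_bound:
  fixes h :: "'s \<Rightarrow> 'q fls^4^4" and z1 z2 w :: "'q fls^4^4"
  assumes S: "finite S" "S \<noteq> {}" and h: "\<And>s. s \<in> S \<Longrightarrow> h s \<in> unip_box M"
    and v: "\<And>s s'. s \<in> S \<Longrightarrow> s' \<in> S \<Longrightarrow> v (s, s') \<in> H_Sp4 \<and> h s ** v (s, s') = h s'"
    and w: "w \<in> H_Sp4" and z: "z1 \<in> unip_box M" "z2 \<in> unip_box M" "z1 = w ** z2"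
    and Good: "Good \<subseteq> S \<times> S" and \<sigma>: "bij_betw \<sigma> Good Good"
    and shift: "\<And>p. p \<in> Good \<Longrightarrow> v (\<sigma> p) = w ** v p"
    and bad: "card (S \<times> S - Good) > 0"
    and ij1: "j1 \<le> i1" "i1 \<le> N" "\<And>s. s \<in> S \<Longrightarrow> K_equiv (h s ** z1) (Cartan_mat i1 j1)"
    and ij2: "j2 \<le> i2" "i2 \<le> N" "\<And>s. s \<in> S \<Longrightarrow> K_equiv (h s ** z2) (Cartan_mat i2 j2)"
  shows "cmod (c (Cartan_mat i2 j2) - c (Cartan_mat i1 j1))
    \<le> 2 * (sqrt (real (card (S \<times> S - Good))) / real (card S)) * C"
proof -
  have HL: "x \<in> L" if "x \<in> H_Sp4" for x using that H_subset by blast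
  have BL: "x \<in> L" if "x \<in> unip_box M" for x using that unip_box_L by blast
  have "cmod (\<Sum>s\<in>S. c (h s \<otimes>\<^bsub>G_Sp4\<^esub> z1) - c (h s \<otimes>\<^bsub>G_Sp4\<^esub> z2))
      \<le> 2 * sqrt (real (card (S \<times> S - Good))) * C"
  proof (rule schur_norm_difference_bound[where v = v and w = w and \<sigma> = \<sigma>, OF discrete S(1) _ _ _ _ _ Good \<sigma> _ bad _ _
        finite_unip_box unip_box_nonempty unip_box_L _ _ schur_norm])
    show "h s \<in> L" if "s \<in> S" for s using BL h[OF that] .
    show "v (s, s') \<in> L \<and> h s \<otimes>\<^bsub>G_Sp4\<^esub> v (s, s') = h s'" if "s \<in> S" "s' \<in> S" for s s'
      using v[OF that] HL by simp
    show "w \<in> L" "z2 \<in> L" using HL[OF w] BL[OF z(2)] .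
    show "z1 = w \<otimes>\<^bsub>G_Sp4\<^esub> z2" using z(3) by simp
    show "v (\<sigma> p) = w \<otimes>\<^bsub>G_Sp4\<^esub> v p" if "p \<in> Good" for p using shift[OF that] by simp
    show "h s \<otimes>\<^bsub>G_Sp4\<^esub> z1 \<in> length_ball G_Sp4 len n" if "s \<in> S" for s
      using in_ball[OF ij1(1,2) ij1(3)[OF that]] by simp
    show "h s \<otimes>\<^bsub>G_Sp4\<^esub> z2 \<in> length_ball G_Sp4 len n" if "s \<in> S" for s
      using in_ball[OF ij2(1,2) ij2(3)[OF that]] by simp
    show "inv\<^bsub>G_Sp4\<lparr>carrier := L\<rparr>\<^esub> (h s \<otimes>\<^bsub>G_Sp4\<^esub> z1) \<otimes>\<^bsub>G_Sp4\<^esub> x \<in> unip_box M"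
      if "s \<in> S" "x \<in> unip_box M" for s x
      using box_inv_mult[OF unip_box_mult[OF h[OF that(1)] z(1)] that(2)] by simp
    show "inv\<^bsub>G_Sp4\<lparr>carrier := L\<rparr>\<^esub> (h s \<otimes>\<^bsub>G_Sp4\<^esub> z2) \<otimes>\<^bsub>G_Sp4\<^esub> x \<in> unip_box M"
      if "s \<in> S" "x \<in> unip_box M" for s x
      using box_inv_mult[OF unip_box_mult[OF h[OF that(1)] z(2)] that(2)] by simp
  qed
  moreover have "(\<Sum>s\<in>S. c (h s \<otimes>\<^bsub>G_Sp4\<^esub> z1) - c (h s \<otimes>\<^bsub>G_Sp4\<^esub> z2)) =
      of_nat (card S) * (c (Cartan_mat i1 j1) - c (Cartan_mat i2 j2))"
    using c_K_equiv[OF ij1(3)] c_K_equiv[OF ij2(3)] by simp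
  ultimately have "real (card S) * cmod (c (Cartan_mat i2 j2) - c (Cartan_mat i1 j1))
      \<le> 2 * sqrt (real (card (S \<times> S - Good))) * C"
    by (simp add: norm_mult norm_minus_commute)
  moreover have "real (card S) > 0" using S by (simp add: card_gt_0_iff)
  ultimately show ?thesis by (simp add: field_simps)
qed

text \<open>
  A quadratic phase \<open>b\<^sup>2 div t\<^sup>i\<close> in the Siegel unipotent radical. For \<open>x = b' - b\<close> of degree
  larger than \<open>k\<close>, translating \<open>b\<close> by \<open>b\<^sub>0\<close> changes the phase difference by \<open>2 b\<^sub>0 x div t\<^sup>i\<close>,
  which can be made equal to \<open>t\<^sup>k\<^sup>+\<^sup>1 - t\<^sup>k\<close>.
\<close>

lemma Siegel_move:
  assumes two: "(2 :: 'q) \<noteq> 0" and ki: "k < i" "i \<le> N"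
  shows "cmod (c (Cartan_mat i k) - c (Cartan_mat i (Suc k)))
    \<le> 2 * (1 / sqrt (real CARD('q))) ^ (i - k) * C"
proof -
  define T W :: "'q poly" where "T = monom 1 i" and "W = monom 1 (Suc k) - monom 1 k"
  define S :: "'q poly set" where "S = polys_below (Suc i)"
  define B :: "'q poly set" where "B = polys_below (Suc k)"
  define Good where "Good = {(b, b'). b \<in> S \<and> b' \<in> S \<and> b' - b \<notin> B}"
  \<comment> \<open>Division with remainder solves \<open>2 * b0 * x = T * W\<close> up to a
    remainder of degree below \<open>degree x\<close>, hence below \<open>i\<close>, which
    disappears on dividing by \<open>T\<close>. The bound \<open>degree x > k\<close> keeps
    \<open>b0 x\<close> inside \<open>S\<close>.\<close>
  define b0 where "b0 x = (T * W) div (smult 2 x)" for x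
  \<comment> \<open>Both components move by the same amount, so \<open>b' - b\<close> is preserved;
    hence \<open>\<sigma>\<close> maps good pairs to good pairs and is inverted by
    subtraction.\<close>
  define \<sigma> where "\<sigma> = (\<lambda>(b, b'). (b + b0 (b' - b), b' + b0 (b' - b)))"
  \<comment> \<open>The last parameter makes \<open>b * b - T * (b * b div T)\<close> a remainder
    modulo \<open>T\<close>, so the decisive minor does not depend on \<open>b\<close> to leading
    order.\<close>
  define h where "h b = unip 0 b T (b * b div T)" for b
  define v where "v = (\<lambda>(b, b'). unip 0 (b' - b) 0 (b' * b' div T - b * b div T))"
  have T: "T \<noteq> 0" "degree T = i" by (simp_all add: T_def degree_monom_eq)
  have W: "degree W = Suc k" "W \<noteq> 0"
  proof -
    have "degree (monom (1 :: 'q) (Suc k) + - monom 1 k) = degree (monom (1 :: 'q) (Suc k))"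
      by (rule degree_add_eq_left) (simp add: degree_monom_eq)
    then show "degree W = Suc k" by (simp add: W_def degree_monom_eq)
    then show "W \<noteq> 0" by auto
  qed
  have b0S: "b0 x \<in> S" and b0W: "smult 2 (b0 x * x) div T = W" if x: "x \<in> S" "x \<notin> B" for x
  proof -
    have dx: "Suc k \<le> degree x" "degree x \<le> i" "x \<noteq> 0"
      using x unfolding S_def B_def polys_below_Suc_iff by auto
    let ?y = "smult 2 x"
    have y: "?y \<noteq> 0" "degree ?y = degree x" using dx(3) two by simp_all
    have eq: "b0 x * ?y + (T * W) mod ?y = T * W" unfolding b0_def by (rule div_mult_mod_eq)
    have r: "(T * W) mod ?y = 0 \<or> degree ((T * W) mod ?y) < degree x"
      using degree_mod_less[OF y(1), of "T * W"] y(2) by simp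
    have TW: "degree (T * W) = i + Suc k" using T W by (simp add: degree_mult_eq)
    show "b0 x \<in> S"
    proof (cases "b0 x = 0")
      case False
      have "degree (b0 x) + degree x = degree (T * W - (T * W) mod ?y)"
        using eq False y by (metis add_diff_cancel_right' degree_mult_eq)
      also have "\<dots> \<le> i + Suc k"
        using r TW dx by (intro degree_diff_le) auto
      finally show ?thesis using dx by (simp add: S_def polys_below_Suc_iff)
    qed (simp add: S_def)
    have "(T * W) mod ?y div T = 0"
      using r dx T by (auto intro: div_poly_less)
    then have "(b0 x * ?y) div T = (T * W) div T"
      using poly_div_add_left[of "b0 x * ?y" "(T * W) mod ?y" T] eq by simp
    then show "smult 2 (b0 x * x) div T = W" using T(1) by simp
  qed
  have Sadd: "x + y \<in> S" "x - y \<in> S" if "x \<in> S" "y \<in> S" for x y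
    using that by (simp_all add: S_def polys_below_add polys_below_diff)
  have BS: "B \<subseteq> S" using ki by (auto simp: S_def B_def polys_below_Suc_iff)
  have cards: "card S = CARD('q) ^ Suc i" "card B = CARD('q) ^ Suc k"
    by (simp_all add: S_def B_def card_polys_below)
  have bad: "S \<times> S - Good = {(b, b'). b \<in> S \<and> b' \<in> S \<and> b' - b \<in> B}"
    by (auto simp: Good_def)
  have card_bad: "card (S \<times> S - Good) = CARD('q) ^ Suc i * CARD('q) ^ Suc k"
    unfolding bad using card_difference_pairs[of S B] Sadd BS cards by (simp add: S_def)
  have "cmod (c (Cartan_mat i k) - c (Cartan_mat i (Suc k)))
    \<le> 2 * (sqrt (real (card (S \<times> S - Good))) / real (card S)) * C"
  proof (rule difference_bound[where M = i and v = v and \<sigma> = \<sigma> and h = h and w = "unip 0 0 0 W"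
        and ?z1.0 = "unip 0 0 0 (monom 1 (Suc k))" and ?z2.0 = "unip 0 0 0 (monom 1 k)"])
    show "finite S" by (simp add: S_def)
    show "S \<noteq> {}" unfolding S_def using zero_in_polys_below by blast
    have divT: "degree (b * b div T) \<le> i" if "b \<in> S" for b
    proof (cases "b * b div T = 0")
      case False
      have b: "degree b \<le> i" using that by (simp add: S_def polys_below_Suc_iff)
      have "degree (b * b div T * T) = degree (b * b - b * b mod T)"
        by (metis add_diff_cancel_right' div_mult_mod_eq)
      also have "\<dots> \<le> 2 * i"
        using degree_mult_le[of b b] b degree_mod_less[OF T(1), of "b * b"] T(2)
        by (intro degree_diff_le) auto
      finally show ?thesis using T False by (simp add: degree_mult_eq)
    qed simp
    show "h b \<in> unip_box i" if "b \<in> S" for b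
      unfolding h_def using that divT[OF that] T by (intro unip_in_box) (auto simp: S_def polys_below_Suc_iff)
    show "v (b, b') \<in> H_Sp4 \<and> h b ** v (b, b') = h b'" for b b'
      by (simp add: v_def h_def unip_in_H unip_mult)
    show "unip 0 0 0 W \<in> H_Sp4" by (rule unip_in_H)
    show "unip 0 0 0 (monom 1 (Suc k)) \<in> unip_box i" "unip 0 0 0 (monom 1 k) \<in> unip_box i"
      using ki by (auto intro!: unip_in_box simp: degree_monom_eq)
    show "unip 0 0 0 (monom 1 (Suc k)) = unip 0 0 0 W ** unip 0 0 0 (monom 1 k)"
      by (simp add: unip_mult W_def)
    show "Good \<subseteq> S \<times> S" by (auto simp: Good_def)
    show "bij_betw \<sigma> Good Good"
      by (rule bij_betwI[where g = "\<lambda>(b, b'). (b - b0 (b' - b), b' - b0 (b' - b))"])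
        (auto simp: \<sigma>_def Good_def intro!: Sadd b0S)
    have smult_2: "smult 2 p = p + p" for p :: "'q poly"
      by (metis one_add_one smult_1_left smult_add_left)
    show "v (\<sigma> p) = unip 0 0 0 W ** v p" if "p \<in> Good" for p
    proof -
      obtain b b' where p: "p = (b, b')" by force
      define x where "x = b' - b"
      have x: "x \<in> S" "x \<notin> B" using that Sadd by (auto simp: p x_def Good_def)
      have b': "b' = b + x" by (simp add: x_def)
      have "(b' + b0 x) * (b' + b0 x) - (b + b0 x) * (b + b0 x) = (b' * b' - b * b) + smult 2 (b0 x * x)"
        unfolding b' smult_2 by (simp add: algebra_simps)
      then have "(b' + b0 x) * (b' + b0 x) div T - (b + b0 x) * (b + b0 x) div T = (b' * b' div T - b * b div T) + W"
        using b0W[OF x] by (metis poly_div_add_left poly_div_diff_left)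
      then show ?thesis
        by (simp add: p \<sigma>_def v_def unip_mult flip: x_def)
    qed
    show "0 < card (S \<times> S - Good)" using card_bad by simp
    have type: "K_equiv (h b ** unip 0 0 0 (monom 1 l)) (Cartan_mat i l)" if "b \<in> S" "l \<le> i" for b l
    proof -
      have b: "degree b \<le> i" using that(1) by (simp add: S_def polys_below_Suc_iff)
      have "b * b - T * (b * b div T + monom 1 l) = b * b mod T - T * monom 1 l"
        by (simp add: algebra_simps minus_mult_div_eq_mod)
      \<comment> \<open>The remainder has degree below \<open>i\<close>, so the term of degree
        \<open>i + l\<close> dominates even for \<open>l = 0\<close>.\<close>
      moreover have "degree (b * b mod T - T * monom 1 l) = i + l"
      proof -
        have Tl: "degree (- (T * monom 1 l)) = i + l" using T by (simp add: degree_mult_eq degree_monom_eq)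
        show ?thesis
        proof (cases "b * b mod T = 0")
          case True
          then show ?thesis using Tl by simp
        next
          case False
          then have "degree (b * b mod T) < degree (- (T * monom 1 l))"
            using degree_mod_less[OF T(1), of "b * b"] T(2) Tl by simp
          from degree_add_eq_right[OF this] show ?thesis using Tl by simp
        qed
      qed
      moreover have "degree (b * b div T + monom 1 l) \<le> i"
        using divT[OF that(1)] that(2) by (intro degree_add_le) (auto simp: degree_monom_eq)
      ultimately have "K_equiv (unip 0 b T (b * b div T + monom 1 l)) (Cartan_mat i l)"
        using b T that(2) by (intro K_equiv_unip_Siegel) auto
      then show ?thesis by (simp add: h_def unip_mult)
    qed
    show "K_equiv (h b ** unip 0 0 0 (monom 1 (Suc k))) (Cartan_mat i (Suc k))" if "b \<in> S" for b
      using type that ki by simp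
    show "K_equiv (h b ** unip 0 0 0 (monom 1 k)) (Cartan_mat i k)" if "b \<in> S" for b
      using type that ki by simp
  qed (use ki in auto)
  \<comment> \<open>In powers of \<open>q\<close>: half of \<open>Suc i + Suc k\<close>, minus
    \<open>Suc i\<close>, is minus half of \<open>i - k\<close>.\<close>
  also have "sqrt (real (card (S \<times> S - Good))) / real (card S) = (1 / sqrt (real CARD('q))) ^ (i - k)"
    unfolding card_bad cards power_add[symmetric] of_nat_power
    using ki by (intro sqrt_power_divide) auto
  finally show ?thesis .
qed

text \<open>
  In the Klingen unipotent radical the commutator of the \<open>a\<close>- and \<open>b\<close>-directions is central.
  If \<open>x = a' - a\<close> has large degree, translating \<open>b\<close> by \<open>b\<^sub>0\<close> shifts the central coordinate of
  \<open>h\<^sup>-\<^sup>1 h'\<close> by \<open>b\<^sub>0 x\<close>, which equals \<open>t\<^sup>k\<^sup>+\<^sup>1 - t\<^sup>k\<close> up to a remainder absorbed by the averaging over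
  the central coordinate. The factor \<open>\<delta>\<close> makes both parities of \<open>i + j\<close> accessible.
\<close>

lemma Klingen_move:
  assumes p: "p \<le> 1" and k: "m + p \<le> k" "Suc k \<le> 2 * m" "Suc k \<le> N"
  shows "cmod (c (Cartan_mat k (2 * m + p - k)) - c (Cartan_mat (Suc k) (2 * m + p - Suc k)))
    \<le> 2 * (1 / sqrt (real CARD('q))) ^ (2 * m - Suc k) * C"
proof -
  define W \<delta> t :: "'q poly" where "W = monom 1 (Suc k) - monom 1 k"
    and "\<delta> = (if p = 0 then 0 else monom 1 1)" and "t = monom 1 m"
  \<comment> \<open>Perturbations of degree below \<open>m\<close> keep \<open>t + a\<close> of
    exact degree \<open>m\<close>. A good difference has degree at least \<open>Suc k - m\<close>,
    so quotients of \<open>W\<close> by it reach degree \<open>m\<close>; hence the larger set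
    \<open>A'\<close> for \<open>b\<close>.\<close>
  define A :: "'q poly set" where "A = polys_below m"
  define A' :: "'q poly set" where "A' = polys_below (Suc m)"
  define B :: "'q poly set" where "B = polys_below (Suc k - m)"
  define S where "S = A \<times> A' \<times> A"
  define Good where "Good = {((a, b, d), (a', b', d')). (a, b, d) \<in> S \<and> (a', b', d') \<in> S \<and> a' - a \<notin> B}"
  \<comment> \<open>The remainder is added to \<open>d'\<close> only: \<open>v\<close> contains
    \<open>d' - d\<close>, so shifting both central coordinates alike would have no effect.\<close>
  define \<sigma> where "\<sigma> = (\<lambda>((a, b, d :: 'q poly), (a', b', d' :: 'q poly)).
    ((a, b + W div (a' - a), d), (a', b' + W div (a' - a), d' + W mod (a' - a))))"
  define h where "h = (\<lambda>(a, b, d). unip (t + a) b d \<delta>)"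
  define v where "v = (\<lambda>((a, b, d), (a', b', d')).
    unip (a' - a) (b' - b) (d' - d - (t + a) * (b' - b) + b * (a' - a)) 0)"
  have m: "m \<ge> 1" using k by simp
  have W: "degree W = Suc k"
  proof -
    have "degree (monom (1 :: 'q) (Suc k) + - monom 1 k) = degree (monom (1 :: 'q) (Suc k))"
      by (rule degree_add_eq_left) (simp add: degree_monom_eq)
    then show "degree W = Suc k" by (simp add: W_def degree_monom_eq)
  qed
  have quot: "W div x \<in> A'" "W mod x \<in> A" if x: "x \<in> A" "x \<notin> B" for x
  proof -
    have dx: "x \<noteq> 0" "Suc k - m \<le> degree x" "degree x < m"
      using x unfolding A_def B_def polys_below_iff by auto
    have r: "W mod x = 0 \<or> degree (W mod x) < degree x"
      using degree_mod_less[OF dx(1)] .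
    then show "W mod x \<in> A" using dx by (auto simp: A_def polys_below_iff)
    show "W div x \<in> A'"
    proof (cases "W div x = 0")
      case False
      have "degree (W div x) + degree x = degree (W - W mod x)"
        using False dx(1) by (metis add_diff_cancel_right' degree_mult_eq div_mult_mod_eq)
      also have "\<dots> \<le> Suc k"
        using r W dx k by (intro degree_diff_le) auto
      finally show ?thesis using dx by (simp add: A'_def polys_below_Suc_iff)
    qed (simp add: A'_def)
  qed
  have Aadd: "x + y \<in> A" "x - y \<in> A" if "x \<in> A" "y \<in> A" for x y
    using that by (simp_all add: A_def polys_below_add polys_below_diff)
  have A'add: "x + y \<in> A'" "x - y \<in> A'" if "x \<in> A'" "y \<in> A'" for x y
    using that by (simp_all add: A'_def polys_below_add polys_below_diff)
  have BA: "B \<subseteq> A" using k by (auto simp: A_def B_def polys_below_iff)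
  have cards: "card A = CARD('q) ^ m" "card A' = CARD('q) ^ Suc m" "card B = CARD('q) ^ (Suc k - m)"
    by (simp_all add: A_def A'_def B_def card_polys_below)
  have fin: "finite A" "finite A'" by (simp_all add: A_def A'_def)
  have card_S: "card S = CARD('q) ^ (3 * m + 1)"
  proof -
    have "card S = CARD('q) ^ m * (CARD('q) ^ Suc m * CARD('q) ^ m)"
      by (simp add: S_def card_cartesian_product cards)
    also have "\<dots> = CARD('q) ^ (m + (Suc m + m))" by (simp only: power_add)
    also have "m + (Suc m + m) = 3 * m + 1" by simp
    finally show ?thesis .
  qed
  have card_bad: "card (S \<times> S - Good) = CARD('q) ^ (4 * m + k + 3)"
  proof -
    \<comment> \<open>Badness concerns only \<open>a\<close> and \<open>a'\<close>; the other four
      coordinates of a pair are free.\<close>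
    let ?P = "{(a, a'). a \<in> A \<and> a' \<in> A \<and> a' - a \<in> B}"
    have "bij_betw (\<lambda>((a, b, d), (a', b', d')). ((a, a'), (b, d), (b', d'))) (S \<times> S - Good)
        (?P \<times> (A' \<times> A) \<times> (A' \<times> A))"
      by (rule bij_betwI[where g = "\<lambda>((a, a'), (b, d), (b', d')). ((a, b, d), (a', b', d'))"])
        (auto simp: S_def Good_def)
    then have "card (S \<times> S - Good) = card ?P * ((card A' * card A) * (card A' * card A))"
      by (simp add: bij_betw_same_card card_cartesian_product)
    also have "card ?P = card A * card B"
      using Aadd BA fin by (intro card_difference_pairs) auto
    also have "card A * card B * ((card A' * card A) * (card A' * card A)) =
        CARD('q) ^ (m + (Suc k - m) + ((Suc m + m) + (Suc m + m)))"
      by (simp only: cards power_add)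
    also have "m + (Suc k - m) + ((Suc m + m) + (Suc m + m)) = 4 * m + k + 3" using k by simp
    finally show ?thesis .
  qed
  have "cmod (c (Cartan_mat k (2 * m + p - k)) - c (Cartan_mat (Suc k) (2 * m + p - Suc k)))
    \<le> 2 * (sqrt (real (card (S \<times> S - Good))) / real (card S)) * C"
  proof (rule difference_bound[where M = m and v = v and \<sigma> = \<sigma> and h = h and w = "unip 0 0 W 0"
        and ?z1.0 = "unip 0 0 (monom 1 (Suc k)) 0" and ?z2.0 = "unip 0 0 (monom 1 k) 0"])
    show "finite S" using fin by (simp add: S_def)
    show "S \<noteq> {}" unfolding S_def A_def A'_def using zero_in_polys_below by blast
    have dta: "degree (t + a) = m" if "a \<in> A" for a
    proof (cases "a = 0")
      case False
      then have "degree a < degree t" using that by (simp add: A_def polys_below_iff t_def degree_monom_eq)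
      then show ?thesis by (simp add: degree_add_eq_left) (simp add: t_def degree_monom_eq)
    qed (simp add: t_def degree_monom_eq)
    show "h s \<in> unip_box m" if s: "s \<in> S" for s
    proof -
      obtain a b d where s': "s = (a, b, d)" "a \<in> A" "b \<in> A'" "d \<in> A" using s by (auto simp: S_def)
      then have "degree b \<le> m" "degree d \<le> m"
        by (auto simp: A_def A'_def polys_below_iff)
      then show ?thesis
        unfolding s'(1) h_def using dta[OF s'(2)] m
        by (auto intro!: unip_in_box simp: \<delta>_def degree_monom_eq)
    qed
    show "v (s, s') \<in> H_Sp4 \<and> h s ** v (s, s') = h s'" for s s'
      by (cases s; cases s') (simp add: v_def h_def unip_in_H unip_mult algebra_simps)
    show "unip 0 0 W 0 \<in> H_Sp4" by (rule unip_in_H)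
    show "unip 0 0 (monom 1 (Suc k)) 0 \<in> unip_box m" "unip 0 0 (monom 1 k) 0 \<in> unip_box m"
      using k by (auto intro!: unip_in_box simp: degree_monom_eq)
    show "unip 0 0 (monom 1 (Suc k)) 0 = unip 0 0 W 0 ** unip 0 0 (monom 1 k) 0"
      by (simp add: unip_mult W_def)
    show "Good \<subseteq> S \<times> S" by (auto simp: Good_def)
    show "bij_betw \<sigma> Good Good"
      by (rule bij_betwI[where g = "\<lambda>((a, b, d), (a', b', d')).
          ((a, b - W div (a' - a), d), (a', b' - W div (a' - a), d' - W mod (a' - a)))"])
        (auto simp: \<sigma>_def Good_def S_def intro!: Aadd A'add quot)
    show "v (\<sigma> x) = unip 0 0 W 0 ** v x" if "x \<in> Good" for x
    proof -
      obtain a b d a' b' d' where x: "x = ((a, b, d), (a', b', d'))" by (metis surj_pair)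
      define y where "y = a' - a"
      have "W mod y + a' * (W div y) = (W mod y + y * (W div y)) + a * (W div y)"
        by (simp only: y_def algebra_simps)
      also have "W mod y + y * (W div y) = W" by (rule mod_mult_div_eq)
      finally show ?thesis
        unfolding x \<sigma>_def v_def by (simp add: unip_mult algebra_simps flip: y_def)
    qed
    show "0 < card (S \<times> S - Good)" using card_bad by simp
    have type: "K_equiv (h s ** unip 0 0 (monom 1 l) 0) (Cartan_mat l (2 * m + p - l))"
      if s: "s \<in> S" and l: "m + p \<le> l" "l \<le> 2 * m" for s l
    proof -
      obtain a b d where s': "s = (a, b, d)" "a \<in> A" "b \<in> A'" "d \<in> A" using s by (auto simp: S_def)
      have b: "degree b \<le> m" using s'(3) by (auto simp: A'_def polys_below_iff)
      have dl: "degree (d + monom 1 l) = l"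
      proof (cases "d = 0")
        case False
        then have "degree d < degree (monom (1 :: 'q) l)"
          using s'(4) l by (simp add: A_def polys_below_iff degree_monom_eq)
        from degree_add_eq_right[OF this] show ?thesis by (simp add: degree_monom_eq)
      qed (simp add: degree_monom_eq)
      have "K_equiv (unip (t + a) b (d + monom 1 l) \<delta>) (Cartan_mat l (2 * m + p - l))"
        unfolding \<delta>_def using K_equiv_unip_Klingen[OF dta[OF s'(2)] b dl p l] .
      then show ?thesis by (simp add: s'(1) h_def unip_mult)
    qed
    show "K_equiv (h s ** unip 0 0 (monom 1 (Suc k)) 0) (Cartan_mat (Suc k) (2 * m + p - Suc k))" if "s \<in> S" for s
      using type[OF that] k by simp
    show "K_equiv (h s ** unip 0 0 (monom 1 k) 0) (Cartan_mat k (2 * m + p - k))" if "s \<in> S" for s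
      using type[OF that] k by simp
  qed (use k in auto)
  \<comment> \<open>The exponents match because
    \<open>2 * (3 * m + 1) = (4 * m + k + 3) + (2 * m - Suc k)\<close>.\<close>
  also have "sqrt (real (card (S \<times> S - Good))) / real (card S) = (1 / sqrt (real CARD('q))) ^ (2 * m - Suc k)"
    unfolding card_bad card_S of_nat_power
    using k by (intro sqrt_power_divide) auto
  finally show ?thesis .
qed

end

section \<open>Property T-Schur\<close>

lemma upper_unipotent_iff: "A \<in> upper_unipotent \<longleftrightarrow>
    A$1$1 = 1 \<and> A$2$1 = 0 \<and> A$2$2 = 1 \<and> A$3$1 = 0 \<and> A$3$2 = 0 \<and> A$3$3 = 1 \<and>
    A$4$1 = 0 \<and> A$4$2 = 0 \<and> A$4$3 = 0 \<and> A$4$4 = 1"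
  unfolding upper_unipotent_def by (auto simp: vec_eq_iff_4)

lemma Sp4_inverse_upper_unipotent: "A \<in> upper_unipotent \<Longrightarrow> Sp4_inverse A \<in> upper_unipotent"
  by (simp add: upper_unipotent_iff Sp4_inverse_def matrix_mult_nth_4 J4_nth)

lemma upper_unipotent_mult: "A \<in> upper_unipotent \<Longrightarrow> B \<in> upper_unipotent \<Longrightarrow> A ** B \<in> upper_unipotent"
  by (simp add: upper_unipotent_iff matrix_mult_nth_4)

lemma subgroup_H_Sp4: "subgroup H_Sp4 G_Sp4"
proof -
  interpret \<Gamma>: subgroup Gamma_Sp4 G_Sp4 by (rule subgroup_Gamma_Sp4)
  show ?thesis
  proof
    show "H_Sp4 \<subseteq> carrier G_Sp4" using \<Gamma>.subset by (auto simp: H_Sp4_def)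
    show "A \<otimes>\<^bsub>G_Sp4\<^esub> B \<in> H_Sp4" if "A \<in> H_Sp4" "B \<in> H_Sp4" for A B
      using that \<Gamma>.m_closed[of A B] by (simp add: H_Sp4_def upper_unipotent_mult)
    show "\<one>\<^bsub>G_Sp4\<^esub> \<in> H_Sp4"
      using unip_in_H[of 0 0 0 0] by (simp add: unip_0)
    show "inv\<^bsub>G_Sp4\<^esub> A \<in> H_Sp4" if "A \<in> H_Sp4" for A
    proof -
      have A: "A \<in> Gamma_Sp4" "A \<in> upper_unipotent" "A \<in> Sp4 UNIV"
        using that \<Gamma>.subset by (auto simp: H_Sp4_def)
      show ?thesis
        using \<Gamma>.m_inv_closed[OF A(1)] Sp4_inverse_upper_unipotent[OF A(2)]
        by (simp add: H_Sp4_def inv_G_Sp4[OF A(3)])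
    qed
  qed
qed

text \<open>Distance below 1 forces equal coefficients at nonpositive powers of
  \<open>fls_X\<close>, and elements of \<open>Gamma_Sp4\<close> have no others. The uniform gap
  yields discreteness and closedness of every subgroup in between.\<close>

lemma Gamma_Sp4_separated:
  assumes "A \<in> Gamma_Sp4" "B \<in> Gamma_Sp4" "dist A B < 1"
  shows "A = B"
proof -
  have "mat_bdd (- int 0 - 1) (A - B)"
    using assms(3) by (intro mat_bdd_if_dist_less) simp
  then have low: "A $ i $ j $$ k = B $ i $ j $$ k" if "k \<le> 0" for i j k
    using that by (simp add: mat_bdd_def fls_bdd_def)
  have high: "A $ i $ j $$ k = B $ i $ j $$ k" if "k > 0" for i j k
    using assms(1,2) that by (auto simp: Gamma_Sp4_def Sp4_def polys_in_X_inv_eq_nth)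
  show ?thesis
    unfolding vec_eq_iff by (intro allI fls_eqI) (metis low high not_le)
qed

lemma discrete_group_subgroup:
  assumes L: "subgroup L G_Sp4" and sub: "L \<subseteq> Gamma_Sp4"
  shows "discrete_group (G_Sp4\<lparr>carrier := L\<rparr>)"
proof -
  interpret group "G_Sp4\<lparr>carrier := L\<rparr>"
    using subgroup.subgroup_is_group[OF L group_G_Sp4] .
  show ?thesis
  proof
    fix A assume A: "A \<subseteq> carrier (G_Sp4\<lparr>carrier := L\<rparr>)"
    have "A = L \<inter> (\<Union>x\<in>A. ball x 1)"
    proof (intro equalityI subsetI)
      fix y assume "y \<in> L \<inter> (\<Union>x\<in>A. ball x 1)"
      then obtain x where x: "x \<in> A" "dist x y < 1" "y \<in> L" by auto
      then have "x = y" using A sub by (intro Gamma_Sp4_separated) auto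
      then show "y \<in> A" using x(1) by simp
    next
      fix y assume "y \<in> A"
      then show "y \<in> L \<inter> (\<Union>x\<in>A. ball x 1)" using A by (auto intro!: bexI[of _ y])
    qed
    moreover have "open (\<Union>x\<in>A. ball x 1)" by (intro open_UN ballI open_ball)
    ultimately show "openin (top_of_set (carrier (G_Sp4\<lparr>carrier := L\<rparr>))) A"
      unfolding openin_open by auto
  qed
qed

lemma compact_Sp4_mat_bdd: "compact {A \<in> Sp4 UNIV :: ('q::{field,finite} fls^4^4) set. mat_bdd (int N) A}"
  using compact_Int_closed[OF compact_mat_bdd[of N] closed_Sp4]
  by (simp add: Int_def conj_commute)

lemma locally_compact_group_G_Sp4: "locally_compact_group (G_Sp4 :: ('q::{field,finite} fls^4^4) monoid)"
proof -
  have "continuous_on (Sp4 UNIV) (\<lambda>A :: 'q fls^4^4. inv\<^bsub>G_Sp4\<^esub> A)"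
    using continuous_on_Sp4_inverse by (rule continuous_on_cong[THEN iffD2, rotated 2]) (auto simp: inv_G_Sp4)
  moreover have "locally_compact_space (top_of_set (Sp4 UNIV :: ('q fls^4^4) set))"
    unfolding locally_compact_space_def
  proof
    fix A :: "'q fls^4^4" assume "A \<in> topspace (top_of_set (Sp4 UNIV))"
    moreover obtain N where "mat_bdd (int N) A" using mat_bdd_exists by blast
    moreover have "openin (top_of_set (Sp4 UNIV)) {A \<in> Sp4 UNIV :: ('q fls^4^4) set. mat_bdd (int N) A}"
      unfolding openin_open using open_mat_bdd[of N] by (intro exI[of _ "{A. mat_bdd (int N) A}"]) auto
    moreover have "compactin (top_of_set (Sp4 UNIV)) {A \<in> Sp4 UNIV :: ('q fls^4^4) set. mat_bdd (int N) A}"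
      using compact_Sp4_mat_bdd by (auto simp: compactin_subtopology)
    ultimately show "\<exists>U K. openin (top_of_set (Sp4 UNIV)) U \<and> compactin (top_of_set (Sp4 UNIV)) K \<and> A \<in> U \<and> U \<subseteq> K"
      by (intro exI[of _ "{A \<in> Sp4 UNIV. mat_bdd (int N) A}"]) auto
  qed
  ultimately show ?thesis
    by (simp add: locally_compact_group_def group_G_Sp4 continuous_on_matrix_mult)
qed

text \<open>The ambient group is not compact because it contains the closed, infinite, discrete
  \<open>L\<close>; this also separates it from the compact \<open>K_Sp4\<close>.\<close>

lemma T_Schur_setting_Sp4:
  assumes L: "subgroup L (G_Sp4 :: ('q::{field,finite} fls^4^4) monoid)" and sub: "H_Sp4 \<subseteq> L" "L \<subseteq> Gamma_Sp4"
  shows "T_Schur_setting (G_Sp4 :: ('q fls^4^4) monoid) K_Sp4 L"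
proof -
  interpret discrete_group "G_Sp4\<lparr>carrier := L\<rparr>" by (rule discrete_group_subgroup[OF L sub(2)])
  have LS: "L \<subseteq> Sp4 UNIV" using subgroup.subset[OF L] by simp
  have closed: "closed L"
    using sub(2) Gamma_Sp4_separated by (intro discrete_imp_closed[of 1]) (auto simp: dist_commute)
  have "inj (\<lambda>n. unip 0 0 (monom 1 n) 0 :: 'q fls^4^4)"
    by (auto simp: inj_def dest: arg_cong[where f = degree] simp: degree_monom_eq)
  moreover have "range (\<lambda>n. unip 0 0 (monom 1 n) 0) \<subseteq> L" using sub(1) unip_in_H by blast
  ultimately have "infinite L" using finite_subset finite_imageD by blast
  then have nc: "\<not> compact L" using finite_if_compact[of L] by auto
  have nG: "\<not> compact (Sp4 UNIV :: ('q fls^4^4) set)"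
  proof
    assume "compact (Sp4 UNIV :: ('q fls^4^4) set)"
    then have "compact (Sp4 UNIV \<inter> L)" using closed by (rule compact_Int_closed)
    moreover have "Sp4 UNIV \<inter> L = L" using LS by blast
    ultimately show False using nc by simp
  qed
  have K: "compact (K_Sp4 :: ('q fls^4^4) set)"
    using compact_Sp4_mat_bdd[of 0] by (simp add: K_Sp4_eq)
  then have "K_Sp4 \<noteq> (Sp4 UNIV :: ('q fls^4^4) set)" using nG by auto
  then show ?thesis
    unfolding T_Schur_setting_def
    using locally_compact_group_G_Sp4 nG subgroup_K_Sp4 K L nc closed_subset[OF LS closed] by simp
qed

lemma Cartan_mat_mult: "Cartan_mat i j ** Cartan_mat i' j' = Cartan_mat (i + i') (j + j')"
  by (simp add: Cartan_mat_def Cartan_diag_def mat4_simps power_add mult.commute)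

text \<open>A length function is bounded on the compact \<open>K_Sp4\<close>, and subadditivity
  along the two generators of the diagonal semigroup gives linear growth. This is how an arbitrary
  length function is compared with Cartan types.\<close>

lemma length_function_linear_bound:
  fixes len :: "'q::{field,finite} fls^4^4 \<Rightarrow> real"
  assumes len: "length_function G_Sp4 len"
  obtains \<kappa> where "\<kappa> > 0"
    "\<And>(g :: 'q fls^4^4) i j. j \<le> i \<Longrightarrow> K_equiv g (Cartan_mat i j) \<Longrightarrow> len g \<le> \<kappa> * (real i + 1)"
proof -
  have mult: "len (A ** B) \<le> len A + len B" if "A \<in> Sp4 UNIV" "B \<in> Sp4 UNIV" for A B
    using len that by (auto simp: length_function_def)
  have nonneg: "len A \<ge> 0" if "A \<in> Sp4 UNIV" for A using len that by (simp add: length_function_def)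
  have "continuous_on K_Sp4 len"
    using len K_Sp4_in_Sp4 unfolding length_function_def by (auto intro: continuous_on_subset)
  moreover have "compact (K_Sp4 :: ('q fls^4^4) set)"
    using compact_Sp4_mat_bdd[of 0] by (simp add: K_Sp4_eq)
  ultimately have "bdd_above (len ` K_Sp4)"
    by (intro bounded_imp_bdd_above compact_imp_bounded compact_continuous_image)
  then obtain M where M: "\<And>k. k \<in> K_Sp4 \<Longrightarrow> len k \<le> M" by (auto simp: bdd_above_def)
  define l1 l2 where "l1 = len (Cartan_mat 1 0)" and "l2 = len (Cartan_mat 0 1)"
  have l: "l1 \<ge> 0" "l2 \<ge> 0" by (simp_all add: l1_def l2_def nonneg Cartan_mat_in_Sp4)
  have M0: "M \<ge> 0" using M[OF K_Sp4_one] nonneg[OF Sp4_one] by simp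
  have one: "len (Cartan_mat 0 0) = 0"
  proof -
    have "Cartan_mat 0 0 = (mat 1 :: 'q fls^4^4)"
      by (simp add: Cartan_mat_def Cartan_diag_def vec_eq_iff_4 mat_nth)
    then show ?thesis using len by (simp add: length_function_def)
  qed
  have j: "len (Cartan_mat 0 j) \<le> real j * l2" for j
  proof (induction j)
    case (Suc j)
    have "Cartan_mat 0 (Suc j) = (Cartan_mat 0 1 ** Cartan_mat 0 j :: 'q fls^4^4)"
      by (simp add: Cartan_mat_mult)
    then show ?case
      using mult[OF Cartan_mat_in_Sp4[of 0 1] Cartan_mat_in_Sp4[of 0 j]] Suc
      by (simp add: l2_def algebra_simps)
  qed (simp add: one)
  have ij: "len (Cartan_mat i j) \<le> real i * l1 + real j * l2" for i j
  proof (induction i)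
    case (Suc i)
    have "Cartan_mat (Suc i) j = (Cartan_mat 1 0 ** Cartan_mat i j :: 'q fls^4^4)"
      by (simp add: Cartan_mat_mult)
    then show ?case
      using mult[OF Cartan_mat_in_Sp4[of 1 0] Cartan_mat_in_Sp4[of i j]] Suc
      by (simp add: l1_def algebra_simps)
  qed (use j in simp)
  \<comment> \<open>The outer factors from \<open>K_Sp4\<close> account for \<open>2 * M\<close>;
    the summand 1 keeps \<open>\<kappa>\<close> positive even if \<open>len\<close>
    vanishes.\<close>
  define \<kappa> where "\<kappa> = 2 * M + l1 + l2 + 1"
  show ?thesis
  proof (rule that[of \<kappa>])
    show "\<kappa> > 0" using M0 l by (simp add: \<kappa>_def)
    fix g :: "'q fls^4^4" and i j assume ji: "j \<le> i" and g: "K_equiv g (Cartan_mat i j)"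
    obtain k k' where k: "k \<in> K_Sp4" "k' \<in> K_Sp4" "g = k ** Cartan_mat i j ** k'"
      using g unfolding K_equiv_def by blast
    have "len g \<le> len k + len (Cartan_mat i j) + len k'"
      unfolding k(3) using k(1,2)
        mult[of "k ** Cartan_mat i j" k'] mult[of k "Cartan_mat i j"]
      by (simp add: Sp4_mult K_Sp4_in_Sp4 Cartan_mat_in_Sp4)
    also have "\<dots> \<le> M + (real i * l1 + real j * l2) + M"
      using M k ij by (intro add_mono) auto
    also have "\<dots> \<le> M + (real i * l1 + real i * l2) + M"
      using ji l by (intro add_mono mult_right_mono) auto
    also have "\<dots> \<le> \<kappa> * (real i + 1)"
      using M0 l by (simp add: \<kappa>_def algebra_simps)
    finally show "len g \<le> \<kappa> * (real i + 1)" .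
  qed
qed

definition height :: "'q::field fls^4^4 \<Rightarrow> nat" where
  "height A = (LEAST n. mat_bdd (int n) A)"

lemma mat_bdd_iff_height: "mat_bdd (int n) A \<longleftrightarrow> height A \<le> n"
proof -
  obtain N where "mat_bdd (int N) A" using mat_bdd_exists by blast
  then have "mat_bdd (int (height A)) A" unfolding height_def by (rule LeastI)
  then show ?thesis unfolding height_def by (auto intro: Least_le mat_bdd_mono)
qed

lemma height_eq: "j \<le> i \<Longrightarrow> K_equiv A (Cartan_mat i j) \<Longrightarrow> height A = i"
  using K_equiv_mat_bdd mat_bdd_Cartan_mat mat_bdd_iff_height
  by (metis order_antisym order_refl)

text \<open>\<open>height\<close> is locally constant, and the elements of height at most
  \<open>N\<close> form a compact set.\<close>

lemma power_height_C0:
  assumes \<theta>: "0 < \<theta>" "\<theta> < 1" and A: "A > 0"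
  shows "(\<lambda>g. A * \<theta> ^ height g) \<in> C0 (G_Sp4 :: ('q::{field,finite} fls^4^4) monoid)"
proof -
  have "height B = height A" if "dist A B < 1" for A B :: "'q fls^4^4"
    using mat_bdd_if_dist_less_1[of A B] mat_bdd_if_dist_less_1[of B A] that mat_bdd_iff_height
    by (metis dist_commute order_antisym order_refl)
  then have "continuous_on (Sp4 UNIV) (\<lambda>g :: 'q fls^4^4. A * \<theta> ^ height g)"
    unfolding continuous_on_iff by (metis dist_commute dist_self zero_less_one)
  moreover have "\<exists>Q. compact Q \<and> Q \<subseteq> Sp4 UNIV \<and> (\<forall>g\<in>Sp4 UNIV - Q :: ('q fls^4^4) set. \<bar>A * \<theta> ^ height g\<bar> < \<epsilon>)"
    if \<epsilon>: "\<epsilon> > 0" for \<epsilon>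
  proof -
    obtain N where N: "\<theta> ^ N < \<epsilon> / A" using real_arch_pow_inv[of "\<epsilon> / A" \<theta>] \<epsilon> A \<theta> by auto
    have "\<bar>A * \<theta> ^ height g\<bar> < \<epsilon>" if "\<not> mat_bdd (int N) g" for g :: "'q fls^4^4"
    proof -
      have "\<theta> ^ height g \<le> \<theta> ^ N" using that \<theta> by (intro power_decreasing) (auto simp: mat_bdd_iff_height)
      then have "\<theta> ^ height g < \<epsilon> / A" using N by simp
      then show ?thesis using A \<theta> by (simp add: abs_mult field_simps)
    qed
    then show ?thesis
      using compact_Sp4_mat_bdd[of N, where 'q = 'q]
      by (intro exI[of _ "{A \<in> Sp4 UNIV :: ('q fls^4^4) set. mat_bdd (int N) A}"]) auto
  qed
  ultimately show ?thesis by (simp add: C0_def)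
qed

lemma has_T_Schur_Sp4:
  assumes two: "(2 :: 'q::{field,finite}) \<noteq> 0"
    and L: "subgroup L (G_Sp4 :: ('q fls^4^4) monoid)" "H_Sp4 \<subseteq> L" "L \<subseteq> Gamma_Sp4"
  shows "has_T_Schur (G_Sp4 :: ('q fls^4^4) monoid) K_Sp4 L"
  unfolding has_T_Schur_def
proof (intro conjI allI impI T_Schur_setting_Sp4 L)
  fix len assume len: "length_function (G_Sp4 :: ('q fls^4^4) monoid) len"
  obtain \<kappa> where \<kappa>: "\<kappa> > 0"
    "\<And>(g :: 'q fls^4^4) i j. j \<le> i \<Longrightarrow> K_equiv g (Cartan_mat i j) \<Longrightarrow> len g \<le> \<kappa> * (real i + 1)"
    using length_function_linear_bound[OF len] by blast
  \<comment> \<open>\<open>r\<close> is the gain of both moves per unit of distance from the wall;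
    the eighth root puts it into the form used by \<open>zigzag\<close>.\<close>
  define r where "r = 1 / sqrt (real CARD('q))"
  define \<theta> where "\<theta> = root 8 r"
  have "CARD('q) \<ge> 2"
  proof -
    have "card {0, 1 :: 'q} \<le> CARD('q)" by (rule card_mono) auto
    then show ?thesis by simp
  qed
  then have r: "0 < r" "r < 1" by (simp_all add: r_def)
  have \<theta>: "0 < \<theta>" "\<theta> < 1" "\<theta> ^ 8 = r" using r by (simp_all add: \<theta>_def)
  show "\<exists>s\<^sub>0>0. \<forall>s\<in>{0..<s\<^sub>0}. \<exists>\<phi>\<in>C0 G_Sp4. \<forall>C>0. \<forall>c.
    continuous_on (carrier (G_Sp4 :: ('q fls^4^4) monoid)) c \<and> biinvariant G_Sp4 K_Sp4 c \<and>
      (\<forall>n. schur_norm G_Sp4 L len n c \<le> ereal (C * exp (s * real n))) \<longrightarrow>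
      (\<exists>c_inf. \<forall>g\<in>carrier G_Sp4. cmod (c g - c_inf) \<le> C * \<phi> g)"
  \<comment> \<open>With this threshold, enlarging \<open>i\<close> by one, and so the length by
    \<open>\<kappa>\<close>, multiplies \<open>exp (s * n)\<close> by at most
    \<open>1 / \<theta>\<close>.\<close>
  proof (intro exI[of _ "ln (1 / \<theta>) / \<kappa>"] conjI ballI)
    show "0 < ln (1 / \<theta>) / \<kappa>" using \<theta> \<kappa>(1) by simp
    fix s assume "s \<in> {0..<ln (1 / \<theta>) / \<kappa>}"
    then have s: "0 \<le> s" "s * \<kappa> \<le> ln (1 / \<theta>)" using \<kappa>(1) by (auto simp: field_simps)
    then have exp_s: "exp (s * \<kappa>) \<le> 1 / \<theta>" using \<theta> by (metis exp_le_cancel_iff exp_ln zero_less_divide_1_iff)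
    \<comment> \<open>\<open>W0\<close> is the part of \<open>exp (s * real (N i))\<close>
      independent of \<open>i\<close>. In \<open>W\<close>, the 2 comes from the difference estimate
      and \<open>r ^ 2\<close> in the denominator repairs the Klingen exponent, which falls short of
      \<open>j\<close> by one or two.\<close>
    define W0 where "W0 = exp (s * (2 * \<kappa> + 1))"
    define W where "W = 2 * W0 / r ^ 2"
    have W0: "W0 > 0" by (simp add: W0_def)
    have W: "W > 0" using W0 r by (simp add: W_def)
    have W_r2: "2 * W0 = W * r ^ 2" using r by (simp add: W_def)
    show "\<exists>\<phi>\<in>C0 G_Sp4. \<forall>C>0. \<forall>c.
      continuous_on (carrier (G_Sp4 :: ('q fls^4^4) monoid)) c \<and> biinvariant G_Sp4 K_Sp4 c \<and>
        (\<forall>n. schur_norm G_Sp4 L len n c \<le> ereal (C * exp (s * real n))) \<longrightarrow>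
        (\<exists>c_inf. \<forall>g\<in>carrier G_Sp4. cmod (c g - c_inf) \<le> C * \<phi> g)"
    proof (rule zigzag[OF \<theta>(1,2) W])
      fix A :: real
      assume A: "A > 0" and zig: "\<And>C (c :: nat \<Rightarrow> nat \<Rightarrow> complex). C > 0 \<Longrightarrow>
        (\<And>i j. j \<le> i \<Longrightarrow> cmod (c i j) \<le> C * W * (1/\<theta>) ^ i) \<Longrightarrow>
        (\<And>i j. j < i \<Longrightarrow> cmod (c i j - c i (Suc j)) \<le> C * W * (1/\<theta>) ^ i * (\<theta>^8) ^ (i - j)) \<Longrightarrow>
        (\<And>i j. 1 \<le> j \<Longrightarrow> j \<le> i \<Longrightarrow> cmod (c i j - c (Suc i) (j - 1)) \<le> C * W * (1/\<theta>) ^ i * (\<theta>^8) ^ j) \<Longrightarrow>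
        \<exists>l. \<forall>i j. j \<le> i \<longrightarrow> cmod (c i j - l) \<le> C * (A * \<theta> ^ i)"
      show ?thesis
      proof (intro bexI[OF _ power_height_C0[OF \<theta>(1,2) A]] allI impI, elim conjE)
        fix C :: real and c :: "'q fls^4^4 \<Rightarrow> complex"
        assume C: "C > 0" and K: "biinvariant G_Sp4 K_Sp4 c"
          and schur: "\<forall>n. schur_norm G_Sp4 L len n c \<le> ereal (C * exp (s * real n))"
        \<comment> \<open>A radius that covers heights up to \<open>Suc i\<close>, because the
          Klingen move ends there.\<close>
        define N where "N i = nat \<lceil>\<kappa> * (real i + 2)\<rceil>" for i
        define E where "E i = C * exp (s * real (N i))" for i
        have sb: "schur_bound L len (N i) c (E i) (Suc i)" for i
        proof (rule schur_bound.intro)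
          show "discrete_group (G_Sp4\<lparr>carrier := L\<rparr>)" using discrete_group_subgroup L by blast
          show "schur_norm G_Sp4 L len (N i) c \<le> ereal (E i)" using schur by (simp add: E_def)
          fix i' j' and g :: "'q fls^4^4" assume *: "j' \<le> i'" "i' \<le> Suc i" "K_equiv g (Cartan_mat i' j')"
          have "len g \<le> \<kappa> * (real i' + 1)" using \<kappa>(2) * by blast
          also have "\<dots> \<le> \<kappa> * (real i + 2)" using *(2) \<kappa>(1) by (intro mult_left_mono) auto
          also have "\<dots> \<le> real (N i)" unfolding N_def by linarith
          finally show "g \<in> length_ball G_Sp4 len (N i)"
            using K_equiv_in_Sp4[OF *(3) Cartan_mat_in_Sp4] by (simp add: length_ball_def)
        qed (use K L in auto)
        have E0: "E i \<ge> 0" for i using C by (simp add: E_def)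
        have E: "E i \<le> C * W0 * (1 / \<theta>) ^ i" for i
        proof -
          have "real (N i) \<le> \<kappa> * (real i + 2) + 1"
          proof -
            have "0 \<le> \<kappa> * (real i + 2)" using \<kappa>(1) by simp
            then have "real (N i) = of_int \<lceil>\<kappa> * (real i + 2)\<rceil>" by (simp add: N_def)
            then show ?thesis by linarith
          qed
          then have "s * real (N i) \<le> s * (\<kappa> * (real i + 2) + 1)" using s by (intro mult_left_mono)
          then have "exp (s * real (N i)) \<le> exp (s * (2 * \<kappa> + 1) + real i * (s * \<kappa>))"
            by (simp add: algebra_simps)
          also have "\<dots> = W0 * exp (s * \<kappa>) ^ i" by (simp add: W0_def exp_add exp_of_nat_mult)
          also have "\<dots> \<le> W0 * (1 / \<theta>) ^ i"
            using exp_s W0 by (intro mult_left_mono power_mono) auto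
          finally show ?thesis using C by (simp add: E_def)
        qed
        have E2: "2 * E i \<le> C * W * (1 / \<theta>) ^ i * r ^ 2" for i
        proof -
          have "2 * E i \<le> C * (2 * W0) * (1 / \<theta>) ^ i" using E[of i] by simp
          then show ?thesis unfolding W_r2 by (simp add: mult_ac)
        qed
        have "\<exists>l. \<forall>i j. j \<le> i \<longrightarrow> cmod (c (Cartan_mat i j) - l) \<le> C * (A * \<theta> ^ i)"
        proof (rule zig[OF C])
          have r2: "r ^ 2 \<le> 1" "r ^ 2 \<le> r" using r by (simp_all add: power_le_one power2_eq_square mult_le_one)
          have pos: "0 \<le> C * W * (1 / \<theta>) ^ i" for i using C W \<theta> by simp
          show "cmod (c (Cartan_mat i j)) \<le> C * W * (1 / \<theta>) ^ i" if "j \<le> i" for i j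
          proof -
            from that have "cmod (c (Cartan_mat i j)) \<le> E i"
              using schur_bound.point_bound[OF sb] by simp
            also have "\<dots> \<le> C * W * (1 / \<theta>) ^ i"
              using E2[of i] E0[of i] mult_left_mono[OF r2(1) pos[of i]] by linarith
            finally show ?thesis .
          qed
          show "cmod (c (Cartan_mat i j) - c (Cartan_mat i (Suc j))) \<le> C * W * (1 / \<theta>) ^ i * (\<theta> ^ 8) ^ (i - j)"
            if "j < i" for i j
          proof -
            from that have "cmod (c (Cartan_mat i j) - c (Cartan_mat i (Suc j))) \<le> 2 * r ^ (i - j) * E i"
              unfolding r_def by (intro schur_bound.Siegel_move[OF sb two]) auto
            also have "\<dots> = (2 * E i) * r ^ (i - j)" by simp
            also have "\<dots> \<le> C * W * (1 / \<theta>) ^ i * r ^ (i - j)"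
              using E2[of i] mult_left_mono[OF r2(1) pos[of i]] r by (intro mult_right_mono) auto
            finally show ?thesis by (simp add: \<theta>(3))
          qed
          show "cmod (c (Cartan_mat i j) - c (Cartan_mat (Suc i) (j - 1))) \<le> C * W * (1 / \<theta>) ^ i * (\<theta> ^ 8) ^ j"
            if j: "1 \<le> j" "j \<le> i" for i j
          proof -
            define p m where "p = (i + j) mod 2" and "m = (i + j) div 2"
            have pm: "i + j = 2 * m + p" "p \<le> 1" by (auto simp: p_def m_def)
            show ?thesis
            \<comment> \<open>The Klingen move requires \<open>Suc i \<le> 2 * m\<close>, which is
              \<open>p + 1 \<le> j\<close>. Only \<open>j = 1\<close> with \<open>p = 1\<close> is
              excluded, and there the pointwise bound suffices.\<close>
            proof (cases "p + 1 \<le> j")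
              case True
              have mi: "m + p \<le> i" "Suc i \<le> 2 * m" using pm j True by presburger+
              have eq: "2 * m + p - i = j" "2 * m + p - Suc i = j - 1" using pm j by auto
              have "cmod (c (Cartan_mat i j) - c (Cartan_mat (Suc i) (j - 1))) \<le> 2 * r ^ (2 * m - Suc i) * E i"
                using schur_bound.Klingen_move[OF sb pm(2) mi order_refl] unfolding eq r_def .
              also have "\<dots> = (2 * E i) * r ^ (2 * m - Suc i)" by simp
              also have "\<dots> \<le> (C * W * (1 / \<theta>) ^ i * r ^ 2) * r ^ (2 * m - Suc i)"
                using E2 r by (intro mult_right_mono) auto
              also have "\<dots> = C * W * (1 / \<theta>) ^ i * r ^ (2 + (2 * m - Suc i))"
                by (simp only: power_add mult.assoc)
              also have "\<dots> \<le> C * W * (1 / \<theta>) ^ i * r ^ j"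
                using pos r pm True by (intro mult_left_mono power_decreasing) auto
              finally show ?thesis by (simp add: \<theta>(3))
            next
              case False
              then have j1: "j = 1" using j pm by simp
              have "cmod (c (Cartan_mat i j) - c (Cartan_mat (Suc i) (j - 1))) \<le>
                  cmod (c (Cartan_mat i j)) + cmod (c (Cartan_mat (Suc i) (j - 1)))"
                by (rule norm_triangle_ineq4)
              also have "\<dots> \<le> E i + E i"
                using j by (intro add_mono schur_bound.point_bound[OF sb]) auto
              also have "\<dots> \<le> C * W * (1 / \<theta>) ^ i * r"
                using E2[of i] mult_left_mono[OF r2(2) pos[of i]] by simp
              finally show ?thesis by (simp add: \<theta>(3) j1)
            qed
          qed
        qed
        then obtain l where l: "\<And>i j. j \<le> i \<Longrightarrow> cmod (c (Cartan_mat i j) - l) \<le> C * (A * \<theta> ^ i)" by blast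
        show "\<exists>c_inf. \<forall>g\<in>carrier G_Sp4. cmod (c g - c_inf) \<le> C * (A * \<theta> ^ height g)"
        proof (intro exI[of _ l] ballI)
          fix g :: "'q fls^4^4" assume "g \<in> carrier G_Sp4"
          then have "g \<in> Sp4 UNIV" by simp
          then obtain i j where ij: "j \<le> i" "K_equiv g (Cartan_mat i j)"
            by (rule Cartan_decomposition)
          then show "cmod (c g - l) \<le> C * (A * \<theta> ^ height g)"
            using l[OF ij(1)] height_eq[OF ij] schur_bound.c_K_equiv[OF sb ij(2)] by simp
        qed
      qed
    qed
  qed
qed

theorem theorem1p2:
  assumes "CHAR('q::{field,finite}) \<noteq> 2"
  shows "has_T_Schur (G_Sp4 :: ('q fls^4^4) monoid) K_Sp4 H_Sp4 \<and>
         has_T_Schur (G_Sp4 :: ('q fls^4^4) monoid) K_Sp4 Gamma_Sp4"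
proof -
  have two: "(2 :: 'q) \<noteq> 0"
  proof
    assume "(2 :: 'q) = 0"
    then have "CHAR('q) dvd 2" using of_nat_eq_0_iff_char_dvd[of 2, where 'a = 'q] by simp
    then have "CHAR('q) = 1 \<or> CHAR('q) = 2" using prime_nat_iff two_is_prime_nat by blast
    then show False using assms CHAR_not_1 by auto
  qed
  have "H_Sp4 \<subseteq> (Gamma_Sp4 :: ('q fls^4^4) set)" by (auto simp: H_Sp4_def)
  then show ?thesis
    using has_T_Schur_Sp4[OF two] subgroup_H_Sp4 subgroup_Gamma_Sp4 by blast
qed

end
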